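(* Let $P_1,P_2,\ldots,P_n$ be skew-symmetric $4\times 4$-matrices of unknowns (Plücker coordinates) that represent lines in $\mathbb{P}^3$, let $P_1^*,\ldots,P_n^*$ be the dual matrices, and let $I_n$ be the prime ideal of the concurrent lines variety $V_n\subset(\mathbb{P}^5)^n$ in the polynomial ring in the $6n$ Plücker coordinates. Then $I_n$ is minimally generated by the $\binom{n+1}{2}$ quadrics $\operatorname{trace}(P_iP_j^* )$ ($1\le i\le j\le n$) together with the $10\binom{n}{3}$ cubics obtained as $3\times 3$-minors of the $4\times n$ matrix $\bigl(P_1u,P_2u,\ldots,P_nu\bigr)$, where $u$ runs over the ten vectors $\{e_1,e_2,e_3,e_4,e_1+e_2,e_1+e_3,e_1+e_4,e_2+e_3,e_2+e_4,e_3+e_4\}$. Moreover, for the reverse lexicographic order, the reduced Gröbner basis of $I_n$ consists of $\binom{n+1}{2}$ quadrics, $12\binom{n}{3}$ cubics and $4\binom{n+1}{4}$ quartics. Their leading terms are squarefree, so the initial ideal is radical.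
   Context: Work over $\mathbb{C}$. A line in $\mathbb{P}^3$ through points $x,y$ has Plücker coordinates $p_{ij}=x_iy_j-x_jy_i$, $0\le i<j\le 3$; this identifies $\mathrm{Gr}(1,\mathbb{P}^3)$ with the quadric $p_{03}p_{12}-p_{02}p_{13}+p_{01}p_{23}=0$ in $\mathbb{P}^5$. To Plücker coordinates $p$ one associates the matrices $$P=\begin{bmatrix} 0 & p_{23} & -p_{13} & p_{12} \\ -p_{23} & 0 & p_{03} & -p_{02} \\ {p_{13}} & -p_{03} & 0 & p_{01} \\ -p_{12} & p_{02} & -p_{01} & 0 \end{bmatrix},\qquad P^*=\begin{bmatrix} 0 & p_{01} & p_{02} & p_{03} \\ -p_{01} & 0 & p_{12} & p_{13} \\ -p_{02} & -p_{12} & 0 & p_{23} \\ -p_{03} & -p_{13} & -p_{23} & 0 \end{bmatrix}.$$ A point $x$ lies on the line $p$ iff $Px=0$. The concurrent lines variety $V_n\subset \mathrm{Gr}(1,\mathbb{P}^3)^n\subset(\mathbb{P}^5)^n$ is the set of ordered $n$-tuples of lines in $\mathbb{P}^3$ that all pass through a common point; $I_n$ is its $\mathbb{Z}^n$-graded prime ideal. Cubic convention: for each $u$ in the list and each triple $i<j<k$, the four $3\times3$-minors of $(P_iu,P_ju,P_ku)$ coincide up to sign or vanish, so each pair ($u$, triple) contributes one cubic. Monomial order: the (degree) reverse lexicographic order in which the variables of line $1$ are larger than those of line $2$, and so on, and within each line $p_{01}>p_{02}>p_{03}>p_{12}>p_{13}>p_{23}$. *)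

theory Defs
  imports
    Complex_Main
    "HOL-Algebra.Ideal"
    "Jordan_Normal_Form.Determinant"
    "Jordan_Normal_Form.DL_Submatrix"
    "HOL-Library.Poly_Mapping"
begin

(* the short names are otherwise taken by another imported theory *)
alias lookup = Poly_Mapping.lookup
alias keys = Poly_Mapping.keys

section \<open>The polynomial ring in the Pluecker coordinates\<close>

text \<open>
  \<open>Coord l i j\<close> is the unknown \<open>p\<^sub>i\<^sub>j\<close> of line number \<open>l\<close>. Lines are numbered \<open>0, \<dots>, n - 1\<close> and the
  coordinates of projective 3-space are numbered \<open>0, \<dots>, 3\<close>. The linear order is the order of the
  unknowns that underlies the monomial order: unknowns of earlier lines are larger, and within a
  line \<open>p\<^sub>0\<^sub>1 > p\<^sub>0\<^sub>2 > p\<^sub>0\<^sub>3 > p\<^sub>1\<^sub>2 > p\<^sub>1\<^sub>3 > p\<^sub>2\<^sub>3\<close>.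
\<close>

datatype coord = Coord (line: nat) (fst_index: nat) (snd_index: nat)

instantiation coord :: linorder
begin

definition less_coord :: "coord \<Rightarrow> coord \<Rightarrow> bool" where
  "v < w \<longleftrightarrow> line w < line v \<or> line w = line v \<and>
     (fst_index w < fst_index v \<or> fst_index w = fst_index v \<and> snd_index w < snd_index v)"

definition less_eq_coord :: "coord \<Rightarrow> coord \<Rightarrow> bool" where
  "(v :: coord) \<le> w \<longleftrightarrow> v < w \<or> v = w"

instance
proof
  fix x y z :: coord
  show "(x < y) = (x \<le> y \<and> \<not> y \<le> x)"
    by (auto simp: less_coord_def less_eq_coord_def)
  show "x \<le> x"
    by (simp add: less_eq_coord_def)
  show "x \<le> z" if "x \<le> y" "y \<le> z"
    using that by (auto simp: less_coord_def less_eq_coord_def)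
  show "x = y" if "x \<le> y" "y \<le> x"
    using that by (auto simp: less_coord_def less_eq_coord_def)
  show "x \<le> y \<or> y \<le> x"
    by (cases x; cases y) (auto simp: less_coord_def less_eq_coord_def)
qed

end

type_synonym monomial = "coord \<Rightarrow>\<^sub>0 nat"
type_synonym mpoly = "monomial \<Rightarrow>\<^sub>0 complex"

definition var :: "coord \<Rightarrow> mpoly" where
  "var v = Poly_Mapping.single (Poly_Mapping.single v 1) 1"

definition eval :: "(coord \<Rightarrow> complex) \<Rightarrow> mpoly \<Rightarrow> complex" where
  "eval a f = (\<Sum>m\<in>keys f. lookup f m * (\<Prod>v\<in>keys m. a v ^ lookup m v))"

definition coords :: "nat \<Rightarrow> coord set" where
  "coords n = {Coord l i j | l i j. l < n \<and> i < j \<and> j < 4}"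

definition poly_ring :: "nat \<Rightarrow> mpoly ring" where
  "poly_ring n = \<lparr>carrier = {f. \<forall>m\<in>keys f. keys m \<subseteq> coords n},
     monoid.mult = (*), one = 1, ring.zero = 0, add = (+)\<rparr>"

definition homogeneous :: "nat \<Rightarrow> mpoly \<Rightarrow> bool" where
  "homogeneous d f \<longleftrightarrow> (\<forall>m\<in>keys f. (\<Sum>v\<in>keys m. lookup m v) = d)"

definition multihomogeneous :: "(nat \<Rightarrow> nat) \<Rightarrow> mpoly \<Rightarrow> bool" where
  "multihomogeneous d f \<longleftrightarrow>
     (\<forall>m\<in>keys f. \<forall>l. (\<Sum>v\<in>{v\<in>keys m. line v = l}. lookup m v) = d l)"


section \<open>Concurrent lines\<close>

text \<open>
  A point of projective space is given by its homogeneous coordinates, any nonzero vector.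
\<close>

definition proj_point :: "complex vec \<Rightarrow> bool" where
  "proj_point x \<longleftrightarrow> x \<in> carrier_vec 4 \<and> x \<noteq> 0\<^sub>v 4"

definition same_point :: "complex vec \<Rightarrow> complex vec \<Rightarrow> bool" where
  "same_point x y \<longleftrightarrow> (\<exists>c. c \<noteq> 0 \<and> y = c \<cdot>\<^sub>v x)"

definition on_line :: "complex vec \<Rightarrow> complex vec \<Rightarrow> complex vec \<Rightarrow> bool" where
  "on_line x y z \<longleftrightarrow> (\<exists>s t. z = s \<cdot>\<^sub>v x + t \<cdot>\<^sub>v y)"

definition pluecker :: "complex vec \<Rightarrow> complex vec \<Rightarrow> nat \<Rightarrow> nat \<Rightarrow> complex" where
  "pluecker x y i j = x $ i * y $ j - x $ j * y $ i"

text \<open>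
  The concurrent lines variety, as the set of all choices \<open>a\<close> of homogeneous coordinates, in
  the product of \<open>n\<close> projective 5-spaces, of its points. The factor \<open>c\<close> makes all representatives of
  the \<open>l\<close>-th line explicit. Values of \<open>a\<close> outside \<^term>\<open>coords n\<close> are irrelevant.
\<close>

definition concurrent_lines :: "nat \<Rightarrow> (coord \<Rightarrow> complex) set" where
  "concurrent_lines n = {a. \<exists>z. proj_point z \<and>
     (\<forall>l<n. \<exists>x y c. proj_point x \<and> proj_point y \<and> \<not> same_point x y \<and> on_line x y z \<and> c \<noteq> 0 \<and>
        (\<forall>i j. i < j \<and> j < 4 \<longrightarrow> a (Coord l i j) = c * pluecker x y i j))}"

text \<open>
  As usual for subvarieties of a product of projective spaces, the ideal is generated by the
  multihomogeneous polynomials that vanish on the variety.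
\<close>

definition concurrent_ideal :: "nat \<Rightarrow> mpoly set" where
  "concurrent_ideal n = genideal (poly_ring n)
     {f \<in> carrier (poly_ring n). (\<exists>d. multihomogeneous d f) \<and> (\<forall>a\<in>concurrent_lines n. eval a f = 0)}"


section \<open>The quadrics and the cubics\<close>

definition P_mat :: "nat \<Rightarrow> mpoly mat" where
  "P_mat l = (let p = (\<lambda>i j. var (Coord l i j)) in mat_of_rows_list 4
     [[      0,   p 2 3, - p 1 3,   p 1 2],
      [- p 2 3,       0,   p 0 3, - p 0 2],
      [  p 1 3, - p 0 3,       0,   p 0 1],
      [- p 1 2,   p 0 2, - p 0 1,       0]])"

definition P_dual :: "nat \<Rightarrow> mpoly mat" where
  "P_dual l = (let p = (\<lambda>i j. var (Coord l i j)) in mat_of_rows_list 4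
     [[      0,   p 0 1,   p 0 2,   p 0 3],
      [- p 0 1,       0,   p 1 2,   p 1 3],
      [- p 0 2, - p 1 2,       0,   p 2 3],
      [- p 0 3, - p 1 3, - p 2 3,       0]])"

definition mat_trace :: "'a :: comm_monoid_add mat \<Rightarrow> 'a" where
  "mat_trace A = (\<Sum>i<dim_row A. A $$ (i, i))"

definition quadrics :: "nat \<Rightarrow> mpoly set" where
  "quadrics n = {mat_trace (P_mat i * P_dual j) | i j. i \<le> j \<and> j < n}"

definition ten_vectors :: "mpoly vec set" where
  "ten_vectors = {unit_vec 4 a | a. a < 4} \<union>
     {unit_vec 4 a + unit_vec 4 b | a b. a < b \<and> b < 4}"

definition concurrent_mat :: "nat \<Rightarrow> mpoly vec \<Rightarrow> mpoly mat" where
  "concurrent_mat n u = mat_of_cols 4 (map (\<lambda>l. P_mat l *\<^sub>v u) [0..<n])"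

text \<open>
  \<open>minor n u r J\<close> is the 3 by 3 minor of \<open>(P\<^sub>1u, \<dots>, P\<^sub>nu)\<close> with columns \<open>J\<close> and all rows but \<open>r\<close>.
\<close>

definition minor :: "nat \<Rightarrow> mpoly vec \<Rightarrow> nat \<Rightarrow> nat set \<Rightarrow> mpoly" where
  "minor n u r J = det (submatrix (concurrent_mat n u) ({..<4} - {r}) J)"

definition triples :: "nat \<Rightarrow> nat set set" where
  "triples n = {J. J \<subseteq> {..<n} \<and> card J = 3}"

text \<open>
  For given \<open>u\<close> and \<open>J\<close> the four minors coincide up to sign or vanish. The representative chosen here
  omits the row of the first nonzero entry of \<open>u\<close>; this minor does not vanish.
\<close>

definition cubic :: "nat \<Rightarrow> mpoly vec \<Rightarrow> nat set \<Rightarrow> mpoly" where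
  "cubic n u J = minor n u (LEAST a. u $ a \<noteq> 0) J"

definition cubics :: "nat \<Rightarrow> mpoly set" where
  "cubics n = {cubic n u J | u J. u \<in> ten_vectors \<and> J \<in> triples n}"

definition minimally_generates :: "nat \<Rightarrow> mpoly set \<Rightarrow> mpoly set \<Rightarrow> bool" where
  "minimally_generates n G I \<longleftrightarrow> G \<subseteq> carrier (poly_ring n) \<and> genideal (poly_ring n) G = I \<and>
     (\<forall>H. H \<subset> G \<longrightarrow> genideal (poly_ring n) H \<noteq> I)"


section \<open>Groebner bases for the degree reverse lexicographic order\<close>

definition degrevlex_less :: "monomial \<Rightarrow> monomial \<Rightarrow> bool" where
  "degrevlex_less m m' \<longleftrightarrow>
     (let deg = (\<lambda>k. \<Sum>v\<in>keys k. lookup k v) in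
       deg m < deg m' \<or> deg m = deg m' \<and>
       (\<exists>v. lookup m v > lookup m' v \<and> (\<forall>w<v. lookup m w = lookup m' w)))"

definition lead_mon :: "mpoly \<Rightarrow> monomial" where
  "lead_mon f = (THE m. m \<in> keys f \<and> (\<forall>m'\<in>keys f. m' \<noteq> m \<longrightarrow> degrevlex_less m' m))"

definition initial_ideal :: "nat \<Rightarrow> mpoly set \<Rightarrow> mpoly set" where
  "initial_ideal n I =
     genideal (poly_ring n) {Poly_Mapping.single (lead_mon f) 1 | f. f \<in> I \<and> f \<noteq> 0}"

definition groebner_basis :: "nat \<Rightarrow> mpoly set \<Rightarrow> mpoly set \<Rightarrow> bool" where
  "groebner_basis n I G \<longleftrightarrow> finite G \<and> G \<subseteq> I \<and> 0 \<notin> G \<and>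
     genideal (poly_ring n) {Poly_Mapping.single (lead_mon g) 1 | g. g \<in> G} = initial_ideal n I"

definition mon_dvd :: "monomial \<Rightarrow> monomial \<Rightarrow> bool" where
  "mon_dvd m m' \<longleftrightarrow> (\<exists>k. m' = m + k)"

definition reduced_groebner_basis :: "nat \<Rightarrow> mpoly set \<Rightarrow> mpoly set \<Rightarrow> bool" where
  "reduced_groebner_basis n I G \<longleftrightarrow> groebner_basis n I G \<and>
     (\<forall>g\<in>G. lookup g (lead_mon g) = 1 \<and>
        (\<forall>h\<in>G - {g}. \<forall>m\<in>keys g. \<not> mon_dvd (lead_mon h) m))"

definition squarefree_mon :: "monomial \<Rightarrow> bool" where
  "squarefree_mon m \<longleftrightarrow> (\<forall>v. lookup m v \<le> 1)"

definition radical_ideal :: "nat \<Rightarrow> mpoly set \<Rightarrow> bool" where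
  "radical_ideal n I \<longleftrightarrow> ideal I (poly_ring n) \<and>
     (\<forall>f\<in>carrier (poly_ring n). \<forall>k::nat. f [^]\<^bsub>poly_ring n\<^esub> k \<in> I \<longrightarrow> f \<in> I)"

end

theory Submission
  imports Defs "HOL-Computational_Algebra.Polynomial"
begin

text \<open>
  The ideal \<open>I\<^sub>n\<close> is the kernel of \<open>p\<^sub>l \<mapsto> z \<and> y\<^sub>l\<close>. A monomial is standard if none of the proposed
  leading monomials divides it. The standard monomials are linearly independent as functions of
  \<open>(z, y)\<close>: lines are peeled off from the last to the first, and on each line the smallest unknown
  that does not vanish is set to zero, which leads to the Schubert divisors in the variety of pairs
  of a point and a line through it. On the other hand, explicit combinations of the quadrics and the
  cubics have the proposed leading monomials, so every polynomial is congruent to a combination of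
  standard ones modulo the ideal of the quadrics and cubics. Therefore this ideal is the whole kernel
  and the proposed monomials generate its initial ideal. No generator is redundant: a quadric is
  detected by a point at which only two unknowns are nonzero, and the cubics are separated by triples
  of coplanar lines in a plane \<open>h\<close>, where the quadrics vanish and the cubic of \<open>u\<close> becomes a multiple
  of \<open>(h \<bullet> u)\<^sup>2\<close>.
\<close>

\<comment> \<open>S-pairs, a family growing with the number of lines, are avoided by a sandwich.
  Standard monomials have two descriptions: \<open>face\<close>, the runs of an automaton with four
  states, fits the geometric descent that proves independence, and \<open>nonfaces\<close> fits
  division. Only \<open>nonface_cover\<close>, that a set without nonfaces is accepted, is
  combinatorial. The converse comes from algebra: each nonface is the leading monomial of an ideal
  element, and a standard leading monomial would leave, once the lower terms are reduced, a
  nontrivial relation between standard monomials.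

  The states arise as follows. Setting the smallest unknowns of the last line to zero lowers its
  Schubert variety until the whole line vanishes, so that y_l is 0 or parallel to z. On the other
  lines the same problem remains, with z confined to the span of e_0, ..., e_k; hence the induction
  treats all four flag steps at once. The descent cuts by the smallest unknown first because in the
  reverse lexicographic order such cuts are compatible with taking leading monomials.\<close>
alias single = Poly_Mapping.single

abbreviation "polys n \<equiv> carrier (poly_ring n)"

section \<open>Polynomials as finitely supported functions\<close>

lemma keys_add_mon: "keys (m + k) = keys m \<union> keys k" for m k :: monomial
  by (auto simp: in_keys_iff lookup_add)

lemma carrier_iff: "f \<in> polys n \<longleftrightarrow> (\<forall>m\<in>keys f. keys m \<subseteq> coords n)"
  by (simp add: poly_ring_def)

lemma mpoly_expand: "(\<Sum>m\<in>keys f. single m (lookup f m)) = f" for f :: mpoly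
  by (rule poly_mapping_eqI)
     (auto simp: lookup_sum lookup_single when_def sum.delta in_keys_iff)

section \<open>Evaluation of monomials and polynomials at points\<close>

definition mev :: "(coord \<Rightarrow> complex) \<Rightarrow> monomial \<Rightarrow> complex" where
  "mev a m = (\<Prod>v\<in>keys m. a v ^ lookup m v)"

lemma mev_superset:
  assumes "finite A" "keys m \<subseteq> A"
  shows "mev a m = (\<Prod>v\<in>A. a v ^ lookup m v)"
  unfolding mev_def using assms
  by (intro prod.mono_neutral_left) (auto simp: in_keys_iff)

lemma mev_add: "mev a (m + k) = mev a m * mev a k"
proof -
  have "mev a m = (\<Prod>v\<in>keys m \<union> keys k. a v ^ lookup m v)"
    "mev a k = (\<Prod>v\<in>keys m \<union> keys k. a v ^ lookup k v)"
    by (auto intro!: mev_superset)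
  then show ?thesis
    unfolding mev_def[of a "m + k"] keys_add_mon by (simp add: lookup_add power_add prod.distrib)
qed

lemma mev_0 [simp]: "mev a 0 = 1"
  by (simp add: mev_def)

lemma mev_single [simp]: "mev a (single v k) = a v ^ k"
  by (cases "k = 0") (simp_all add: mev_def)

lemma mev_eq_0: "v \<in> keys m \<Longrightarrow> a v = 0 \<Longrightarrow> mev a m = 0"
  by (auto simp: mev_def in_keys_iff intro!: prod_zero)

lemma mev_cong: "(\<And>v. v \<in> keys m \<Longrightarrow> a v = b v) \<Longrightarrow> mev a m = mev b m"
  by (auto simp: mev_def)

lemma eval_mev: "eval a f = (\<Sum>m\<in>keys f. lookup f m * mev a m)"
  by (simp add: eval_def mev_def)

lemma eval_superset:
  assumes "finite A" "keys f \<subseteq> A"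
  shows "eval a f = (\<Sum>m\<in>A. lookup f m * mev a m)"
  unfolding eval_mev using assms
  by (intro sum.mono_neutral_left) (auto simp: in_keys_iff)

lemma eval_0 [simp]: "eval a 0 = 0"
  by (simp add: eval_mev)

lemma eval_add [simp]: "eval a (f + g) = eval a f + eval a g"
proof -
  have "eval a (f + g) = (\<Sum>m\<in>keys f \<union> keys g. lookup (f + g) m * mev a m)"
    by (intro eval_superset) (auto simp: Poly_Mapping.keys_add)
  also have "\<dots> = eval a f + eval a g"
    using eval_superset[of "keys f \<union> keys g" f a] eval_superset[of "keys f \<union> keys g" g a]
    by (simp add: lookup_add algebra_simps sum.distrib)
  finally show ?thesis .
qed

lemma eval_sum [simp]: "eval a (sum f A) = (\<Sum>x\<in>A. eval a (f x))"
  by (induction A rule: infinite_finite_induct) auto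

lemma eval_single [simp]: "eval a (single m c) = c * mev a m"
  by (cases "c = 0") (simp_all add: eval_mev)

lemma eval_1 [simp]: "eval a 1 = 1"
  using eval_single[of a 0 1] by (simp del: eval_single)

lemma eval_mult [simp]: "eval a (f * g) = eval a f * eval a g"
proof -
  have "f * g = (\<Sum>m\<in>keys f. \<Sum>k\<in>keys g. single (m + k) (lookup f m * lookup g k))"
    by (subst mpoly_expand[of f, symmetric], subst mpoly_expand[of g, symmetric])
       (simp add: sum_product mult_single del: mpoly_expand)
  then have "eval a (f * g) = (\<Sum>m\<in>keys f. \<Sum>k\<in>keys g. lookup f m * mev a m * (lookup g k * mev a k))"
    by (simp add: mev_add mult_ac)
  also have "\<dots> = eval a f * eval a g"
    by (simp add: eval_mev sum_product)
  finally show ?thesis .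
qed

lemma eval_uminus [simp]: "eval a (- f) = - eval a f"
  using eval_add[of a f "- f"] by (simp add: add_eq_0_iff del: eval_add)

lemma eval_diff [simp]: "eval a (f - g) = eval a f - eval a g"
  using eval_add[of a f "- g"] by (simp del: eval_add)

lemma eval_prod [simp]: "eval a (prod f A) = (\<Prod>x\<in>A. eval a (f x))"
  by (induction A rule: infinite_finite_induct) auto

lemma eval_var [simp]: "eval a (var v) = a v"
  by (simp add: var_def)

lemma eval_numeral [simp]: "eval a (numeral k) = numeral k"
  using eval_single[of a 0 "numeral k"] by (simp del: eval_single)

lemma eval_cong:
  assumes "\<And>m v. m \<in> keys f \<Longrightarrow> v \<in> keys m \<Longrightarrow> a v = b v"
  shows "eval a f = eval b f"
  unfolding eval_mev by (intro sum.cong refl arg_cong2[of _ _ _ _ "(*)"] mev_cong assms)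

text \<open>Pulling back along a polynomial curve reduces questions about vanishing to the domain
  C[t].\<close>

lemma eval_curve:
  assumes "\<And>v. \<exists>p. \<forall>t. A t v = poly p t"
  shows "\<exists>p. \<forall>t. eval (A t) f = poly p t"
proof -
  from assms obtain p where p: "\<And>v t. A t v = poly (p v) t" by metis
  have "eval (A t) f = poly (\<Sum>m\<in>keys f. [:lookup f m:] * (\<Prod>v\<in>keys m. p v ^ lookup m v)) t" for t
    by (simp add: eval_def p poly_sum poly_prod)
  then show ?thesis by blast
qed

text \<open>Relations are split by monomials: at a point where all monomials outside
  \<open>B\<close> vanish, f and \<open>restr B f\<close> take the same value.\<close>

definition restr :: "monomial set \<Rightarrow> mpoly \<Rightarrow> mpoly" where
  "restr B f = (\<Sum>m\<in>keys f \<inter> B. single m (lookup f m))"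

lemma lookup_restr: "lookup (restr B f) m = (if m \<in> B then lookup f m else 0)"
  by (auto simp: restr_def lookup_sum lookup_single when_def sum.delta in_keys_iff)

lemma keys_restr [simp]: "keys (restr B f) = keys f \<inter> B"
  by (auto simp: in_keys_iff lookup_restr split: if_splits)

lemma restr_split: "f = restr B f + restr (- B) f"
  by (rule poly_mapping_eqI) (auto simp: lookup_add lookup_restr)

lemma eval_restr_split: "eval a f = eval a (restr B f) + eval a (restr (- B) f)"
  using arg_cong[OF restr_split[of f B], of "eval a"] by (simp only: eval_add)

lemma keys_mult_mon:
  fixes f g :: mpoly
  assumes "k \<in> keys (f * g)"
  obtains m m' where "m \<in> keys f" "m' \<in> keys g" "k = m + m'"
  using keys_mult[of f g] assms by blast

section \<open>The polynomial ring and its ideals\<close>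

lemma cring_poly_ring: "cring (poly_ring n)"
proof (rule cringI)
  have minus: "\<exists>y\<in>polys n. y + x = 0" if "x \<in> polys n" for x
    using that by (intro bexI[of _ "- x"]) (auto simp: carrier_iff in_keys_iff)
  show "abelian_group (poly_ring n)"
  proof (rule abelian_groupI)
    show "\<exists>y\<in>polys n. y \<oplus>\<^bsub>poly_ring n\<^esub> x = \<zero>\<^bsub>poly_ring n\<^esub>"
      if "x \<in> polys n" for x
      using minus[OF that] by (simp add: poly_ring_def)
  qed (use Poly_Mapping.keys_add in \<open>fastforce simp: poly_ring_def add_ac\<close>)+
  show "Group.comm_monoid (poly_ring n)"
  proof (rule comm_monoidI)
    show "x \<otimes>\<^bsub>poly_ring n\<^esub> y \<in> polys n"
      if "x \<in> polys n" "y \<in> polys n" for x y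
      using that by (fastforce simp: poly_ring_def keys_add_mon elim!: keys_mult_mon)
  qed (auto simp: poly_ring_def mult_ac)
qed (auto simp: poly_ring_def algebra_simps)

lemma poly_ring_simps [simp]:
  "f \<otimes>\<^bsub>poly_ring n\<^esub> g = f * g" "f \<oplus>\<^bsub>poly_ring n\<^esub> g = f + g"
  "\<one>\<^bsub>poly_ring n\<^esub> = 1" "\<zero>\<^bsub>poly_ring n\<^esub> = 0"
  by (simp_all add: poly_ring_def)

lemma pow_poly_ring [simp]: "f [^]\<^bsub>poly_ring n\<^esub> (k::nat) = f ^ k"
  by (induction k) (simp_all add: nat_pow_def mult_ac)

lemma carrier_0: "0 \<in> polys n" and carrier_1: "1 \<in> polys n"
  by (simp_all add: carrier_iff)

lemma carrier_add: "f \<in> polys n \<Longrightarrow> g \<in> polys n \<Longrightarrow> f + g \<in> polys n"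
  using Poly_Mapping.keys_add[of f g] by (auto simp: carrier_iff)

lemma carrier_uminus: "f \<in> polys n \<Longrightarrow> - f \<in> polys n"
  by (auto simp: carrier_iff in_keys_iff)

lemma carrier_diff: "f \<in> polys n \<Longrightarrow> g \<in> polys n \<Longrightarrow> f - g \<in> polys n"
  using carrier_add[of f n "- g"] carrier_uminus[of g n] by simp

lemma carrier_mult: "f \<in> polys n \<Longrightarrow> g \<in> polys n \<Longrightarrow> f * g \<in> polys n"
  by (fastforce simp: carrier_iff keys_add_mon elim!: keys_mult_mon)

lemma carrier_single: "keys m \<subseteq> coords n \<Longrightarrow> single m c \<in> polys n"
  by (auto simp: carrier_iff)

lemma carrier_const: "single 0 c \<in> polys n"
  by (intro carrier_single) simp

lemma carrier_var: "v \<in> coords n \<Longrightarrow> var v \<in> polys n"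
  unfolding var_def by (intro carrier_single) simp

lemma carrier_restr: "f \<in> polys n \<Longrightarrow> restr B f \<in> polys n"
  by (auto simp: carrier_iff)

lemma ideal_poly_ringI:
  assumes "I \<subseteq> polys n" "0 \<in> I" "\<And>f g. f \<in> I \<Longrightarrow> g \<in> I \<Longrightarrow> f + g \<in> I"
    and mult: "\<And>f g. f \<in> polys n \<Longrightarrow> g \<in> I \<Longrightarrow> f * g \<in> I"
  shows "ideal I (poly_ring n)"
proof (rule idealI)
  interpret cring "poly_ring n" by (rule cring_poly_ring)
  show "ring (poly_ring n)" by (rule ring_axioms)
  have m1: "- f \<in> I" if "f \<in> I" for f
    using mult[OF carrier_uminus[OF carrier_1] that] by simp
  have inv: "\<ominus>\<^bsub>poly_ring n\<^esub> f = - f" if "f \<in> I" for f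
    using assms(1) that m1[OF that] by (intro minus_equality) (auto)
  show "subgroup I (add_monoid (poly_ring n))"
  proof (rule subgroup.intro)
    fix x assume "x \<in> I"
    then show "inv\<^bsub>add_monoid (poly_ring n)\<^esub> x \<in> I"
      using inv[of x] m1[of x] by (simp only: a_inv_def)
  qed (use assms in auto)
qed (simp_all add: mult, metis mult mult.commute)

lemma ideal_poly_ringD:
  assumes "ideal I (poly_ring n)"
  shows ideal_carrier: "f \<in> I \<Longrightarrow> f \<in> polys n"
    and ideal_0: "0 \<in> I"
    and ideal_add: "f \<in> I \<Longrightarrow> g \<in> I \<Longrightarrow> f + g \<in> I"
    and ideal_mult: "f \<in> I \<Longrightarrow> g \<in> polys n \<Longrightarrow> g * f \<in> I"
    and ideal_uminus: "f \<in> I \<Longrightarrow> - f \<in> I"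
    and ideal_diff: "f \<in> I \<Longrightarrow> g \<in> I \<Longrightarrow> f - g \<in> I"
proof -
  interpret ideal I "poly_ring n" by (rule assms)
  show "f \<in> I \<Longrightarrow> f \<in> polys n" by (rule a_Hcarr)
  show "0 \<in> I" using additive_subgroup.zero_closed[OF is_additive_subgroup] by simp
  show add: "f + g \<in> I" if "f \<in> I" "g \<in> I" for f g using that additive_subgroup.a_closed[OF is_additive_subgroup, of f g] by simp
  show mult: "g * f \<in> I" if "f \<in> I" "g \<in> polys n" for f g
    using I_l_closed[OF that] by simp
  show um: "- f \<in> I" if "f \<in> I" for f
    using mult[OF that carrier_uminus[OF carrier_1]] by simp
  show "f - g \<in> I" if "f \<in> I" "g \<in> I"
    using add[OF that(1) um[OF that(2)]] by simp
qed

lemma ideal_sum: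
  assumes "ideal I (poly_ring n)" "\<And>x. x \<in> A \<Longrightarrow> f x \<in> I"
  shows "sum f A \<in> I"
  using assms(2) by (induction A rule: infinite_finite_induct)
    (auto intro: ideal_0[OF assms(1)] ideal_add[OF assms(1)])

lemma ideal_genideal: "G \<subseteq> polys n \<Longrightarrow> ideal (genideal (poly_ring n) G) (poly_ring n)"
  using cring.axioms(1)[OF cring_poly_ring] by (rule ring.genideal_ideal)

lemma genideal_incl: "G \<subseteq> polys n \<Longrightarrow> G \<subseteq> genideal (poly_ring n) G"
  using cring.axioms(1)[OF cring_poly_ring] by (rule ring.genideal_self)

lemma genideal_least: "ideal I (poly_ring n) \<Longrightarrow> G \<subseteq> I \<Longrightarrow> genideal (poly_ring n) G \<subseteq> I"
  using cring.axioms(1)[OF cring_poly_ring] by (rule ring.genideal_minimal)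

section \<open>Divisibility of monomials and monomial ideals\<close>

lemma mon_dvd_iff: "mon_dvd m m' \<longleftrightarrow> (\<forall>v. lookup m v \<le> lookup m' v)"
proof
  assume *: "\<forall>v. lookup m v \<le> lookup m' v"
  have "m' = m + (m' - m)"
    by (rule poly_mapping_eqI) (use * in \<open>auto simp: lookup_add lookup_minus\<close>)
  then show "mon_dvd m m'" unfolding mon_dvd_def by blast
qed (auto simp: mon_dvd_def lookup_add)

lemma mon_dvd_refl: "mon_dvd m m"
  by (simp add: mon_dvd_iff)

lemma mon_dvd_trans: "mon_dvd a b \<Longrightarrow> mon_dvd b c \<Longrightarrow> mon_dvd a c"
  by (meson mon_dvd_iff order_trans)

text \<open>Every monomial of a product is a multiple of a monomial of either factor, so the
  right-hand side is an ideal. Comparing initial ideals thereby becomes a question of divisibility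
  of monomials.\<close>

lemma genideal_monomials:
  assumes "\<And>l. l \<in> L \<Longrightarrow> keys l \<subseteq> coords n"
  shows "genideal (poly_ring n) ((\<lambda>l. single l 1) ` L) =
    {f \<in> polys n. \<forall>m\<in>keys f. \<exists>l\<in>L. mon_dvd l m}" (is "?I = ?M")
proof
  have sub: "(\<lambda>l. single l 1) ` L \<subseteq> polys n"
    using assms by (auto intro!: carrier_single)
  have "ideal ?M (poly_ring n)"
  proof (rule ideal_poly_ringI)
    fix f g assume "f \<in> ?M" "g \<in> ?M"
    then show "f + g \<in> ?M" using Poly_Mapping.keys_add[of f g] by (auto intro!: carrier_add)
  next
    fix f g assume f: "f \<in> polys n" and g: "g \<in> ?M"
    have "\<exists>l\<in>L. mon_dvd l m" if m: "m \<in> keys (f * g)" for m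
    proof -
      from m obtain k m' where km: "k \<in> keys f" "m' \<in> keys g" "m = k + m'" by (rule keys_mult_mon)
      with g obtain l where "l \<in> L" "mon_dvd l m'" by blast
      moreover from this km have "mon_dvd l m" by (auto simp: mon_dvd_iff lookup_add trans_le_add2)
      ultimately show ?thesis by blast
    qed
    with f g show "f * g \<in> ?M" by (auto intro!: carrier_mult)
  qed (auto simp: carrier_0)
  moreover have "(\<lambda>l. single l 1) ` L \<subseteq> ?M"
    using sub by (auto intro: mon_dvd_refl)
  ultimately show "?I \<subseteq> ?M" by (rule genideal_least)
  show "?M \<subseteq> ?I"
  proof
    fix f assume f: "f \<in> ?M"
    have "single m (lookup f m) \<in> ?I" if m: "m \<in> keys f" for m
    proof -
      from f m obtain l k where l: "l \<in> L" "m = l + k" by (auto simp: mon_dvd_def)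
      have "keys (l + k) \<subseteq> coords n" using f m unfolding l(2) carrier_iff by blast
      then have "keys k \<subseteq> coords n" by (simp add: keys_add_mon)
      then have "single k (lookup f m) * single l 1 \<in> ?I"
        using l genideal_incl[OF sub] by (intro ideal_mult[OF ideal_genideal[OF sub]] carrier_single) auto
      then show ?thesis using l by (simp add: mult_single add.commute)
    qed
    then have "(\<Sum>m\<in>keys f. single m (lookup f m)) \<in> ?I"
      by (intro ideal_sum[OF ideal_genideal[OF sub]])
    then show "f \<in> ?I" by (simp add: mpoly_expand)
  qed
qed

section \<open>The degree reverse lexicographic order\<close>

definition mdeg :: "monomial \<Rightarrow> nat" where
  "mdeg m = (\<Sum>v\<in>keys m. lookup m v)"

lemma mdeg_superset: "finite A \<Longrightarrow> keys m \<subseteq> A \<Longrightarrow> mdeg m = (\<Sum>v\<in>A. lookup m v)"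
  unfolding mdeg_def by (intro sum.mono_neutral_left) (auto simp: in_keys_iff)

lemma mdeg_add: "mdeg (m + k) = mdeg m + mdeg k"
  using mdeg_superset[of "keys m \<union> keys k" m] mdeg_superset[of "keys m \<union> keys k" k]
  by (simp add: mdeg_def[of "m + k"] keys_add_mon lookup_add sum.distrib)

lemma mdeg_single [simp]: "mdeg (single v k) = k"
  by (cases "k = 0") (simp_all add: mdeg_def)

lemma mdeg_0 [simp]: "mdeg 0 = 0"
  by (simp add: mdeg_def)

lemma mdeg_eq_0: "mdeg m = 0 \<longleftrightarrow> m = 0"
  by (auto simp: mdeg_def in_keys_iff intro!: poly_mapping_eqI)

lemma homogeneous_iff: "homogeneous d f \<longleftrightarrow> (\<forall>m\<in>keys f. mdeg m = d)"
  by (simp add: homogeneous_def mdeg_def)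

notation degrevlex_less (infix "\<prec>" 50)

lemma degrevlex_iff: "m \<prec> m' \<longleftrightarrow> mdeg m < mdeg m' \<or> mdeg m = mdeg m' \<and>
    (\<exists>v. lookup m v > lookup m' v \<and> (\<forall>w<v. lookup m w = lookup m' w))"
  by (simp add: degrevlex_less_def mdeg_def Let_def)

lemma degrevlex_irrefl: "\<not> m \<prec> m"
  by (simp add: degrevlex_iff)

lemma degrevlex_trans:
  assumes "a \<prec> b" "b \<prec> c"
  shows "a \<prec> c"
proof (cases "mdeg a = mdeg b \<and> mdeg b = mdeg c")
  case False
  with assms show ?thesis by (auto simp: degrevlex_iff)
next
  case True
  with assms obtain v w where v: "lookup a v > lookup b v" "\<forall>x<v. lookup a x = lookup b x"
    and w: "lookup b w > lookup c w" "\<forall>x<w. lookup b x = lookup c x"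
    by (auto simp: degrevlex_iff)
  have "lookup a (min v w) > lookup c (min v w)"
    using v w by (cases v w rule: linorder_cases) (auto simp: min_def)
  moreover have "\<forall>x<min v w. lookup a x = lookup c x" using v w by auto
  ultimately show ?thesis using True by (auto simp: degrevlex_iff)
qed

lemma degrevlex_total:
  assumes "m \<noteq> m'"
  shows "m \<prec> m' \<or> m' \<prec> m"
proof (cases "mdeg m = mdeg m'")
  case True
  let ?D = "{v \<in> keys m \<union> keys m'. lookup m v \<noteq> lookup m' v}"
  have fin: "finite ?D" by simp
  have D: "v \<in> ?D \<longleftrightarrow> lookup m v \<noteq> lookup m' v" for v by (auto simp: in_keys_iff)
  from assms have "?D \<noteq> {}" using D by (metis empty_iff poly_mapping_eqI)
  then have min: "Min ?D \<in> ?D" using fin by (rule Min_in[rotated])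
  define v where "v = Min ?D"
  have v: "lookup m v \<noteq> lookup m' v" using min D unfolding v_def by blast
  have eq: "\<forall>w<v. lookup m w = lookup m' w"
    using D Min_le[OF fin] unfolding v_def by (meson leD)
  from v consider "lookup m v > lookup m' v" | "lookup m' v > lookup m v" by linarith
  then show ?thesis
  proof cases
    case 1
    with eq True show ?thesis unfolding degrevlex_iff by blast
  next
    case 2
    with eq True show ?thesis unfolding degrevlex_iff by metis
  qed
qed (auto simp: degrevlex_iff)

lemma degrevlex_asym: "a \<prec> b \<Longrightarrow> \<not> b \<prec> a"
  using degrevlex_trans degrevlex_irrefl by blast

lemma degrevlex_add: "(k + a) \<prec> (k + b) \<longleftrightarrow> a \<prec> b"
  by (simp add: degrevlex_iff mdeg_add lookup_add)

lemma degrevlex_dvd: "mon_dvd m m' \<Longrightarrow> m = m' \<or> m \<prec> m'"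
  using mdeg_eq_0 by (auto simp: mon_dvd_def degrevlex_iff mdeg_add)

lemma ex_lead_mon:
  assumes "f \<noteq> 0"
  obtains m where "m \<in> keys f" "\<And>m'. m' \<in> keys f \<Longrightarrow> m' \<noteq> m \<Longrightarrow> m' \<prec> m"
proof -
  have "transp_on (keys f) degrevlex_less" using degrevlex_trans by (auto intro: transp_onI)
  moreover have "totalp_on (keys f) degrevlex_less" using degrevlex_total by (auto intro: totalp_onI)
  ultimately show ?thesis
    using Finite_Set.bex_greatest_element[of "keys f" degrevlex_less] assms that by auto
qed

lemma lead_monI:
  assumes "m \<in> keys f" "\<And>m'. m' \<in> keys f \<Longrightarrow> m' \<noteq> m \<Longrightarrow> m' \<prec> m"
  shows "lead_mon f = m"
  unfolding lead_mon_def
proof (rule the_equality)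
  show "m \<in> keys f \<and> (\<forall>m'\<in>keys f. m' \<noteq> m \<longrightarrow> m' \<prec> m)"
    using assms by simp
  fix k assume "k \<in> keys f \<and> (\<forall>m'\<in>keys f. m' \<noteq> k \<longrightarrow> m' \<prec> k)"
  then show "k = m"
    using assms(2)[of k] assms(1) degrevlex_asym[of k m] by (cases "k = m") auto
qed

lemma lead_mon:
  assumes "f \<noteq> 0"
  shows lead_mon_in_keys: "lead_mon f \<in> keys f"
    and lead_mon_greatest: "m \<in> keys f \<Longrightarrow> m \<noteq> lead_mon f \<Longrightarrow> m \<prec> lead_mon f"
proof -
  obtain k where k: "k \<in> keys f" "\<And>m'. m' \<in> keys f \<Longrightarrow> m' \<noteq> k \<Longrightarrow> m' \<prec> k"
    using ex_lead_mon[OF assms] by metis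
  have "lead_mon f = k" using k by (rule lead_monI)
  with k show "lead_mon f \<in> keys f"
    "m \<in> keys f \<Longrightarrow> m \<noteq> lead_mon f \<Longrightarrow> m \<prec> lead_mon f"
    by auto
qed

lemma lead_mon_single_add:
  assumes "\<And>t. t \<in> keys h \<Longrightarrow> t \<prec> m"
  shows "lead_mon (single m 1 + h) = m" "lookup (single m 1 + h) m = 1"
    "keys (single m 1 + h) = insert m (keys h)"
proof -
  have "m \<notin> keys h" using assms degrevlex_irrefl by blast
  then show l: "lookup (single m 1 + h) m = 1" by (simp add: lookup_add in_keys_iff)
  show k: "keys (single m 1 + h) = insert m (keys h)"
    using \<open>m \<notin> keys h\<close> by (auto simp: in_keys_iff lookup_add lookup_single when_def split: if_splits)
  show "lead_mon (single m 1 + h) = m"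
    by (rule lead_monI) (use k assms in auto)
qed

lemma finite_coords: "finite (coords n)"
proof -
  have "coords n \<subseteq> (\<lambda>(l, i, j). Coord l i j) ` ({..<n} \<times> {..<4} \<times> {..<4})"
    by (force simp: coords_def image_iff)
  then show ?thesis by (rule finite_subset) simp
qed

lemma finite_monomials: "finite {m. keys m \<subseteq> coords n \<and> mdeg m = d}"
proof -
  let ?F = "{f. \<forall>v. (v \<in> coords n \<longrightarrow> f v \<in> {..d}) \<and> (v \<notin> coords n \<longrightarrow> f v = (0::nat))}"
  have "finite ?F" by (rule finite_set_of_finite_funs) (auto simp: finite_coords)
  moreover have "lookup ` {m. keys m \<subseteq> coords n \<and> mdeg m = d} \<subseteq> ?F"
  proof (rule image_subsetI)
    fix m assume "m \<in> {m. keys m \<subseteq> coords n \<and> mdeg m = d}"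
    then have m: "keys m \<subseteq> coords n" "d = mdeg m" by auto
    have "lookup m v \<le> mdeg m" for v
      using member_le_sum[of v "keys m" "lookup m"] by (cases "v \<in> keys m") (auto simp: mdeg_def in_keys_iff)
    then show "lookup m \<in> ?F" using m by (auto simp: in_keys_iff)
  qed
  ultimately have "finite (lookup ` {m. keys m \<subseteq> coords n \<and> mdeg m = d})" by (rule finite_subset[rotated])
  moreover have "inj_on lookup {m :: monomial. keys m \<subseteq> coords n \<and> mdeg m = d}"
    by (intro inj_onI poly_mapping_eqI) (erule fun_cong)
  ultimately show ?thesis by (rule finite_imageD)
qed

text \<open>Within a fixed degree there are only finitely many monomials, so the order is well-founded there.\<close>

lemma degrevlex_induct [consumes 1, case_names less]:
  assumes "keys m \<subseteq> coords n"
    and step: "\<And>m. keys m \<subseteq> coords n \<Longrightarrow>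
      (\<And>t. keys t \<subseteq> coords n \<Longrightarrow> mdeg t = mdeg m \<Longrightarrow> t \<prec> m \<Longrightarrow> P t) \<Longrightarrow> P m"
  shows "P m"
  using assms(1)
proof (induction "card {t. keys t \<subseteq> coords n \<and> mdeg t = mdeg m \<and> t \<prec> m}"
    arbitrary: m rule: less_induct)
  case less
  show ?case
  proof (rule step[OF less.prems])
    fix t assume t: "keys t \<subseteq> coords n" "mdeg t = mdeg m" "t \<prec> m"
    have "card {s. keys s \<subseteq> coords n \<and> mdeg s = mdeg t \<and> s \<prec> t}
      < card {s. keys s \<subseteq> coords n \<and> mdeg s = mdeg m \<and> s \<prec> m}"
    proof (rule psubset_card_mono)
      show "finite {s. keys s \<subseteq> coords n \<and> mdeg s = mdeg m \<and> s \<prec> m}"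
        using finite_monomials[of n "mdeg m"] by (rule finite_subset[rotated]) auto
      show "{s. keys s \<subseteq> coords n \<and> mdeg s = mdeg t \<and> s \<prec> t}
        \<subset> {s. keys s \<subseteq> coords n \<and> mdeg s = mdeg m \<and> s \<prec> m}"
        using t degrevlex_trans[OF _ t(3)] degrevlex_irrefl[of t] by (intro psubsetI) (auto simp: set_eq_iff)
    qed
    from less.hyps[OF this t(1)] show "P t" .
  qed
qed

subsection \<open>Monomials given by ascending lists of unknowns\<close>

definition lmon :: "coord list \<Rightarrow> monomial" where
  "lmon xs = (\<Sum>v\<leftarrow>xs. single v 1)"

lemma lmon_simps [simp]: "lmon [] = 0" "lmon (x # xs) = single x 1 + lmon xs"
  by (simp_all add: lmon_def)

lemma keys_lmon: "keys (lmon xs) = set xs"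
  by (induction xs) (auto simp: keys_add_mon)

lemma mdeg_lmon: "mdeg (lmon xs) = length xs"
  by (induction xs) (auto simp: mdeg_add)

lemma prod_list_var: "(\<Prod>v\<leftarrow>xs. var v) = single (lmon xs) 1"
  by (induction xs) (simp_all add: var_def mult_single)

text \<open>For words of equal length with ascending right word this implies the reverse
  lexicographic comparison: a smaller letter at the first difference means a higher power of a small
  unknown. The left word may be out of order, as happens for lower terms of the quartics when j =
  k.\<close>

fun lexless :: "coord list \<Rightarrow> coord list \<Rightarrow> bool" where
  "lexless (x # xs) (y # ys) \<longleftrightarrow> x < y \<or> x = y \<and> lexless xs ys"
| "lexless _ _ \<longleftrightarrow> False"

lemma degrevlex_lmon:
  assumes "lexless xs ys" "sorted ys" "length xs = length ys"
  shows "lmon xs \<prec> lmon ys"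
  using assms
proof (induction xs ys rule: lexless.induct)
  case (1 x xs y ys)
  show ?case
  proof (cases "x = y")
    case True
    with 1 show ?thesis by (simp add: degrevlex_add)
  next
    case False
    with 1 have xy: "x < y" by simp
    let ?l = "lmon (x # xs)" and ?r = "lmon (y # ys)"
    \<comment> \<open>All letters of the ascending right word exceed \<open>v\<close>, so
      \<open>v\<close> decides the comparison.\<close>
    define v where "v = Min (set (x # xs))"
    have vx: "v \<le> x" and v: "v \<in> set (x # xs)"
      unfolding v_def by (rule Min_le, simp, simp) (rule Min_in, simp, simp)
    have r: "lookup ?r w = 0" if "w \<le> v" for w
    proof -
      have "w < y" using that vx xy by (meson le_less_trans)
      then have "w \<notin> set (y # ys)" using 1(3) by auto
      then show ?thesis unfolding keys_lmon[symmetric] by (simp only: in_keys_iff not_not)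
    qed
    have l: "lookup ?l w = 0" if "w < v" for w
    proof -
      have "w \<notin> set (x # xs)" using that Min_le[of "set (x # xs)" w] unfolding v_def by (meson List.finite_set leD)
      then show ?thesis unfolding keys_lmon[symmetric] by (simp only: in_keys_iff not_not)
    qed
    have "lookup ?l v > 0" using v unfolding keys_lmon[symmetric] by (simp only: in_keys_iff neq0_conv)
    with r l have "lookup ?l v > lookup ?r v \<and> (\<forall>w<v. lookup ?l w = lookup ?r w)" by (simp del: lmon_simps)
    moreover have "mdeg ?l = mdeg ?r" using 1(4) by (simp add: mdeg_lmon del: lmon_simps)
    ultimately show ?thesis unfolding degrevlex_iff by blast
  qed
qed auto

section \<open>Linear independence of the standard monomials\<close>

definition indep :: "monomial set \<Rightarrow> (coord \<Rightarrow> complex) set \<Rightarrow> bool" where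
  "indep S Z \<longleftrightarrow> (\<forall>f. keys f \<subseteq> S \<longrightarrow> (\<forall>a\<in>Z. eval a f = 0) \<longrightarrow> f = 0)"

lemma indep_mono: "indep S Z \<Longrightarrow> S' \<subseteq> S \<Longrightarrow> Z \<subseteq> Z' \<Longrightarrow> indep S' Z'"
  unfolding indep_def by blast

text \<open>
  Monomials outside \<open>S2\<close> vanish on \<open>Z2\<close>, so restricting a relation first to \<open>Z2\<close> and then to
  \<open>Z1\<close> kills it.
\<close>

lemma indep_union:
  assumes "indep S1 Z1" "indep S2 Z2" "Z1 \<subseteq> Z" "Z2 \<subseteq> Z"
    and vanish: "\<And>m a. m \<in> S1 \<Longrightarrow> m \<notin> S2 \<Longrightarrow> a \<in> Z2 \<Longrightarrow> mev a m = 0"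
  shows "indep (S1 \<union> S2) Z"
  unfolding indep_def
proof (intro allI impI)
  fix f assume f: "keys f \<subseteq> S1 \<union> S2" "\<forall>a\<in>Z. eval a f = 0"
  have "eval a (restr S2 f) = 0" if "a \<in> Z2" for a
  proof -
    have "eval a (restr (- S2) f) = 0"
      unfolding eval_mev using f(1) vanish that by (intro sum.neutral) auto
    then show ?thesis using f(2) that assms(4) eval_restr_split[of a f S2] by auto
  qed
  then have "restr S2 f = 0" using assms(2) unfolding indep_def by simp
  then have "keys f \<subseteq> S1" using f(1) keys_restr[of S2 f] by auto
  then show "f = 0" using f(2) assms(1,3) unfolding indep_def by blast
qed

text \<open>An elementary form of irreducibility: any two points are joined by a polynomial curve
  inside \<open>Z\<close>, so the functions on \<open>Z\<close> inherit the absence of zero divisors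
  from C[t].\<close>

definition line_closed :: "(coord \<Rightarrow> complex) set \<Rightarrow> bool" where
  "line_closed Z \<longleftrightarrow> (\<forall>a\<in>Z. \<forall>b\<in>Z. \<exists>A. (\<forall>t. A t \<in> Z) \<and> A 0 = a \<and> A 1 = b \<and>
     (\<forall>v. \<exists>p. \<forall>t. A t v = poly p t))"

lemma line_closed_irreducible:
  assumes "line_closed Z" "b \<in> Z" "eval b g \<noteq> 0" "\<And>a. a \<in> Z \<Longrightarrow> eval a f * eval a g = 0" "a \<in> Z"
  shows "eval a f = 0"
proof -
  obtain A where A: "\<And>t. A t \<in> Z" "A 0 = a" "A 1 = b" "\<And>v. \<exists>p. \<forall>t. A t v = poly p t"
    using assms(1,2,5) unfolding line_closed_def by blast
  have ev: "\<exists>p. \<forall>t. eval (A t) h = poly p t" for h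
    by (rule eval_curve) (rule A(4))
  obtain p where p: "\<forall>t. eval (A t) f = poly p t" using ev by blast
  obtain q where q: "\<forall>t. eval (A t) g = poly q t" using ev by blast
  have "poly (p * q) t = 0" for t using assms(4)[OF A(1)] by (simp add: p q)
  then have "p * q = 0" using poly_all_0_iff_0 by blast
  moreover have "q \<noteq> 0" using q A(3) assms(3) by auto
  ultimately have "p = 0" by simp
  then show ?thesis using p A(2) by auto
qed

lemma mpoly_div_var:
  assumes "\<And>m. m \<in> keys f \<Longrightarrow> lookup m x \<noteq> 0"
  shows "\<exists>g. f = var x * g \<and> (\<forall>m\<in>keys g. single x 1 + m \<in> keys f)"
proof -
  let ?d = "\<lambda>m. m - single x (1::nat)"
  define g where "g = (\<Sum>m\<in>keys f. single (?d m) (lookup f m))"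
  have d: "single x 1 + ?d m = m" if "m \<in> keys f" for m
    using assms[OF that] by (intro poly_mapping_eqI) (auto simp: lookup_add lookup_minus lookup_single when_def)
  have "var x * g = (\<Sum>m\<in>keys f. single m (lookup f m))"
    unfolding g_def var_def sum_distrib_left using d by (intro sum.cong) (auto simp: mult_single)
  then have "f = var x * g" by (simp add: mpoly_expand)
  moreover have "single x 1 + m \<in> keys f" if m: "m \<in> keys g" for m
  proof -
    have "lookup g m \<noteq> 0" using m by (simp add: in_keys_iff)
    then obtain m' where "m' \<in> keys f" "lookup (single (?d m') (lookup f m')) m \<noteq> 0"
      unfolding g_def lookup_sum by (meson sum.not_neutral_contains_not_neutral)
    then show ?thesis using d by (auto simp: lookup_single when_def split: if_splits)
  qed
  ultimately show ?thesis by blast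
qed

text \<open>
  A relation that does not vanish identically after setting \<open>x = 0\<close> is excluded by \<open>base\<close>; the
  others are divisible by \<open>x\<close>, which may be cancelled since \<open>Z\<close> is irreducible.
\<close>

lemma indep_peel:
  assumes lc: "line_closed Z" "b \<in> Z" "b x \<noteq> 0"
    and S: "\<And>m. single x 1 + m \<in> S \<Longrightarrow> m \<in> S"
    and base: "indep {m \<in> S. lookup m x = 0} {a \<in> Z. a x = 0}"
  shows "indep S Z"
proof -
  \<comment> \<open>The bound \<open>d\<close> on the exponent of \<open>x\<close> drops by one with
    each cancellation of \<open>x\<close>.\<close>
  have "f = 0" if "keys f \<subseteq> S" "\<forall>a\<in>Z. eval a f = 0" "\<forall>m\<in>keys f. lookup m x < d" for f d
    using that
  proof (induction d arbitrary: f)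
    case 0
    then show ?case by auto
  next
    case (Suc d)
    let ?B = "{m. lookup m x = 0}"
    have "eval a (restr (- ?B) f) = 0" if "a x = 0" for a
      unfolding eval_mev by (intro sum.neutral) (auto simp: that in_keys_iff intro!: mev_eq_0[of x])
    then have "eval a (restr ?B f) = 0" if "a \<in> Z" "a x = 0" for a
      using eval_restr_split[of a f ?B] Suc.prems(2) that by simp
    moreover have "keys (restr ?B f) \<subseteq> {m \<in> S. lookup m x = 0}" using Suc.prems(1) by auto
    ultimately have "restr ?B f = 0" using base unfolding indep_def by blast
    then have "keys f \<inter> ?B = {}" using keys_restr[of ?B f] by simp
    then have "\<And>m. m \<in> keys f \<Longrightarrow> lookup m x \<noteq> 0" by auto
    then obtain g where g: "f = var x * g" "\<forall>m\<in>keys g. single x 1 + m \<in> keys f"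
      using mpoly_div_var[of f x] by blast
    have "eval a g = 0" if "a \<in> Z" for a
      by (rule line_closed_irreducible[OF lc(1,2), of "var x"])
         (use lc(3) Suc.prems(2) g(1) that in \<open>auto simp: mult.commute\<close>)
    moreover have "keys g \<subseteq> S" using g(2) S Suc.prems(1) by blast
    moreover have "\<forall>m\<in>keys g. lookup m x < d"
      using g(2) Suc.prems(3) by (fastforce simp: lookup_add)
    ultimately have "g = 0" using Suc.IH by blast
    with g(1) show ?case by simp
  qed
  moreover have "\<exists>d. \<forall>m\<in>keys f. lookup m x < d" for f :: mpoly
    by (intro exI[of _ "Suc (\<Sum>m\<in>keys f. lookup m x)"] ballI le_imp_less_Suc member_le_sum) auto
  ultimately show ?thesis unfolding indep_def by blast
qed

subsection \<open>Parametrized families of concurrent lines\<close>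

text \<open>Pluecker coordinates of the lines z \<and> y_l. Degenerate pairs, where y_l is parallel
  to z, are deliberately included: they are where the descent on a line ends, and they make the
  parameter space a vector space.\<close>

definition param :: "(nat \<Rightarrow> complex) \<Rightarrow> (nat \<Rightarrow> nat \<Rightarrow> complex) \<Rightarrow> coord \<Rightarrow> complex" where
  "param z y v = z (fst_index v) * y (line v) (snd_index v) - z (snd_index v) * y (line v) (fst_index v)"

lemma param_Coord [simp]: "param z y (Coord l i j) = z i * y l j - z j * y l i"
  by (simp add: param_def)

definition flag_pts :: "nat \<Rightarrow> (coord \<Rightarrow> complex) set" where
  "flag_pts k = {param z y | z y. \<forall>q>k. z q = 0}"

text \<open>Only line \<open>l\<close> is restricted by \<open>j\<close>. The order of
  \<open>i\<close> and \<open>j\<close> matters: for i < j the smaller flag step contains the common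
  point, for i > j it contains the second point y_l.\<close>

definition schubert_pts :: "nat \<Rightarrow> nat \<Rightarrow> nat \<Rightarrow> (coord \<Rightarrow> complex) set" where
  "schubert_pts l i j = {param z y | z y. (\<forall>q>i. z q = 0) \<and> (\<forall>q>j. y l q = 0)}"

lemma schubert_ptsI: "\<forall>q>i. z q = 0 \<Longrightarrow> \<forall>q>j. y l q = 0 \<Longrightarrow> param z y \<in> schubert_pts l i j"
  unfolding schubert_pts_def by blast

text \<open>The two index conditions kill the products z_p y_q and z_q y_p separately.\<close>

lemma schubert_pts_vanish:
  "a \<in> schubert_pts l i j \<Longrightarrow> i < p \<or> j < q \<Longrightarrow> i < q \<or> j < p \<Longrightarrow> a (Coord l p q) = 0"
  unfolding schubert_pts_def by auto

lemma schubert_pts_hyperplane: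
  assumes "i' \<le> i" "j' \<le> j" "i' < p \<or> j' < q" "i' < q \<or> j' < p"
  shows "schubert_pts l i' j' \<subseteq> {a \<in> schubert_pts l i j. a (Coord l p q) = 0}"
proof
  fix a assume a: "a \<in> schubert_pts l i' j'"
  then obtain z y where "a = param z y" "\<forall>q>i'. z q = 0" "\<forall>q>j'. y l q = 0"
    unfolding schubert_pts_def by blast
  then have "a \<in> schubert_pts l i j" using assms(1,2) by (auto intro!: schubert_ptsI)
  with schubert_pts_vanish[OF a assms(3,4)] show "a \<in> {a \<in> schubert_pts l i j. a (Coord l p q) = 0}"
    by simp
qed

lemma param_segment:
  "\<exists>p. \<forall>t. param (\<lambda>q. z q + t * (z' q - z q)) (\<lambda>l q. y l q + t * (y' l q - y l q)) v = poly p t"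
proof -
  let ?a = "\<lambda>q. [:z q, z' q - z q:]" and ?b = "\<lambda>q. [:y (line v) q, y' (line v) q - y (line v) q:]"
  show ?thesis
    by (intro exI[of _ "?a (fst_index v) * ?b (snd_index v) - ?a (snd_index v) * ?b (fst_index v)"])
       (simp add: param_def algebra_simps)
qed

text \<open>Segments between parameters stay admissible, and \<open>param\<close> is quadratic in
  the parameters, so the image of a segment is a polynomial curve.\<close>

lemma line_closed_param:
  assumes "\<And>z y z' y' t. P z y \<Longrightarrow> P z' y' \<Longrightarrow>
    P (\<lambda>q. z q + t * (z' q - z q)) (\<lambda>l q. y l q + t * (y' l q - y l q))"
  shows "line_closed {param z y | z y. P z y}"
  unfolding line_closed_def
proof (intro ballI)
  fix a b assume "a \<in> {param z y | z y. P z y}" "b \<in> {param z y | z y. P z y}"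
  then obtain z y z' y' where a: "a = param z y" "P z y" and b: "b = param z' y'" "P z' y'" by blast
  let ?A = "\<lambda>t. param (\<lambda>q. z q + t * (z' q - z q)) (\<lambda>l q. y l q + t * (y' l q - y l q))"
  have "?A t \<in> {param z y | z y. P z y}" for t using assms[OF a(2) b(2)] by blast
  moreover have "?A 0 = a" "?A 1 = b" by (simp_all add: a b)
  ultimately show "\<exists>A. (\<forall>t. A t \<in> {param z y | z y. P z y}) \<and> A 0 = a \<and> A 1 = b \<and>
      (\<forall>v. \<exists>p. \<forall>t. A t v = poly p t)"
    using param_segment by (intro exI[of _ ?A]) blast
qed

lemma line_closed_schubert_pts: "line_closed (schubert_pts l i j)"
  unfolding schubert_pts_def by (rule line_closed_param) auto

subsection \<open>Standard monomials\<close>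

abbreviation "p01 l \<equiv> Coord l 0 1"
abbreviation "p02 l \<equiv> Coord l 0 2"
abbreviation "p03 l \<equiv> Coord l 0 3"
abbreviation "p12 l \<equiv> Coord l 1 2"
abbreviation "p13 l \<equiv> Coord l 1 3"
abbreviation "p23 l \<equiv> Coord l 2 3"

definition on_lin :: "nat \<Rightarrow> coord set \<Rightarrow> (nat \<times> nat) set" where
  "on_lin l X = {(i, j). Coord l i j \<in> X}"

text \<open>
  Reading the lines from the last to the first, the state \<open>k\<close> means that the common point is
  confined to the span of \<open>e\<^sub>0, \<dots>, e\<^sub>k\<close>. A pair \<open>(B, k')\<close> allows the unknowns \<open>B\<close> on the
  current line and leads to the state \<open>k'\<close>.
\<close>

fun transitions :: "nat \<Rightarrow> ((nat \<times> nat) set \<times> nat) set" where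
  "transitions k =
     (if k = 0 then {({(0,1),(0,2),(0,3)}, 0)}
      else if k = 1 then {({(0,1),(0,2),(0,3),(1,3)}, 0), ({(0,1),(0,2),(1,2),(1,3)}, 0), ({(0,1),(1,2),(1,3)}, 1)}
      else if k = 2 then {({(0,1),(0,2),(0,3),(1,3),(2,3)}, 0), ({(0,1),(0,2),(1,2),(1,3),(2,3)}, 0),
        ({(0,1),(1,2),(1,3),(2,3)}, 1), ({(0,1),(0,2),(1,2),(2,3)}, 1), ({(0,2),(1,2),(2,3)}, 2)}
      else {({(0,1),(0,2),(1,2),(1,3),(2,3)}, 1), ({(0,2),(1,2),(1,3),(2,3)}, 2),
        ({(0,1),(0,2),(0,3),(1,3),(2,3)}, 1), ({(0,2),(0,3),(1,3),(2,3)}, 2), ({(0,3),(1,3),(2,3)}, 3)})"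

declare transitions.simps [simp del]

text \<open>The sets \<open>B\<close> along the runs of the automaton generate a simplicial complex
  on the unknowns.\<close>

fun face :: "nat \<Rightarrow> nat \<Rightarrow> coord set \<Rightarrow> bool" where
  "face 0 k X \<longleftrightarrow> True"
| "face (Suc l) k X \<longleftrightarrow> (\<exists>(B, k')\<in>transitions k. on_lin l X \<subseteq> B \<and> face l k' X)"

definition standard :: "nat \<Rightarrow> nat \<Rightarrow> monomial set" where
  "standard n k = {m. keys m \<subseteq> coords n \<and> face n k (keys m)}"

text \<open>The situation in the middle of line \<open>l\<close>: \<open>T\<close> lists what may
  still be used on this line, each time with the state for the lines before it.\<close>

definition state_standard :: "nat \<Rightarrow> ((nat \<times> nat) set \<times> nat) set \<Rightarrow> monomial set" where
  "state_standard l T = {m. keys m \<subseteq> coords (Suc l) \<and> (\<exists>(B, k)\<in>T. on_lin l (keys m) \<subseteq> B \<and> face l k (keys m))}"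

lemma standard_Suc: "standard (Suc l) k = state_standard l (transitions k)"
  by (simp add: standard_def state_standard_def)

lemma state_standard_Un: "state_standard l (T \<union> T') = state_standard l T \<union> state_standard l T'"
  by (auto simp: state_standard_def)

lemma on_lin_mono: "X \<subseteq> Y \<Longrightarrow> on_lin l X \<subseteq> on_lin l Y"
  by (auto simp: on_lin_def)

lemma face_subset: "X \<subseteq> Y \<Longrightarrow> face l k Y \<Longrightarrow> face l k X"
proof (induction l arbitrary: k)
  case (Suc l)
  from Suc.prems(2) obtain B r where B: "(B, r) \<in> transitions k" "on_lin l Y \<subseteq> B" "face l r Y" by auto
  then have "on_lin l X \<subseteq> B" "face l r X"
    using on_lin_mono[OF Suc.prems(1)] Suc.IH[OF Suc.prems(1)] by blast+
  with B(1) show ?case by auto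
qed simp

text \<open>The flag steps are nested, so each alternative of a state has a larger one in the next
  state. This is a finite check because all states from 3 on have the same transitions.\<close>

lemma transitions_mono_Suc:
  assumes "(B, r) \<in> transitions k"
  shows "\<exists>(B', r')\<in>transitions (Suc k). B \<subseteq> B' \<and> r \<le> r'"
proof -
  consider "k = 0" | "k = 1" | "k = 2" | "transitions (Suc k) = transitions k"
    by (cases "k = 0 \<or> k = 1 \<or> k = 2") (auto simp: transitions.simps)
  then show ?thesis
  proof cases
    case 4
    with assms show ?thesis by blast
  qed (use assms in \<open>auto simp: transitions.simps\<close>)
qed

lemma transitions_mono:
  "k \<le> k' \<Longrightarrow> (B, r) \<in> transitions k \<Longrightarrow> \<exists>(B', r')\<in>transitions k'. B \<subseteq> B' \<and> r \<le> r'"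
proof (induction rule: dec_induct)
  case base
  then show ?case by blast
next
  case (step m)
  then obtain B' r' where 1: "(B', r') \<in> transitions m" "B \<subseteq> B'" "r \<le> r'" by blast
  obtain B'' r'' where "(B'', r'') \<in> transitions (Suc m)" "B' \<subseteq> B''" "r' \<le> r''"
    using transitions_mono_Suc[OF 1(1)] by blast
  with 1 show ?case by (intro bexI[of _ "(B'', r'')"]) auto
qed

lemma face_mono: "k \<le> k' \<Longrightarrow> face l k X \<Longrightarrow> face l k' X"
proof (induction l arbitrary: k k')
  case (Suc l)
  from Suc.prems(2) obtain B r where B: "(B, r) \<in> transitions k" "on_lin l X \<subseteq> B" "face l r X" by auto
  from transitions_mono[OF Suc.prems(1) B(1)] obtain B' r'
    where "(B', r') \<in> transitions k'" "B \<subseteq> B'" "r \<le> r'" by blast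
  with B Suc.IH[of r r'] show ?case by auto
qed simp

text \<open>Combines two divisors of a hyperplane section. \<open>V\<close> collects unknowns that
  vanish on the second divisor; an alternative of \<open>T1\<close> that avoids \<open>V\<close> is
  already covered by \<open>T2\<close>, so a monomial of \<open>T1\<close> not covered there
  contains an unknown of \<open>V\<close> and vanishes on \<open>Z2\<close>.\<close>

lemma indep_branch:
  assumes "indep (state_standard l T1) Z1" "indep (state_standard l T2) Z2" "Z1 \<subseteq> Z" "Z2 \<subseteq> Z"
    and V: "\<And>p q a. (p, q) \<in> V \<Longrightarrow> a \<in> Z2 \<Longrightarrow> a (Coord l p q) = 0"
    and T: "\<forall>(B, k)\<in>T1. \<exists>(B', k')\<in>T2. B \<subseteq> B' \<union> V \<and> k \<le> k'"
  shows "indep (state_standard l (T1 \<union> T2)) Z"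
  unfolding state_standard_Un
proof (rule indep_union[OF assms(1-4)])
  fix m a assume m: "m \<in> state_standard l T1" "m \<notin> state_standard l T2" and a: "a \<in> Z2"
  from m(1) obtain B k where B: "keys m \<subseteq> coords (Suc l)" "(B, k) \<in> T1" "on_lin l (keys m) \<subseteq> B" "face l k (keys m)"
    by (auto simp: state_standard_def)
  with T obtain B' k' where B': "(B', k') \<in> T2" "B \<subseteq> B' \<union> V" "k \<le> k'" by blast
  have "\<not> on_lin l (keys m) \<subseteq> B'"
    using m(2) B B' face_mono[OF B'(3) B(4)] by (auto simp: state_standard_def)
  with B(3) B'(2) obtain p q where "Coord l p q \<in> keys m" "(p, q) \<in> V" by (auto simp: on_lin_def)
  then show "mev a m = 0" using V a by (intro mev_eq_0)
qed

text \<open>Independence on part of the section p_ij = 0 lifts to the whole Schubert variety, with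
  arbitrary powers of p_ij now allowed.\<close>

lemma indep_peel_state:
  assumes "indep (state_standard l T) Z" "Z \<subseteq> {a \<in> schubert_pts l i j. a (Coord l p q) = 0}"
    and "(p, q) = (min i j, max i j)" "i \<noteq> j"
  shows "indep (state_standard l ((\<lambda>(B, k). (insert (p, q) B, k)) ` T)) (schubert_pts l i j)"
proof (rule indep_peel[where x = "Coord l p q"])
  show "line_closed (schubert_pts l i j)" by (rule line_closed_schubert_pts)
  \<comment> \<open>With z = e_i and y_l = e_j the coordinate p_ij is 1 or -1.\<close>
  let ?b = "param (\<lambda>r. if r = i then 1 else 0) (\<lambda>l r. if r = j then 1 else 0)"
  show "?b \<in> schubert_pts l i j" by (rule schubert_ptsI) auto
  show "?b (Coord l p q) \<noteq> 0" using assms(3,4) by (auto simp: min_def max_def)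
next
  fix m assume m: "single (Coord l p q) 1 + m \<in> state_standard l ((\<lambda>(B, k). (insert (p, q) B, k)) ` T)"
  have sub: "keys m \<subseteq> keys (single (Coord l p q) 1 + m)" by (auto simp: keys_add_mon)
  from m obtain B k where "(B, k) \<in> T" "keys (single (Coord l p q) 1 + m) \<subseteq> coords (Suc l)"
    "on_lin l (keys (single (Coord l p q) 1 + m)) \<subseteq> insert (p, q) B"
    "face l k (keys (single (Coord l p q) 1 + m))"
    by (auto simp: state_standard_def)
  then have "keys m \<subseteq> coords (Suc l)" "(insert (p, q) B, k) \<in> (\<lambda>(B, k). (insert (p, q) B, k)) ` T"
    "on_lin l (keys m) \<subseteq> insert (p, q) B" "face l k (keys m)"
    using sub on_lin_mono[OF sub, of l] face_subset[OF sub, of l k] by (blast, force, blast, blast)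
  then show "m \<in> state_standard l ((\<lambda>(B, k). (insert (p, q) B, k)) ` T)"
    unfolding state_standard_def by blast
next
  show "indep {m \<in> state_standard l ((\<lambda>(B, k). (insert (p, q) B, k)) ` T). lookup m (Coord l p q) = 0}
     {a \<in> schubert_pts l i j. a (Coord l p q) = 0}"
  proof (rule indep_mono[OF assms(1) _ assms(2)], rule subsetI)
    fix m assume m: "m \<in> {m \<in> state_standard l ((\<lambda>(B, k). (insert (p, q) B, k)) ` T). lookup m (Coord l p q) = 0}"
    then have "(p, q) \<notin> on_lin l (keys m)" by (simp add: on_lin_def in_keys_iff)
    moreover from m obtain B k where "keys m \<subseteq> coords (Suc l)" "(B, k) \<in> T"
      "on_lin l (keys m) \<subseteq> insert (p, q) B" "face l k (keys m)"
      by (auto simp: state_standard_def)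
    ultimately show "m \<in> state_standard l T" unfolding state_standard_def by blast
  qed
qed

text \<open>Bottom of the descent: line \<open>l\<close> has vanished, no unknown of it is allowed,
  and the remaining lines meet in a point that is still free in flag step \<open>k\<close>. So the
  claim is the one for fewer lines.\<close>

lemma indep_vertex:
  assumes "indep (standard l k) (flag_pts k)"
  shows "indep (state_standard l {({}, k)}) {a \<in> schubert_pts l k j. \<forall>p q. a (Coord l p q) = 0}"
  unfolding indep_def
proof (intro allI impI)
  fix f assume f: "keys f \<subseteq> state_standard l {({}, k)}"
    "\<forall>a\<in>{a \<in> schubert_pts l k j. \<forall>p q. a (Coord l p q) = 0}. eval a f = 0"
  have nl: "line v < l" if m: "m \<in> keys f" and v: "v \<in> keys m" for m v
  proof -
    from f(1) m have "keys m \<subseteq> coords (Suc l)" "on_lin l (keys m) = {}" by (auto simp: state_standard_def)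
    with v show ?thesis by (cases v) (auto simp: coords_def on_lin_def less_Suc_eq)
  qed
  have "eval a f = 0" if "a \<in> flag_pts k" for a
  proof -
    from that obtain z y where a: "a = param z y" "\<forall>q>k. z q = 0" unfolding flag_pts_def by blast
    \<comment> \<open>Setting y_l to 0 kills line \<open>l\<close> without moving the common point
      or the other lines.\<close>
    let ?b = "param z (y(l := \<lambda>_. 0))"
    have "?b \<in> schubert_pts l k j" using a by (intro schubert_ptsI) auto
    moreover have "\<forall>p q. ?b (Coord l p q) = 0" by simp
    ultimately have "eval ?b f = 0" using f(2) by blast
    moreover have "eval a f = eval ?b f"
      unfolding a by (intro eval_cong) (use nl in \<open>fastforce simp: param_def\<close>)
    ultimately show ?thesis by simp
  qed
  moreover have "keys f \<subseteq> standard l k"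
  proof
    fix m assume m: "m \<in> keys f"
    with f(1) have "keys m \<subseteq> coords (Suc l)" "face l k (keys m)" by (auto simp: state_standard_def)
    moreover have "keys m \<subseteq> coords l"
      using calculation(1) nl[OF m] by (fastforce simp: coords_def)
    ultimately show "m \<in> standard l k" by (simp add: standard_def)
  qed
  ultimately show "f = 0" using assms unfolding indep_def by blast
qed

text \<open>
  One line is peeled off by descending through the Schubert varieties of pairs (point on a line),
  indexed by the positions \<open>i\<close>, \<open>j\<close> of the point and of a second point of the line; the
  hyperplane section \<open>p\<^sub>i\<^sub>j = 0\<close> contains the Schubert divisors below \<open>(i, j)\<close>.
\<close>

lemma indep_standard: "k \<le> 3 \<Longrightarrow> indep (standard n k) (flag_pts k)"
proof (induction n arbitrary: k)
  case 0
  have "f = 0" if f: "keys f \<subseteq> standard 0 k" "\<forall>a\<in>flag_pts k. eval a f = 0" for f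
  proof -
    have "m = 0" if "m \<in> keys f" for m
      using f(1) that by (auto simp: standard_def coords_def)
    then have sub: "keys f \<subseteq> {0}" by blast
    have "param (\<lambda>_. 0) (\<lambda>_ _. 0) \<in> flag_pts k" unfolding flag_pts_def by blast
    with f(2) have "eval (param (\<lambda>_. 0) (\<lambda>_ _. 0)) f = 0" by blast
    moreover have "eval (param (\<lambda>_. 0) (\<lambda>_ _. 0)) f = lookup f 0"
      using eval_superset[of "{0}" f] sub by simp
    ultimately show ?thesis using sub by (auto simp: in_keys_iff intro!: poly_mapping_eqI)
  qed
  then show ?case unfolding indep_def by blast
next
  case (Suc l)
  let ?I = "\<lambda>T i j. indep (state_standard l T) (schubert_pts l i j)"
  have vertex: "indep (state_standard l {({}, r)}) {a \<in> schubert_pts l r j. \<forall>p q. a (Coord l p q) = 0}"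
    if "r \<le> 3" for r j
    by (rule indep_vertex[OF Suc.IH[OF that]])
  have vertex_sub: "{a \<in> schubert_pts l r j. \<forall>p q. a (Coord l p q) = 0} \<subseteq> {a \<in> schubert_pts l r j. a (Coord l p q) = 0}"
    for r j p q by blast
  \<comment> \<open>Below (0, 1) and (1, 0) only the vertex is left. The flag step in which the
    point is still free there becomes the next state, here 0 and 1.\<close>
  have i01: "?I {({(0,1)}, 0)} 0 1"
    using indep_peel_state[OF vertex[of 0 1] vertex_sub, where p = 0 and q = 1] by simp
  have i10: "?I {({(0,1)}, 1)} 1 0"
    using indep_peel_state[OF vertex[of 1 0] vertex_sub, where p = 0 and q = 1] by simp
  have i02: "?I {({(0,1),(0,2)}, 0)} 0 2"
    using indep_peel_state[OF i01 schubert_pts_hyperplane, where i = 0 and j = 2 and p = 0 and q = 2]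
    by (simp add: insert_commute transitions.simps)
  have i03: "?I {({(0,1),(0,2),(0,3)}, 0)} 0 3"
    using indep_peel_state[OF i02 schubert_pts_hyperplane, where i = 0 and j = 3 and p = 0 and q = 3]
    by (simp add: insert_commute transitions.simps)
  \<comment> \<open>On (2, 0) one has p_02 = - z_2 y_0: either the point drops to flag step 1, or
    the line vanishes while the point stays free in flag step 2.\<close>
  have i20: "?I {({(0,1),(0,2)}, 1), ({(0,2)}, 2)} 2 0"
  proof -
    let ?Z = "{a \<in> schubert_pts l 2 0. a (p02 l) = 0}"
    have "indep (state_standard l ({({(0,1)}, 1)} \<union> {({}, 2)})) ?Z"
      by (rule indep_branch[OF i10 vertex[of 2 0] schubert_pts_hyperplane vertex_sub, where V = "UNIV"])
         (auto intro: schubert_pts_vanish)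
    from indep_peel_state[OF this subset_refl] show ?thesis by (simp add: insert_commute)
  qed
  have i30: "?I {({(0,1),(0,2),(0,3)}, 1), ({(0,2),(0,3)}, 2), ({(0,3)}, 3)} 3 0"
  proof -
    let ?Z = "{a \<in> schubert_pts l 3 0. a (p03 l) = 0}"
    have "indep (state_standard l ({({(0,1),(0,2)}, 1), ({(0,2)}, 2)} \<union> {({}, 3)})) ?Z"
      by (rule indep_branch[OF i20 vertex[of 3 0] schubert_pts_hyperplane vertex_sub, where V = "UNIV"])
         (auto intro: schubert_pts_vanish)
    from indep_peel_state[OF this subset_refl] show ?thesis by (simp add: insert_commute)
  qed
  \<comment> \<open>On (1, 2) one has p_12 = z_1 y_2. If y_2 = 0 and z_1 is nonzero, then y_l can be
    changed modulo z into a multiple of e_0, so (1, 0) takes the place of (1, 1). For the same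
    reason (2, 1) takes the place of (2, 2) below.\<close>
  have i12: "?I {({(0,1),(0,2),(1,2)}, 0), ({(0,1),(1,2)}, 1)} 1 2"
  proof -
    let ?Z = "{a \<in> schubert_pts l 1 2. a (p12 l) = 0}"
    have "indep (state_standard l ({({(0,1),(0,2)}, 0)} \<union> {({(0,1)}, 1)})) ?Z"
      by (rule indep_branch[OF i02 i10 schubert_pts_hyperplane schubert_pts_hyperplane, where V = "{(0,2)}"])
         (auto intro: schubert_pts_vanish)
    from indep_peel_state[OF this subset_refl] show ?thesis by (simp add: insert_commute)
  qed
  have i21: "?I {({(0,1),(0,2),(1,2)}, 1), ({(0,2),(1,2)}, 2)} 2 1"
    using indep_peel_state[OF i20 schubert_pts_hyperplane, where i = 2 and j = 1 and p = 1 and q = 2]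
    by (simp add: insert_commute transitions.simps)
  have i13: "?I {({(0,1),(0,2),(0,3),(1,3)}, 0), ({(0,1),(0,2),(1,2),(1,3)}, 0), ({(0,1),(1,2),(1,3)}, 1)} 1 3"
  proof -
    let ?Z = "{a \<in> schubert_pts l 1 3. a (p13 l) = 0}"
    have "indep (state_standard l ({({(0,1),(0,2),(0,3)}, 0)} \<union> {({(0,1),(0,2),(1,2)}, 0), ({(0,1),(1,2)}, 1)})) ?Z"
      by (rule indep_branch[OF i03 i12 schubert_pts_hyperplane schubert_pts_hyperplane, where V = "{(0,3)}"])
         (auto intro: schubert_pts_vanish)
    from indep_peel_state[OF this subset_refl] show ?thesis by (simp add: insert_commute)
  qed
  have i31: "?I {({(0,1),(0,2),(1,2),(1,3)}, 1), ({(0,2),(1,2),(1,3)}, 2),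
      ({(0,1),(0,2),(0,3),(1,3)}, 1), ({(0,2),(0,3),(1,3)}, 2), ({(0,3),(1,3)}, 3)} 3 1"
  proof -
    let ?Z = "{a \<in> schubert_pts l 3 1. a (p13 l) = 0}"
    have "indep (state_standard l ({({(0,1),(0,2),(1,2)}, 1), ({(0,2),(1,2)}, 2)} \<union>
        {({(0,1),(0,2),(0,3)}, 1), ({(0,2),(0,3)}, 2), ({(0,3)}, 3)})) ?Z"
      by (rule indep_branch[OF i21 i30 schubert_pts_hyperplane schubert_pts_hyperplane, where V = "{(1,2)}"])
         (auto intro: schubert_pts_vanish)
    from indep_peel_state[OF this subset_refl] show ?thesis by (simp add: insert_commute)
  qed
  have i23: "?I (transitions 2) 2 3"
  proof -
    let ?Z = "{a \<in> schubert_pts l 2 3. a (p23 l) = 0}"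
    have "indep (state_standard l ({({(0,1),(0,2),(0,3),(1,3)}, 0), ({(0,1),(0,2),(1,2),(1,3)}, 0), ({(0,1),(1,2),(1,3)}, 1)} \<union>
        {({(0,1),(0,2),(1,2)}, 1), ({(0,2),(1,2)}, 2)})) ?Z"
      by (rule indep_branch[OF i13 i21 schubert_pts_hyperplane schubert_pts_hyperplane, where V = "{(0,3),(1,3)}"])
         (auto intro: schubert_pts_vanish)
    from indep_peel_state[OF this subset_refl] show ?thesis by (simp add: insert_commute transitions.simps)
  qed
  have i32: "?I (transitions 3) 3 2"
    using indep_peel_state[OF i31 schubert_pts_hyperplane, where i = 3 and j = 2 and p = 2 and q = 3]
    by (simp add: insert_commute transitions.simps)
  \<comment> \<open>A general line through a point of flag step k < 3 has type (k, 3). For k = 3 the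
    second point can be moved along the line, which gives type (3, 2).\<close>
  consider "k = 0" | "k = 1" | "k = 2" | "k = 3" using Suc.prems by linarith
  then obtain j where "?I (transitions k) k j"
    using i03 i13 i23 i32 by cases (auto simp: transitions.simps)
  then show ?case
    unfolding standard_Suc by (rule indep_mono) (auto simp: schubert_pts_def flag_pts_def)
qed

section \<open>Minimal nonfaces\<close>

text \<open>
  With \<open>a, \<dots>, f\<close> short for \<open>p\<^sub>0\<^sub>1, p\<^sub>0\<^sub>2, p\<^sub>0\<^sub>3, p\<^sub>1\<^sub>2, p\<^sub>1\<^sub>3, p\<^sub>2\<^sub>3\<close>, these are the supports of the leading
  monomials \<open>c\<^sub>id\<^sub>i\<close> and \<open>f\<^sub>ia\<^sub>j\<close>, then \<open>f\<^sub>i{c,e}\<^sub>j{b,d}\<^sub>k\<close>, \<open>{d,e}\<^sub>ic\<^sub>j{b,d}\<^sub>k\<close>, \<open>{d,e}\<^sub>i{b,c}\<^sub>ja\<^sub>k\<close>, and finally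
  \<open>{d,e}\<^sub>ib\<^sub>je\<^sub>k{b,d}\<^sub>l\<close> where \<open>j = k\<close> is allowed.
\<close>

definition nonfaces2 :: "nat \<Rightarrow> coord set set" where
  "nonfaces2 n = {{p03 i, p12 i} | i. i < n} \<union> {{p23 i, p01 j} | i j. i < j \<and> j < n}"

definition cubic_types :: "((nat \<times> nat) \<times> (nat \<times> nat) \<times> (nat \<times> nat)) set" where
  "cubic_types = {(2,3)} \<times> {(0,3),(1,3)} \<times> {(0,2),(1,2)} \<union> {(1,2),(1,3)} \<times> {(0,3)} \<times> {(0,2),(1,2)} \<union>
     {(1,2),(1,3)} \<times> {(0,2),(0,3)} \<times> {(0,1)}"

definition nonfaces3 :: "nat \<Rightarrow> coord set set" where
  "nonfaces3 n = {{Coord i p p', Coord j q q', Coord k r r'} | i j k p p' q q' r r'.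
     i < j \<and> j < k \<and> k < n \<and> ((p, p'), (q, q'), (r, r')) \<in> cubic_types}"

definition nonfaces4 :: "nat \<Rightarrow> coord set set" where
  "nonfaces4 n = {{Coord i 1 p, p02 j, p13 k, Coord l r 2} | i j k l p r.
     i < j \<and> j \<le> k \<and> k < l \<and> l < n \<and> p \<in> {2, 3} \<and> r \<in> {0, 1}}"

definition nonfaces :: "nat \<Rightarrow> coord set set" where
  "nonfaces n = nonfaces2 n \<union> nonfaces3 n \<union> nonfaces4 n"

lemma nonfacesI:
  "i < n \<Longrightarrow> {p03 i, p12 i} \<in> nonfaces n"
  "i < j \<Longrightarrow> j < n \<Longrightarrow> {p23 i, p01 j} \<in> nonfaces n"
  "i < j \<Longrightarrow> j < k \<Longrightarrow> k < n \<Longrightarrow> ((p, p'), (q, q'), (r, r')) \<in> cubic_types \<Longrightarrow>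
     {Coord i p p', Coord j q q', Coord k r r'} \<in> nonfaces n"
  "i < j \<Longrightarrow> j \<le> k \<Longrightarrow> k < l \<Longrightarrow> l < n \<Longrightarrow> p \<in> {2, 3} \<Longrightarrow> r \<in> {0, 1} \<Longrightarrow>
     {Coord i 1 p, p02 j, p13 k, Coord l r 2} \<in> nonfaces n"
  unfolding nonfaces_def nonfaces2_def nonfaces3_def nonfaces4_def
     apply (rule UnI1, rule UnI1, rule UnI1, intro CollectI exI conjI, rule refl, assumption)
    apply (rule UnI1, rule UnI1, rule UnI2, intro CollectI exI conjI, rule refl, assumption+)
   apply (rule UnI1, rule UnI2, intro CollectI exI conjI, rule refl, assumption+)
  apply (rule UnI2, intro CollectI exI conjI, rule refl, assumption+)
  done

section \<open>Faces described by forbidden patterns; the letters are those of the preceding section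
  comment\<close>

lemma face_step:
  assumes "X \<subseteq> coords N" "(B, r) \<in> transitions k" "face l r X"
    and "\<And>i j. (i, j) \<in> {(0,1),(0,2),(0,3),(1,2),(1,3),(2,3)} \<Longrightarrow> (i, j) \<notin> B \<Longrightarrow> Coord l i j \<notin> X"
  shows "face (Suc l) k X"
proof -
  have "(i, j) \<in> B" if "(i, j) \<in> on_lin l X" for i j
  proof (rule ccontr)
    assume "(i, j) \<notin> B"
    moreover have X: "Coord l i j \<in> X" using that by (simp add: on_lin_def)
    then have "i < j" "j < 4" using assms(1) by (auto simp: coords_def)
    then have "(i, j) \<in> {(0,1),(0,2),(0,3),(1,2),(1,3),(2,3)}" by auto
    ultimately show False using assms(4) X by blast
  qed
  then have "on_lin l X \<subseteq> B" by auto
  with assms(2,3) show ?thesis unfolding face.simps by blast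
qed

text \<open>State 0 places the common point at e_0, where only a, b and c survive.\<close>

lemma face_0:
  assumes X: "X \<subseteq> coords N"
    and "\<forall>i<l. p12 i \<notin> X \<and> p13 i \<notin> X \<and> p23 i \<notin> X"
  shows "face l 0 X"
  using assms(2)
proof (induction l)
  case (Suc l)
  then show ?case
    by (intro face_step[OF X, of "{(0,1),(0,2),(0,3)}" 0]) (auto simp: transitions.simps)
qed simp

text \<open>State 1 drops to 0 as soon as b or c is used, which forbids d and e on all earlier
  lines. As c and d exclude each other on a line, the drop has one alternative with c and one with
  d.\<close>

lemma face_1:
  assumes X: "X \<subseteq> coords N"
    and "\<forall>i<l. p23 i \<notin> X \<and> \<not> (p03 i \<in> X \<and> p12 i \<in> X)"
    and "\<forall>j<l. \<forall>i<j. (p12 i \<in> X \<or> p13 i \<in> X) \<longrightarrow> p02 j \<notin> X \<and> p03 j \<notin> X"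
  shows "face l 1 X"
  using assms(2,3)
proof (induction l)
  case (Suc l)
  have cd: "\<not> (p03 l \<in> X \<and> p12 l \<in> X)" and nf: "p23 l \<notin> X"
    using Suc.prems(1) by blast+
  show ?case
  proof (cases "p02 l \<in> X \<or> p03 l \<in> X")
    case True
    then have low: "face l 0 X" using Suc.prems by (intro face_0[OF X]) (auto simp: less_Suc_eq)
    show ?thesis
    proof (cases "p03 l \<in> X")
      case True
      then show ?thesis using cd nf low
        by (intro face_step[OF X, of "{(0,1),(0,2),(0,3),(1,3)}" 0]) (auto simp: transitions.simps)
    next
      case False
      then show ?thesis using cd nf low
        by (intro face_step[OF X, of "{(0,1),(0,2),(1,2),(1,3)}" 0]) (auto simp: transitions.simps)
    qed
  next
    case False
    moreover have "face l 1 X" using Suc by (auto simp: less_Suc_eq)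
    ultimately show ?thesis using cd nf
      by (intro face_step[OF X, of "{(0,1),(1,2),(1,3)}" 1]) (auto simp: transitions.simps)
  qed
qed simp

text \<open>State 2 is left through a, c or e, which forbids f on earlier lines. Using c, or b
  together with e, drops to 0 and forbids d and e there as well. Otherwise the state becomes 1 and
  only a b or c on an earlier line drops it to 0, whence the patterns on three lines. The bound
  \<open>j \<le> k\<close> includes b and e on the same line.\<close>

lemma face_2:
  assumes X: "X \<subseteq> coords N"
    and "\<forall>i<l. \<not> (p03 i \<in> X \<and> p12 i \<in> X)"
    and "\<forall>j<l. \<forall>i<j. p23 i \<in> X \<longrightarrow> p01 j \<notin> X \<and> p03 j \<notin> X \<and> p13 j \<notin> X"
    and "\<forall>j<l. \<forall>i<j. (p12 i \<in> X \<or> p13 i \<in> X) \<longrightarrow> p03 j \<notin> X"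
    and "\<forall>k<l. \<forall>j<k. \<forall>i<j. (p12 i \<in> X \<or> p13 i \<in> X) \<longrightarrow> p02 j \<in> X \<or> p03 j \<in> X \<longrightarrow> p01 k \<notin> X"
    and "\<forall>k<l. \<forall>j\<le>k. \<forall>i<j. (p12 i \<in> X \<or> p13 i \<in> X) \<longrightarrow> p02 j \<in> X \<longrightarrow> p13 k \<notin> X"
  shows "face l 2 X"
  using assms(2-)
proof (induction l)
  case (Suc l)
  have cd: "\<not> (p03 l \<in> X \<and> p12 l \<in> X)"
    using Suc.prems(1) by blast
  consider (c) "p03 l \<in> X" | (be) "p03 l \<notin> X" "p13 l \<in> X" "p02 l \<in> X"
    | (e) "p03 l \<notin> X" "p13 l \<in> X" "p02 l \<notin> X"
    | (a) "p03 l \<notin> X" "p13 l \<notin> X" "p01 l \<in> X"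
    | (o) "p03 l \<notin> X" "p13 l \<notin> X" "p01 l \<notin> X"
    by blast
  then show ?case
  proof cases
    case c
    moreover have "face l 0 X" using Suc.prems c by (intro face_0[OF X]) (auto simp: less_Suc_eq)
    ultimately show ?thesis using cd
      by (intro face_step[OF X, of "{(0,1),(0,2),(0,3),(1,3),(2,3)}" 0]) (auto simp: transitions.simps)
  next
    case be
    moreover have "face l 0 X" using Suc.prems be by (intro face_0[OF X]) (auto simp: less_Suc_eq)
    ultimately show ?thesis using cd
      by (intro face_step[OF X, of "{(0,1),(0,2),(1,2),(1,3),(2,3)}" 0]) (auto simp: transitions.simps)
  next
    case e
    moreover have "face l 1 X" using Suc.prems e by (intro face_1[OF X]) (auto simp: less_Suc_eq)
    ultimately show ?thesis using cd
      by (intro face_step[OF X, of "{(0,1),(1,2),(1,3),(2,3)}" 1]) (auto simp: transitions.simps)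
  next
    case a
    moreover have "face l 1 X" using Suc.prems a by (intro face_1[OF X]) (auto simp: less_Suc_eq)
    ultimately show ?thesis using cd
      by (intro face_step[OF X, of "{(0,1),(0,2),(1,2),(2,3)}" 1]) (auto simp: transitions.simps)
  next
    case o
    moreover have "face l 2 X" by (rule Suc.IH) (use Suc.prems in \<open>auto simp: less_Suc_eq\<close>)
    ultimately show ?thesis using cd
      by (intro face_step[OF X, of "{(0,2),(1,2),(2,3)}" 2]) (auto simp: transitions.simps)
  qed
qed simp

lemma all_less_SucD: "\<forall>k<Suc l. P k \<Longrightarrow> \<forall>k<l. P k"
  by simp

text \<open>State 3 is left through a to state 1, otherwise through b or d to state 2. The
  hypotheses are the patterns of \<open>face_1\<close> and \<open>face_2\<close>, completed where
  necessary by such a trigger on a later line; spelled out, they are the nonfaces.\<close>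

lemma face_3:
  assumes X: "X \<subseteq> coords N"
    and "\<forall>i<l. \<not> (p03 i \<in> X \<and> p12 i \<in> X)"
    and "\<forall>j<l. \<forall>i<j. p23 i \<in> X \<longrightarrow> p01 j \<notin> X"
    and "\<forall>k<l. \<forall>j<k. \<forall>i<j. p23 i \<in> X \<longrightarrow> p03 j \<in> X \<or> p13 j \<in> X \<longrightarrow> p02 k \<notin> X \<and> p12 k \<notin> X"
    and "\<forall>k<l. \<forall>j<k. \<forall>i<j. (p12 i \<in> X \<or> p13 i \<in> X) \<longrightarrow> p03 j \<in> X \<longrightarrow> p02 k \<notin> X \<and> p12 k \<notin> X"
    and "\<forall>k<l. \<forall>j<k. \<forall>i<j. (p12 i \<in> X \<or> p13 i \<in> X) \<longrightarrow> p02 j \<in> X \<or> p03 j \<in> X \<longrightarrow> p01 k \<notin> X"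
    and "\<forall>m<l. \<forall>k<m. \<forall>j\<le>k. \<forall>i<j. (p12 i \<in> X \<or> p13 i \<in> X) \<longrightarrow> p02 j \<in> X \<longrightarrow> p13 k \<in> X \<longrightarrow>
      p02 m \<notin> X \<and> p12 m \<notin> X"
  shows "face l 3 X"
  using assms(2-)
proof (induction l)
  case (Suc l)
  have cd: "\<not> (p03 l \<in> X \<and> p12 l \<in> X)"
    using Suc.prems(1) by blast
  consider (a) "p01 l \<in> X" | (bd) "p01 l \<notin> X" "p02 l \<in> X \<or> p12 l \<in> X"
    | (o) "p01 l \<notin> X" "p02 l \<notin> X" "p12 l \<notin> X"
    by blast
  then show ?case
  proof cases
    case a
    have low: "face l 1 X" using Suc.prems a by (intro face_1[OF X]) (auto simp: less_Suc_eq)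
    show ?thesis
    proof (cases "p03 l \<in> X")
      case True
      then show ?thesis using cd low a
        by (intro face_step[OF X, of "{(0,1),(0,2),(0,3),(1,3),(2,3)}" 1]) (auto simp: transitions.simps)
    next
      case False
      then show ?thesis using cd low a
        by (intro face_step[OF X, of "{(0,1),(0,2),(1,2),(1,3),(2,3)}" 1]) (auto simp: transitions.simps)
    qed
  next
    case bd
    have low: "face l 2 X"
    proof (rule face_2[OF X])
      show "\<forall>i<l. \<not> (p03 i \<in> X \<and> p12 i \<in> X)"
        using Suc.prems(1) by simp
      show "\<forall>j<l. \<forall>i<j. p23 i \<in> X \<longrightarrow> p01 j \<notin> X \<and> p03 j \<notin> X \<and> p13 j \<notin> X"
        using Suc.prems(2) Suc.prems(3)[THEN spec, of l] bd(2) by simp blast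
      show "\<forall>j<l. \<forall>i<j. (p12 i \<in> X \<or> p13 i \<in> X) \<longrightarrow> p03 j \<notin> X"
        using Suc.prems(4)[THEN spec, of l] bd(2) by simp blast
      show "\<forall>k<l. \<forall>j<k. \<forall>i<j. (p12 i \<in> X \<or> p13 i \<in> X) \<longrightarrow>
          p02 j \<in> X \<or> p03 j \<in> X \<longrightarrow> p01 k \<notin> X"
        using Suc.prems(5) less_SucI[of _ l] by blast
      show "\<forall>k<l. \<forall>j\<le>k. \<forall>i<j. (p12 i \<in> X \<or> p13 i \<in> X) \<longrightarrow> p02 j \<in> X \<longrightarrow> p13 k \<notin> X"
        using Suc.prems(6)[THEN spec, of l] bd(2) by simp blast
    qed
    show ?thesis
    proof (cases "p03 l \<in> X")
      case True
      then show ?thesis using cd low bd(1)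
        by (intro face_step[OF X, of "{(0,2),(0,3),(1,3),(2,3)}" 2]) (auto simp: transitions.simps)
    next
      case False
      then show ?thesis using cd low bd(1)
        by (intro face_step[OF X, of "{(0,2),(1,2),(1,3),(2,3)}" 2]) (auto simp: transitions.simps)
    qed
  next
    case o
    have "face l 3 X" by (rule Suc.IH[OF Suc.prems[THEN all_less_SucD]])
    then show ?thesis using o
      by (intro face_step[OF X, of "{(0,3),(1,3),(2,3)}" 3]) (auto simp: transitions.simps)
  qed
qed simp

lemma nonface_cover:
  assumes X: "X \<subseteq> coords n" and "\<not> face n 3 X"
  shows "\<exists>B\<in>nonfaces n. B \<subseteq> X"
proof (rule ccontr)
  assume contra: "\<not> ?thesis"
  have no: "\<not> B \<subseteq> X" if "B \<in> nonfaces n" for B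
    using contra that by blast
  have no2: "\<not> (p03 i \<in> X \<and> p12 i \<in> X)" if "i < n" for i
    using no[OF nonfacesI(1)[OF that]] by simp
  have no2': "\<not> (p23 i \<in> X \<and> p01 j \<in> X)" if "i < j" "j < n" for i j
    using no[OF nonfacesI(2)[OF that]] by simp
  have no3: "\<not> (Coord i p p' \<in> X \<and> Coord j q q' \<in> X \<and> Coord k r r' \<in> X)"
    if "i < j" "j < k" "k < n" "((p, p'), (q, q'), (r, r')) \<in> cubic_types" for i j k p p' q q' r r'
    using no[OF nonfacesI(3)[OF that]] by simp
  have no4: "\<not> (Coord i 1 p \<in> X \<and> p02 j \<in> X \<and> p13 k \<in> X \<and> Coord l r 2 \<in> X)"
    if "i < j" "j \<le> k" "k < l" "l < n" "p \<in> {2, 3}" "r \<in> {0, 1}" for i j k l p r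
    using no[OF nonfacesI(4)[OF that]] by simp
  have "face n 3 X"
  proof (rule face_3[OF X]; intro allI impI)
    fix i assume "i < n" then show "\<not> (p03 i \<in> X \<and> p12 i \<in> X)" by (rule no2)
  next
    fix j i assume "j < n" "i < j" "p23 i \<in> X" then show "p01 j \<notin> X" using no2' by blast
  next
    fix k j i assume "k < n" "j < k" "i < j" "p23 i \<in> X" "p03 j \<in> X \<or> p13 j \<in> X"
    then show "p02 k \<notin> X \<and> p12 k \<notin> X"
      using no3[of i j k 2 3 0 3 0 2] no3[of i j k 2 3 0 3 1 2] no3[of i j k 2 3 1 3 0 2] no3[of i j k 2 3 1 3 1 2]
      by (auto simp: cubic_types_def)
  next
    fix k j i assume "k < n" "j < k" "i < j" "p12 i \<in> X \<or> p13 i \<in> X" "p03 j \<in> X"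
    then show "p02 k \<notin> X \<and> p12 k \<notin> X"
      using no3[of i j k 1 2 0 3 0 2] no3[of i j k 1 2 0 3 1 2] no3[of i j k 1 3 0 3 0 2] no3[of i j k 1 3 0 3 1 2]
      by (auto simp: cubic_types_def)
  next
    fix k j i assume "k < n" "j < k" "i < j" "p12 i \<in> X \<or> p13 i \<in> X" "p02 j \<in> X \<or> p03 j \<in> X"
    then show "p01 k \<notin> X"
      using no3[of i j k 1 2 0 2 0 1] no3[of i j k 1 2 0 3 0 1] no3[of i j k 1 3 0 2 0 1] no3[of i j k 1 3 0 3 0 1]
      by (auto simp: cubic_types_def)
  next
    fix m k j i assume "m < n" "k < m" "j \<le> k" "i < j" "p12 i \<in> X \<or> p13 i \<in> X"
      "p02 j \<in> X" "p13 k \<in> X"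
    then show "p02 m \<notin> X \<and> p12 m \<notin> X"
      using no4[of i j k m 2 0] no4[of i j k m 2 1] no4[of i j k m 3 0] no4[of i j k m 3 1]
      by auto
  qed
  with assms(2) show False by contradiction
qed

section \<open>A Groebner basis\<close>

definition vm :: "coord list \<Rightarrow> mpoly" where
  "vm xs = (\<Prod>v\<leftarrow>xs. var v)"

lemma vm_single: "vm xs = single (lmon xs) 1"
  unfolding vm_def by (rule prod_list_var)

text \<open>Equal degree is demanded so that rewriting stays within one degree, where the order is
  well-founded.\<close>

definition below :: "nat \<Rightarrow> monomial \<Rightarrow> mpoly \<Rightarrow> bool" where
  "below n m h \<longleftrightarrow> h \<in> polys n \<and> (\<forall>t\<in>keys h. mdeg t = mdeg m \<and> t \<prec> m)"

lemma below_add: "below n m f \<Longrightarrow> below n m g \<Longrightarrow> below n m (f + g)"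
  using Poly_Mapping.keys_add[of f g] by (auto simp: below_def intro: carrier_add)

lemma below_uminus: "below n m f \<Longrightarrow> below n m (- f)"
  by (auto simp: below_def in_keys_iff intro: carrier_uminus)

lemma below_diff: "below n m f \<Longrightarrow> below n m g \<Longrightarrow> below n m (f - g)"
  using below_add[of n m f "- g"] below_uminus by simp

lemma below_const_mult: "below n m f \<Longrightarrow> below n m (single 0 c * f)"
proof -
  assume f: "below n m f"
  have "t \<in> keys f" if t: "t \<in> keys (single 0 c * f)" for t
    using t by (rule keys_mult_mon) (auto split: if_splits)
  with f show ?thesis by (auto simp: below_def intro: carrier_mult carrier_const)
qed

lemma below_numeral: "below n m f \<Longrightarrow> below n m (numeral k * f)"
  using below_const_mult[of n m f "numeral k"] by simp

lemma below_vm: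
  assumes "set xs \<subseteq> coords n" "length xs = length ys" "lexless xs ys" "sorted ys"
  shows "below n (lmon ys) (vm xs)"
  unfolding below_def vm_single using assms degrevlex_lmon[OF assms(3,4,2)]
  by (auto simp: mdeg_lmon keys_lmon intro!: carrier_single)

lemmas below_intros = below_add below_diff below_uminus below_numeral below_vm

definition lead_in :: "nat \<Rightarrow> mpoly set \<Rightarrow> coord list \<Rightarrow> bool" where
  "lead_in n I xs \<longleftrightarrow> (\<exists>h. vm xs + h \<in> I \<and> below n (lmon xs) h)"

definition quad :: "nat \<Rightarrow> nat \<Rightarrow> mpoly" where
  "quad i j = var (p01 i) * var (p23 j) + var (p23 i) * var (p01 j)
     - var (p02 i) * var (p13 j) - var (p13 i) * var (p02 j)
     + var (p03 i) * var (p12 j) + var (p12 i) * var (p03 j)"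

definition det3 :: "nat \<times> nat \<Rightarrow> nat \<times> nat \<Rightarrow> nat \<times> nat \<Rightarrow> nat \<Rightarrow> nat \<Rightarrow> nat \<Rightarrow> mpoly" where
  "det3 p q r i j k = (let x = (\<lambda>l s. var (Coord l (fst s) (snd s))) in
     x i p * (x j q * x k r - x k q * x j r) - x j p * (x i q * x k r - x k q * x i r)
     + x k p * (x i q * x j r - x j q * x i r))"

text \<open>
  The squares and the mixed terms of the cubics as quadratic functions of \<open>u\<close>: \<open>det_a\<close> belongs to
  \<open>u\<^sub>a\<^sup>2\<close> and \<open>det_ab\<close> to \<open>u\<^sub>a u\<^sub>b\<close>, up to sign.
\<close>

definition "det_0 = det3 (2,3) (1,3) (1,2)"
definition "det_1 = det3 (2,3) (0,3) (0,2)"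
definition "det_2 = det3 (1,3) (0,3) (0,1)"
definition "det_3 = det3 (1,2) (0,2) (0,1)"
definition "det_01 i j k = det3 (2,3) (1,3) (0,2) i j k + det3 (2,3) (0,3) (1,2) i j k"
definition "det_02 i j k = det3 (2,3) (1,3) (0,1) i j k + det3 (1,3) (0,3) (1,2) i j k"
definition "det_03 i j k = det3 (2,3) (1,2) (0,1) i j k - det3 (1,3) (1,2) (0,2) i j k"
definition "det_12 i j k = det3 (2,3) (0,3) (0,1) i j k + det3 (1,3) (0,3) (0,2) i j k"
definition "det_13 i j k = det3 (2,3) (0,2) (0,1) i j k + det3 (1,2) (0,3) (0,2) i j k"
definition "det_23 i j k = det3 (1,3) (0,2) (0,1) i j k + det3 (1,2) (0,3) (0,1) i j k"

lemmas det_defs = det_0_def det_1_def det_2_def det_3_def det_01_def det_02_def det_03_def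
  det_12_def det_13_def det_23_def

lemmas generator_defs = quad_def det_defs det3_def Let_def fst_conv snd_conv

lemmas vm_simps = generator_defs vm_def algebra_simps

lemmas lex_simps = coords_def less_coord_def less_eq_coord_def

lemma det3_same: "det3 p q r i j j = 0" "det3 p q r i i j = 0"
  by (simp_all add: det3_def Let_def algebra_simps)

text \<open>The identities below use nothing but these members of the ideal. They will be applied to
  the generated ideal, not to the kernel, and this is what forces the two to agree.\<close>

locale concurrent_gens =
  fixes n :: nat and I :: "mpoly set"
  assumes ideal_I: "ideal I (poly_ring n)"
    and quad_I: "\<And>i j. i \<le> j \<Longrightarrow> j < n \<Longrightarrow> quad i j \<in> I"
    and det_I: "\<And>i j k. i < j \<Longrightarrow> j < k \<Longrightarrow> k < n \<Longrightarrow>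
      {det_0 i j k, det_1 i j k, det_2 i j k, det_3 i j k, det_01 i j k, det_02 i j k, det_03 i j k,
       det_12 i j k, det_13 i j k, det_23 i j k} \<subseteq> I"
begin

lemmas I_add = ideal_add[OF ideal_I] and I_diff = ideal_diff[OF ideal_I] and I_uminus = ideal_uminus[OF ideal_I]

lemma I_var: "v \<in> coords n \<Longrightarrow> f \<in> I \<Longrightarrow> var v * f \<in> I"
  by (intro ideal_mult[OF ideal_I] carrier_var)

text \<open>A repeated line makes every determinant vanish, so the identities for the quartics
  remain valid when j = k.\<close>

lemma det_I_le:
  assumes "i \<le> j" "j \<le> k" "k < n"
  shows "det_0 i j k \<in> I" "det_1 i j k \<in> I" "det_2 i j k \<in> I" "det_3 i j k \<in> I" "det_01 i j k \<in> I"
    "det_02 i j k \<in> I" "det_03 i j k \<in> I" "det_12 i j k \<in> I" "det_13 i j k \<in> I" "det_23 i j k \<in> I"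
proof -
  consider "i < j" "j < k" | "i = j" | "j = k" using assms by linarith
  then have "{det_0 i j k, det_1 i j k, det_2 i j k, det_3 i j k, det_01 i j k, det_02 i j k, det_03 i j k,
       det_12 i j k, det_13 i j k, det_23 i j k} \<subseteq> I"
  proof cases
    case 1
    then show ?thesis using assms(3) by (rule det_I)
  qed (simp_all add: det_defs det3_same ideal_0[OF ideal_I])
  then show "det_0 i j k \<in> I" "det_1 i j k \<in> I" "det_2 i j k \<in> I" "det_3 i j k \<in> I" "det_01 i j k \<in> I"
    "det_02 i j k \<in> I" "det_03 i j k \<in> I" "det_12 i j k \<in> I" "det_13 i j k \<in> I" "det_23 i j k \<in> I"
    by simp_all
qed

lemmas I_intros = I_add I_diff I_uminus I_var quad_I det_I_le

lemma leadI_1: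
  assumes "g \<in> I" "g = vm xs + h" "below n (lmon xs) h"
  shows "lead_in n I xs"
  using assms unfolding lead_in_def by blast

lemma leadI_2:
  assumes "g \<in> I" "g = 2 * vm xs + h" "below n (lmon xs) h"
  shows "lead_in n I xs"
proof -
  let ?c = "single 0 (1/2) :: mpoly"
  have "?c * 2 = 1"
    by (metis (no_types, lifting) add_0 divide_inverse mult_single mult.left_neutral single_numeral
        left_inverse zero_neq_numeral single_one)
  then have "?c * g = vm xs + ?c * h" using assms(2) by (simp add: distrib_left mult.assoc[symmetric])
  moreover have "?c * g \<in> I" by (intro ideal_mult[OF ideal_I] assms carrier_const)
  ultimately show ?thesis using leadI_1 below_const_mult[OF assms(3)] by blast
qed

section \<open>Elements with the cubic leading monomials; the names spell the letters on lines i, j,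
  k\<close>

lemma lead_fed:
  assumes "i < j" "j < k" "k < n"
  shows "lead_in n I [p12 k, p13 j, p23 i]"
  by ((rule leadI_1[of
      "(det_0 i j k)" _
      "- vm [p12 k, p23 j, p13 i] - vm [p13 k, p12 j, p23 i] + vm [p13 k, p23 j, p12 i]
      + vm [p23 k, p12 j, p13 i] - vm [p23 k, p13 j, p12 i]"]; insert assms),
    (intro I_intros; simp add: coords_def), simp add: vm_simps, (intro below_intros; auto simp: lex_simps))

lemma lead_fcb:
  assumes "i < j" "j < k" "k < n"
  shows "lead_in n I [p02 k, p03 j, p23 i]"
  by ((rule leadI_1[of
      "(det_1 i j k)" _
      "- vm [p02 k, p23 j, p03 i] - vm [p03 k, p02 j, p23 i] + vm [p03 k, p23 j, p02 i]
      + vm [p23 k, p02 j, p03 i] - vm [p23 k, p03 j, p02 i]"]; insert assms),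
    (intro I_intros; simp add: coords_def), simp add: vm_simps, (intro below_intros; auto simp: lex_simps))

lemma lead_eca:
  assumes "i < j" "j < k" "k < n"
  shows "lead_in n I [p01 k, p03 j, p13 i]"
  by ((rule leadI_1[of
      "(det_2 i j k)" _
      "- vm [p01 k, p13 j, p03 i] - vm [p03 k, p01 j, p13 i] + vm [p03 k, p13 j, p01 i]
      + vm [p13 k, p01 j, p03 i] - vm [p13 k, p03 j, p01 i]"]; insert assms),
    (intro I_intros; simp add: coords_def), simp add: vm_simps, (intro below_intros; auto simp: lex_simps))

lemma lead_dba:
  assumes "i < j" "j < k" "k < n"
  shows "lead_in n I [p01 k, p02 j, p12 i]"
  by ((rule leadI_1[of
      "(det_3 i j k)" _
      "- vm [p01 k, p12 j, p02 i] - vm [p02 k, p01 j, p12 i] + vm [p02 k, p12 j, p01 i]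
      + vm [p12 k, p01 j, p02 i] - vm [p12 k, p02 j, p01 i]"]; insert assms),
    (intro I_intros; simp add: coords_def), simp add: vm_simps, (intro below_intros; auto simp: lex_simps))

lemma lead_feb:
  assumes "i < j" "j < k" "k < n"
  shows "lead_in n I [p02 k, p13 j, p23 i]"
  by ((rule leadI_1[of
      "(det_01 i j k)" _
      "- vm [p02 k, p23 j, p13 i] - vm [p03 k, p12 j, p23 i] + vm [p03 k, p23 j, p12 i]
      + vm [p12 k, p03 j, p23 i] - vm [p12 k, p23 j, p03 i] - vm [p13 k, p02 j, p23 i]
      + vm [p13 k, p23 j, p02 i] + vm [p23 k, p02 j, p13 i] - vm [p23 k, p03 j, p12 i]
      + vm [p23 k, p12 j, p03 i] - vm [p23 k, p13 j, p02 i]"]; insert assms),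
    (intro I_intros; simp add: coords_def), simp add: vm_simps, (intro below_intros; auto simp: lex_simps))

lemma lead_eba:
  assumes "i < j" "j < k" "k < n"
  shows "lead_in n I [p01 k, p02 j, p13 i]"
  by ((rule leadI_1[of
      "(det_23 i j k)" _
      "vm [p01 k, p03 j, p12 i] - vm [p01 k, p12 j, p03 i] - vm [p01 k, p13 j, p02 i]
      - vm [p02 k, p01 j, p13 i] + vm [p02 k, p13 j, p01 i] - vm [p03 k, p01 j, p12 i]
      + vm [p03 k, p12 j, p01 i] + vm [p12 k, p01 j, p03 i] - vm [p12 k, p03 j, p01 i]
      + vm [p13 k, p01 j, p02 i] - vm [p13 k, p02 j, p01 i]"]; insert assms),
    (intro I_intros; simp add: coords_def), simp add: vm_simps, (intro below_intros; auto simp: lex_simps))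

text \<open>\<open>det_23\<close> itself leads with e_i b_j a_k, which is already covered. The
  multiple of \<open>quad i j\<close> cancels this term and doubles d_i c_j a_k, the one of
  \<open>quad i k\<close> removes the new f_i a_j a_k.\<close>

lemma lead_dca:
  assumes "i < j" "j < k" "k < n"
  shows "lead_in n I [p01 k, p03 j, p12 i]"
  by ((rule leadI_2[of
      "- (var (p01 j) * (quad i k)) + var (p01 k) * (quad i j) + (det_23 i j k)" _
      "- (2 * vm [p01 k, p13 j, p02 i]) + vm [p01 k, p23 j, p01 i] + vm [p02 k, p13 j, p01 i]
      - 2 * vm [p03 k, p01 j, p12 i] + vm [p03 k, p12 j, p01 i] - vm [p12 k, p03 j, p01 i]
      + 2 * vm [p13 k, p01 j, p02 i] - vm [p13 k, p02 j, p01 i] - vm [p23 k, p01 j, p01 i]"]; insert assms),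
    (intro I_intros; simp add: coords_def), simp add: vm_simps, (intro below_intros; auto simp: lex_simps))

text \<open>As before, the term f_i e_j b_k that leads \<open>det_01\<close> is cancelled by a
  quadric, and the coefficient of f_i c_j d_k doubles.\<close>

lemma lead_fcd:
  assumes "i < j" "j < k" "k < n"
  shows "lead_in n I [p12 k, p03 j, p23 i]"
  by ((rule leadI_2[of
      "var (p23 i) * (quad j k) - var (p23 j) * (quad i k) + (det_01 i j k)" _
      "- (2 * vm [p12 k, p23 j, p03 i]) - 2 * vm [p13 k, p02 j, p23 i] + 2 * vm [p13 k, p23 j, p02 i]
      + vm [p23 k, p01 j, p23 i] + vm [p23 k, p02 j, p13 i] - vm [p23 k, p03 j, p12 i]
      + vm [p23 k, p12 j, p03 i] - vm [p23 k, p13 j, p02 i] - vm [p23 k, p23 j, p01 i]"]; insert assms),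
    (intro I_intros; simp add: coords_def), simp add: vm_simps, (intro below_intros; auto simp: lex_simps))

text \<open>\<open>det_13\<close> leads with f_i b_j a_k, a multiple of the quadric lead f_i a_k;
  the same divisor occurs in the leads of \<open>det_12\<close>, \<open>det_03\<close> and
  \<open>det_02\<close> used next. Cancelling by quadrics exposes the new leading monomials.\<close>

lemma lead_dcb:
  assumes "i < j" "j < k" "k < n"
  shows "lead_in n I [p02 k, p03 j, p12 i]"
  by ((rule leadI_2[of
      "var (p02 i) * (quad j k) - var (p02 j) * (quad i k) + var (p02 k) * (quad i j) + (det_13 i j k)" _
      "- (2 * vm [p02 k, p13 j, p02 i]) + 2 * vm [p02 k, p23 j, p01 i] - 2 * vm [p03 k, p02 j, p12 i]
      + 2 * vm [p03 k, p12 j, p02 i] + 2 * vm [p23 k, p01 j, p02 i] - 2 * vm [p23 k, p02 j, p01 i]"]; insert assms),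
    (intro I_intros; simp add: coords_def), simp add: vm_simps, (intro below_intros; auto simp: lex_simps))

lemma lead_ecb:
  assumes "i < j" "j < k" "k < n"
  shows "lead_in n I [p02 k, p03 j, p13 i]"
  by ((rule leadI_2[of
      "var (p03 i) * (quad j k) - var (p03 j) * (quad i k) + (det_12 i j k)" _
      "- (2 * vm [p02 k, p13 j, p03 i]) - vm [p03 k, p01 j, p23 i] - vm [p03 k, p02 j, p13 i]
      - vm [p03 k, p03 j, p12 i] + vm [p03 k, p12 j, p03 i] + vm [p03 k, p13 j, p02 i]
      + vm [p03 k, p23 j, p01 i] + 2 * vm [p23 k, p01 j, p03 i] - 2 * vm [p23 k, p03 j, p01 i]"]; insert assms),
    (intro I_intros; simp add: coords_def), simp add: vm_simps, (intro below_intros; auto simp: lex_simps))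

lemma lead_dcd:
  assumes "i < j" "j < k" "k < n"
  shows "lead_in n I [p12 k, p03 j, p12 i]"
  by ((rule leadI_2[of
      "var (p12 i) * (quad j k) - var (p12 j) * (quad i k) + var (p12 k) * (quad i j) + (det_03 i j k)" _
      "- (2 * vm [p12 k, p13 j, p02 i]) + 2 * vm [p12 k, p23 j, p01 i] - 2 * vm [p13 k, p02 j, p12 i]
      + 2 * vm [p13 k, p12 j, p02 i] + 2 * vm [p23 k, p01 j, p12 i] - 2 * vm [p23 k, p12 j, p01 i]"]; insert assms),
    (intro I_intros; simp add: coords_def), simp add: vm_simps, (intro below_intros; auto simp: lex_simps))

lemma lead_ecd:
  assumes "i < j" "j < k" "k < n"
  shows "lead_in n I [p12 k, p03 j, p13 i]"
  by ((rule leadI_2[of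
      "var (p13 i) * (quad j k) - var (p13 j) * (quad i k) + (det_02 i j k)" _
      "- (2 * vm [p12 k, p13 j, p03 i]) - vm [p13 k, p01 j, p23 i] - vm [p13 k, p02 j, p13 i]
      - vm [p13 k, p03 j, p12 i] + vm [p13 k, p12 j, p03 i] + vm [p13 k, p13 j, p02 i]
      + vm [p13 k, p23 j, p01 i] + 2 * vm [p23 k, p01 j, p13 i] - 2 * vm [p23 k, p13 j, p01 i]"]; insert assms),
    (intro I_intros; simp add: coords_def), simp add: vm_simps, (intro below_intros; auto simp: lex_simps))

text \<open>The S-polynomial of \<open>quad i j\<close>, with lead f_i a_j, and
  \<open>det_01 i k l\<close>, with lead f_i e_k b_l. Replacing the latter by
  \<open>det_0 i k l\<close>, with lead f_i e_k d_l, gives the next quartic.\<close>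

lemma lead_ebeb:
  assumes "i < j" "j \<le> k" "k < l" "l < n"
  shows "lead_in n I [p02 l, p13 k, p02 j, p13 i]"
  by ((rule leadI_1[of
      "- (var (p13 k) * (var (p02 l) * (quad i j))) + var (p01 j) * (det_01 i k l)" _
      "- vm [p02 l, p13 k, p03 j, p12 i] - vm [p02 l, p13 k, p12 j, p03 i]
      + vm [p02 l, p13 k, p13 j, p02 i] - vm [p02 l, p13 k, p23 j, p01 i]
      - vm [p02 l, p23 k, p01 j, p13 i] - vm [p03 l, p12 k, p01 j, p23 i]
      + vm [p03 l, p23 k, p01 j, p12 i] + vm [p12 l, p03 k, p01 j, p23 i]
      - vm [p12 l, p23 k, p01 j, p03 i] - vm [p13 l, p02 k, p01 j, p23 i]
      + vm [p13 l, p23 k, p01 j, p02 i] + vm [p23 l, p02 k, p01 j, p13 i]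
      - vm [p23 l, p03 k, p01 j, p12 i] + vm [p23 l, p12 k, p01 j, p03 i]
      - vm [p23 l, p13 k, p01 j, p02 i]"]; insert assms),
    (intro I_intros; simp add: coords_def), simp add: vm_simps, (intro below_intros; auto simp: lex_simps))

lemma lead_ebed:
  assumes "i < j" "j \<le> k" "k < l" "l < n"
  shows "lead_in n I [p12 l, p13 k, p02 j, p13 i]"
  by ((rule leadI_1[of
      "- (var (p13 k) * (var (p12 l) * (quad i j))) + var (p01 j) * (det_0 i k l)" _
      "- vm [p12 l, p13 k, p03 j, p12 i] - vm [p12 l, p13 k, p12 j, p03 i]
      + vm [p12 l, p13 k, p13 j, p02 i] - vm [p12 l, p13 k, p23 j, p01 i]
      - vm [p12 l, p23 k, p01 j, p13 i] - vm [p13 l, p12 k, p01 j, p23 i]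
      + vm [p13 l, p23 k, p01 j, p12 i] + vm [p23 l, p12 k, p01 j, p13 i]
      - vm [p23 l, p13 k, p01 j, p12 i]"]; insert assms),
    (intro I_intros; simp add: coords_def), simp add: vm_simps, (intro below_intros; auto simp: lex_simps))

text \<open>For j < k the first summand supplies d_i b_j e_k b_l, and the other multiples are chosen
  so that all monomials above it cancel.\<close>

lemma lead_dbeb:
  assumes "i < j" "j \<le> k" "k < l" "l < n"
  shows "lead_in n I [p02 l, p13 k, p02 j, p12 i]"
  by ((rule leadI_1[of
      "- (var (p12 i) * (var (p02 l) * (quad j k))) + var (p12 j) * (var (p02 l) * (quad i k))
      + var (p23 i) * (det_3 j k l) - var (p02 k) * (det_03 i j l) - var (p23 j) * (det_3 i k l)
      + var (p12 k) * (det_13 i j l)" _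
      "- vm [p02 l, p13 k, p12 j, p02 i] - vm [p02 l, p23 k, p01 j, p12 i]
      + vm [p02 l, p23 k, p12 j, p01 i] - vm [p03 l, p12 k, p02 j, p12 i]
      + vm [p03 l, p12 k, p12 j, p02 i] + vm [p12 l, p01 k, p02 j, p23 i]
      - vm [p12 l, p01 k, p23 j, p02 i] - vm [p12 l, p02 k, p02 j, p13 i]
      + vm [p12 l, p02 k, p13 j, p02 i] + vm [p12 l, p12 k, p02 j, p03 i]
      - vm [p12 l, p12 k, p03 j, p02 i] + vm [p13 l, p02 k, p02 j, p12 i]
      - vm [p13 l, p02 k, p12 j, p02 i] - vm [p23 l, p02 k, p01 j, p12 i]
      + vm [p23 l, p02 k, p12 j, p01 i] + vm [p23 l, p12 k, p01 j, p02 i]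
      - vm [p23 l, p12 k, p02 j, p01 i]"]; insert assms),
    (intro I_intros; simp add: coords_def), simp add: vm_simps, (intro below_intros; auto simp: lex_simps))

text \<open>For j < k this is the S-polynomial of the two cubics of \<open>lead_dcd\<close> on i, j,
  l and on i, j, k, in which the multiples of \<open>quad i j\<close> cancel.\<close>

lemma lead_dbed:
  assumes "i < j" "j \<le> k" "k < l" "l < n"
  shows "lead_in n I [p12 l, p13 k, p02 j, p12 i]"
  by ((rule leadI_2[of
      "var (p12 i) * (var (p12 k) * (quad j l)) - var (p12 j) * (var (p12 k) * (quad i l))
      - var (p12 i) * (var (p12 l) * (quad j k)) + var (p12 j) * (var (p12 l) * (quad i k))
      + var (p12 k) * (det_03 i j l) - var (p12 l) * (det_03 i j k)" _
      "- (2 * vm [p12 l, p13 k, p12 j, p02 i]) - 2 * vm [p12 l, p23 k, p01 j, p12 i]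
      + 2 * vm [p12 l, p23 k, p12 j, p01 i] - 2 * vm [p13 l, p12 k, p02 j, p12 i]
      + 2 * vm [p13 l, p12 k, p12 j, p02 i] + 2 * vm [p23 l, p12 k, p01 j, p12 i]
      - 2 * vm [p23 l, p12 k, p12 j, p01 i]"]; insert assms),
    (intro I_intros; simp add: coords_def), simp add: vm_simps, (intro below_intros; auto simp: lex_simps))

lemma lead_cd:
  assumes "i < n"
  shows "lead_in n I [p12 i, p03 i]"
  by ((rule leadI_2[of "quad i i" _ "2 * vm [p23 i, p01 i] - 2 * vm [p13 i, p02 i]"]; insert assms),
    (intro I_intros; simp add: coords_def), simp add: vm_simps, (intro below_intros; auto simp: lex_simps))

lemma lead_fa:
  assumes "i < j" "j < n"
  shows "lead_in n I [p01 j, p23 i]"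
  by ((rule leadI_1[of "quad i j" _
      "vm [p23 j, p01 i] - vm [p13 j, p02 i] - vm [p02 j, p13 i] + vm [p12 j, p03 i] + vm [p03 j, p12 i]"]; insert assms),
    (intro I_intros; simp add: coords_def), simp add: vm_simps, (intro below_intros; auto simp: lex_simps))


end

section \<open>The traces and the minors as explicit polynomials\<close>

lemma P_mat_dim: "dim_row (P_mat l) = 4" "dim_col (P_mat l) = 4" "dim_row (P_dual l) = 4" "dim_col (P_dual l) = 4"
  by (simp_all add: P_mat_def P_dual_def mat_of_rows_list_def Let_def)

lemma less_4_iff: "(s::nat) < 4 \<longleftrightarrow> s = 0 \<or> s = 1 \<or> s = 2 \<or> s = 3"
  by auto

lemma lessThan_4: "{..<4::nat} = {0, 1, 2, 3}" "{0..<4::nat} = {0, 1, 2, 3}"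
  by auto

lemma P_mat_entries:
  assumes "s < 4" "t < 4"
  shows "P_mat l $$ (s, t) =
      [[0, var (p23 l), - var (p13 l), var (p12 l)], [- var (p23 l), 0, var (p03 l), - var (p02 l)],
       [var (p13 l), - var (p03 l), 0, var (p01 l)], [- var (p12 l), var (p02 l), - var (p01 l), 0]] ! s ! t"
    "P_dual l $$ (s, t) =
      [[0, var (p01 l), var (p02 l), var (p03 l)], [- var (p01 l), 0, var (p12 l), var (p13 l)],
       [- var (p02 l), - var (p12 l), 0, var (p23 l)], [- var (p03 l), - var (p13 l), - var (p23 l), 0]] ! s ! t"
  using assms by (simp_all add: P_mat_def P_dual_def mat_of_rows_list_def Let_def)

lemma trace_eq_quad: "mat_trace (P_mat i * P_dual j) = - (2 * quad i j)"
proof -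
  have "mat_trace (P_mat i * P_dual j) = (\<Sum>r\<in>{0,1,2,3}. \<Sum>s\<in>{0,1,2,3}. P_mat i $$ (r, s) * P_dual j $$ (s, r))"
    unfolding mat_trace_def by (simp add: P_mat_dim lessThan_4 scalar_prod_def)
  also have "\<dots> = - (2 * quad i j)"
    by (simp add: P_mat_entries quad_def algebra_simps)
  finally show ?thesis .
qed

lemma quadrics_eq: "quadrics n = {- (2 * quad i j) | i j. i \<le> j \<and> j < n}"
  by (simp add: quadrics_def trace_eq_quad)

text \<open>Pairs p \<le> q, with p = q for the unit vectors, match the ten monomials of a quadratic
  form in u.\<close>

definition uvec :: "nat \<Rightarrow> nat \<Rightarrow> mpoly vec" where
  "uvec p q = (if p = q then unit_vec 4 p else unit_vec 4 p + unit_vec 4 q)"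

definition upairs :: "(nat \<times> nat) set" where
  "upairs = {(0,0),(1,1),(2,2),(3,3),(0,1),(0,2),(0,3),(1,2),(1,3),(2,3)}"

lemma upairs_iff: "(p, q) \<in> upairs \<longleftrightarrow> p \<le> q \<and> q < 4"
  unfolding upairs_def insert_iff empty_iff prod.inject by presburger

lemma ten_vectors_eq: "ten_vectors = (\<lambda>(p, q). uvec p q) ` upairs"
proof (rule equalityI; rule subsetI)
  fix u assume "u \<in> ten_vectors"
  then consider a where "u = unit_vec 4 a" "a < 4" | a b where "u = unit_vec 4 a + unit_vec 4 b" "a < b" "b < 4"
    unfolding ten_vectors_def by blast
  then obtain p q where "u = uvec p q" "(p, q) \<in> upairs"
  proof cases
    case (1 a)
    then show ?thesis by (intro that[of a a]) (auto simp: uvec_def upairs_iff)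
  next
    case (2 a b)
    then show ?thesis by (intro that[of a b]) (auto simp: uvec_def upairs_iff)
  qed
  then show "u \<in> (\<lambda>(p, q). uvec p q) ` upairs" by (force simp: image_iff)
next
  fix u assume "u \<in> (\<lambda>(p, q). uvec p q) ` upairs"
  then obtain p q where u: "u = uvec p q" "p \<le> q" "q < 4" by (auto simp: upairs_iff)
  show "u \<in> ten_vectors"
  proof (cases "p = q")
    case True
    with u have "u = unit_vec 4 p" "p < 4" by (auto simp: uvec_def)
    then show ?thesis unfolding ten_vectors_def by blast
  next
    case False
    with u have "u = unit_vec 4 p + unit_vec 4 q" "p < q" "q < 4" by (auto simp: uvec_def)
    then show ?thesis unfolding ten_vectors_def by blast
  qed
qed

lemma P_mat_uvec:
  assumes "s < 4" "p \<le> q" "q < 4"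
  shows "(P_mat l *\<^sub>v uvec p q) $ s = (if p = q then P_mat l $$ (s, p) else P_mat l $$ (s, p) + P_mat l $$ (s, q))"
proof -
  have "(p, q) \<in> upairs" using assms by (simp add: upairs_iff)
  then show ?thesis
    using assms(1) unfolding upairs_def less_4_iff
    by (elim insertE emptyE disjE; simp add: P_mat_dim uvec_def scalar_prod_def lessThan_4)
qed

lemma det_mat_3:
  fixes A :: "'a :: comm_ring_1 mat"
  assumes "A \<in> carrier_mat 3 3"
  shows "det A = A $$ (0,0) * (A $$ (1,1) * A $$ (2,2) - A $$ (1,2) * A $$ (2,1))
    - A $$ (0,1) * (A $$ (1,0) * A $$ (2,2) - A $$ (1,2) * A $$ (2,0))
    + A $$ (0,2) * (A $$ (1,0) * A $$ (2,1) - A $$ (1,1) * A $$ (2,0))"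
proof -
  have two: "det B = B $$ (0,0) * B $$ (1,1) - B $$ (0,1) * B $$ (1,0)" if "B \<in> carrier_mat 2 2" for B :: "'a mat"
  proof -
    have "det B = (\<Sum>j<2. B $$ (0,j) * cofactor B 0 j)"
      using that by (intro laplace_expansion_row) auto
    moreover have "det (mat_delete B 0 j) = mat_delete B 0 j $$ (0,0)" if "j < 2" for j
      using \<open>B \<in> carrier_mat 2 2\<close> by (intro det_single) (auto simp: mat_delete_def)
    ultimately show ?thesis
      using that by (simp add: numeral_2_eq_2 cofactor_def) (simp add: mat_delete_def)
  qed
  have "det A = (\<Sum>j<3. A $$ (0,j) * cofactor A 0 j)"
    using assms by (intro laplace_expansion_row) auto
  also have "\<dots> = (\<Sum>j\<in>{0,1,2}. A $$ (0,j) * cofactor A 0 j)"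
    by (intro sum.cong) auto
  finally have 1: "det A = (\<Sum>j\<in>{0,1,2}. A $$ (0,j) * cofactor A 0 j)" .
  have dim: "dim_row A = 3" "dim_col A = 3" using assms by auto
  have "mat_delete A 0 j \<in> carrier_mat 2 2" for j
    using assms by (auto simp: mat_delete_def)
  then have D: "det (mat_delete A 0 j) = mat_delete A 0 j $$ (0,0) * mat_delete A 0 j $$ (1,1)
      - mat_delete A 0 j $$ (0,1) * mat_delete A 0 j $$ (1,0)" for j
    by (rule two)
  show ?thesis
    unfolding 1 cofactor_def D by (simp add: mat_delete_def dim numeral_2_eq_2[symmetric] algebra_simps)
qed

lemma pick_3:
  assumes "x < y" "y < z"
  shows "pick {x, y, z} 0 = x" "pick {x, y, z} (Suc 0) = y" "pick {x, y, z} 2 = z"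
proof -
  show 0: "pick {x, y, z} 0 = x"
    using assms by (auto intro!: Least_equality)
  show 1: "pick {x, y, z} (Suc 0) = y"
    unfolding pick.simps(2) 0 using assms by (auto intro!: Least_equality)
  show "pick {x, y, z} 2 = z"
    unfolding numeral_2_eq_2 pick.simps(2)[of _ "Suc 0"] 1 using assms by (auto intro!: Least_equality)
qed

definition other_rows :: "nat \<Rightarrow> nat \<times> nat \<times> nat" where
  "other_rows r = (if r = 0 then (1,2,3) else if r = 1 then (0,2,3) else if r = 2 then (0,1,3) else (0,1,2))"

definition minor3 :: "(nat \<Rightarrow> nat \<Rightarrow> mpoly) \<Rightarrow> nat \<Rightarrow> nat \<Rightarrow> nat \<Rightarrow> nat \<Rightarrow> mpoly" where
  "minor3 x r i j k = (case other_rows r of (s, t, v) \<Rightarrow>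
     x i s * (x j t * x k v - x k t * x j v) - x j s * (x i t * x k v - x k t * x i v)
     + x k s * (x i t * x j v - x j t * x i v))"

lemma minor_eq:
  assumes "i < j" "j < k" "k < n" "r < 4" "dim_vec u = 4"
  shows "minor n u r {i, j, k} = minor3 (\<lambda>l s. (P_mat l *\<^sub>v u) $ s) r i j k"
proof -
  obtain s t v where R: "other_rows r = (s, t, v)" by (cases "other_rows r")
  then have stv: "{..<4} - {r} = {s, t, v}" "s < t" "t < v" "v < 4"
    using assms(4) by (auto simp: other_rows_def less_4_iff split: if_splits)
  let ?M = "concurrent_mat n u"
  have M: "?M $$ (p, q) = (P_mat q *\<^sub>v u) $ p" if "p < 4" "q < n" for p q
    using that by (simp add: concurrent_mat_def mat_of_cols_index)
  have dimM: "dim_row ?M = 4" "dim_col ?M = n" by (simp_all add: concurrent_mat_def)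
  let ?S = "submatrix ?M {s, t, v} {i, j, k}"
  have "{p. p < dim_row ?M \<and> p \<in> {s, t, v}} = {s, t, v}" "{p. p < dim_col ?M \<and> p \<in> {i, j, k}} = {i, j, k}"
    using stv(2-4) assms(1-3) unfolding dimM by auto
  moreover have "card {s, t, v} = 3" "card {i, j, k} = 3" using stv(2,3) assms(1,2) by auto
  ultimately have S: "?S = mat 3 3 (\<lambda>(p, q). ?M $$ (pick {s, t, v} p, pick {i, j, k} q))"
    unfolding submatrix_def by simp
  have "minor n u r {i, j, k} = det ?S" by (simp only: minor_def stv(1))
  also have "\<dots> = minor3 (\<lambda>l s. (P_mat l *\<^sub>v u) $ s) r i j k"
    using stv(2-4) assms(1-3) by (subst det_mat_3) (simp_all add: S pick_3 M minor3_def R algebra_simps del: pick.simps)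
  finally show ?thesis .
qed

lemma triplesE:
  assumes "J \<in> triples n"
  obtains i j k where "J = {i, j, k}" "i < j" "j < k" "k < n"
proof -
  from assms have J: "J \<subseteq> {..<n}" "card J = 3" by (auto simp: triples_def)
  then obtain a b c where abc: "J = {a, b, c}" "a \<noteq> b" "b \<noteq> c" "a \<noteq> c"
    by (auto simp: card_3_iff)
  have "\<exists>i j k. {a, b, c} = {i, j, k} \<and> i < j \<and> j < k"
  proof -
    consider "a < b" "b < c" | "a < c" "c < b" | "b < a" "a < c" | "b < c" "c < a" | "c < a" "a < b" | "c < b" "b < a"
      using abc by linarith
    then show ?thesis
    proof cases
      case 1 then show ?thesis by blast
    next
      case 2 then show ?thesis by (intro exI[of _ a] exI[of _ c] exI[of _ b]) auto
    next
      case 3 then show ?thesis by (intro exI[of _ b] exI[of _ a] exI[of _ c]) auto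
    next
      case 4 then show ?thesis by (intro exI[of _ b] exI[of _ c] exI[of _ a]) auto
    next
      case 5 then show ?thesis by (intro exI[of _ c] exI[of _ a] exI[of _ b]) auto
    next
      case 6 then show ?thesis by (intro exI[of _ c] exI[of _ b] exI[of _ a]) auto
    qed
  qed
  then show ?thesis using that J abc by blast
qed

lemma triplesI: "i < j \<Longrightarrow> j < k \<Longrightarrow> k < n \<Longrightarrow> {i, j, k} \<in> triples n"
  by (auto simp: triples_def)

lemma dim_uvec [simp]: "dim_vec (uvec p q) = 4"
  by (simp add: uvec_def)

lemma uvec_least:
  assumes "p \<le> q" "q < 4"
  shows "(LEAST a. uvec p q $ a \<noteq> 0) = p"
proof (rule Least_equality)
  show "uvec p q $ p \<noteq> 0" using assms by (simp add: uvec_def)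
  fix y assume y: "uvec p q $ y \<noteq> 0"
  show "p \<le> y"
  proof (rule ccontr)
    assume "\<not> p \<le> y"
    then have "uvec p q $ y = 0" using assms by (simp add: uvec_def)
    with y show False by contradiction
  qed
qed

lemma cubic_eq_minor3:
  assumes "i < j" "j < k" "k < n" "p \<le> q" "q < 4"
  shows "cubic n (uvec p q) {i, j, k} = minor3 (\<lambda>l s. (P_mat l *\<^sub>v uvec p q) $ s) p i j k"
  unfolding cubic_def uvec_least[OF assms(4,5)] using assms by (intro minor_eq) auto

text \<open>Up to the sign belonging to the omitted row p, these are the values of one quadratic
  form in u: unit vectors give the coefficients of the squares, and each sum of two unit vectors
  adds a mixed coefficient.\<close>

lemma cubic_explicit:
  assumes "i < j" "j < k" "k < n"
  shows "cubic n (uvec 0 0) {i, j, k} = det_0 i j k"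
    "cubic n (uvec 1 1) {i, j, k} = - det_1 i j k"
    "cubic n (uvec 2 2) {i, j, k} = det_2 i j k"
    "cubic n (uvec 3 3) {i, j, k} = - det_3 i j k"
    "cubic n (uvec 0 1) {i, j, k} = det_0 i j k + det_1 i j k - det_01 i j k"
    "cubic n (uvec 0 2) {i, j, k} = det_0 i j k + det_2 i j k + det_02 i j k"
    "cubic n (uvec 0 3) {i, j, k} = det_0 i j k + det_3 i j k - det_03 i j k"
    "cubic n (uvec 1 2) {i, j, k} = det_12 i j k - det_1 i j k - det_2 i j k"
    "cubic n (uvec 1 3) {i, j, k} = - det_1 i j k - det_3 i j k - det_13 i j k"
    "cubic n (uvec 2 3) {i, j, k} = det_2 i j k + det_3 i j k - det_23 i j k"
  by (simp_all add: cubic_eq_minor3[OF assms] minor3_def other_rows_def P_mat_uvec P_mat_entries generator_defs algebra_simps)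

text \<open>Each P_l is skew-symmetric, so P_l u is orthogonal to u, and the vector of signed minors
  is a multiple of u. Its entries therefore agree up to sign where u has entry 1 and vanish where u
  has entry 0. The proof checks this case by case.\<close>

lemma minor_cases:
  assumes "u \<in> ten_vectors" "J \<in> triples n" "r < 4"
  shows "minor n u r J \<in> {0, cubic n u J, - cubic n u J}"
proof -
  from assms(2) obtain i j k where J: "J = {i, j, k}" "i < j" "j < k" "k < n" by (rule triplesE)
  from assms(1) obtain p q where u: "u = uvec p q" "(p, q) \<in> upairs" by (auto simp: ten_vectors_eq)
  have pq: "p \<le> q" "q < 4" using u(2) by (auto simp: upairs_iff)
  have "minor n u r J = 0 \<or> minor n u r J = cubic n u J \<or> minor n u r J = - cubic n u J"
    unfolding u(1) J(1) cubic_eq_minor3[OF J(2-4) pq] minor_eq[OF J(2-4) assms(3) dim_uvec]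
    using u(2) assms(3) unfolding upairs_def less_4_iff
    by (elim insertE emptyE disjE; simp add: minor3_def other_rows_def P_mat_uvec P_mat_entries algebra_simps)
  then show ?thesis by blast
qed

section \<open>The ideal of the concurrent lines variety\<close>

definition vanishing :: "nat \<Rightarrow> mpoly set" where
  "vanishing n = {f \<in> polys n. \<forall>z y. eval (param z y) f = 0}"

definition gens :: "nat \<Rightarrow> mpoly set" where
  "gens n = quadrics n \<union> cubics n"

definition gen_ideal :: "nat \<Rightarrow> mpoly set" where
  "gen_ideal n = genideal (poly_ring n) (gens n)"

lemma ideal_vanishing: "ideal (vanishing n) (poly_ring n)"
  by (rule ideal_poly_ringI) (auto simp: vanishing_def carrier_0 intro: carrier_add carrier_mult)

lemma cubics_cases:
  assumes "g \<in> cubics n"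
  obtains i j k p q where "i < j" "j < k" "k < n" "(p, q) \<in> upairs" "g = cubic n (uvec p q) {i, j, k}"
proof -
  from assms obtain u J where g: "u \<in> ten_vectors" "J \<in> triples n" "g = cubic n u J"
    by (auto simp: cubics_def)
  obtain i j k where J: "J = {i, j, k}" "i < j" "j < k" "k < n" using g(2) by (rule triplesE)
  obtain p q where "u = uvec p q" "(p, q) \<in> upairs" using g(1) by (auto simp: ten_vectors_eq)
  with that J g(3) show ?thesis by blast
qed

lemma cubicsI: "i < j \<Longrightarrow> j < k \<Longrightarrow> k < n \<Longrightarrow> p \<le> q \<Longrightarrow> q < 4 \<Longrightarrow> cubic n (uvec p q) {i, j, k} \<in> cubics n"
  unfolding cubics_def ten_vectors_eq using triplesI[of i j k n] by (force simp: upairs_iff)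

text \<open>One case analysis for three uses: membership in the ring, multihomogeneity, and
  vanishing at points where a line is zero.\<close>

lemma cubic_closed:
  assumes "i < j" "j < k" "k < n" "(p, q) \<in> upairs"
    and add: "\<And>f g. P f \<Longrightarrow> P g \<Longrightarrow> P (f + g)" and uminus: "\<And>f. P f \<Longrightarrow> P (- f)"
    and det: "\<And>p p' q q' r r'. p < p' \<Longrightarrow> p' < 4 \<Longrightarrow> q < q' \<Longrightarrow> q' < 4 \<Longrightarrow> r < r' \<Longrightarrow> r' < 4 \<Longrightarrow> P (det3 (p, p') (q, q') (r, r') i j k)"
  shows "P (cubic n (uvec p q) {i, j, k})"
proof -
  have diff: "P (f - g)" if "P f" "P g" for f g
    using add[OF that(1) uminus[OF that(2)]] by simp
  show ?thesis
    using assms(4) unfolding upairs_def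
    by (elim insertE emptyE Pair_inject; simp only: cubic_explicit[OF assms(1-3)] One_nat_def[symmetric] det_defs;
        intro add diff uminus det; simp)
qed

lemma carrier_det3:
  assumes "i < n" "j < n" "k < n" "p < p'" "p' < 4" "q < q'" "q' < 4" "r < r'" "r' < 4"
  shows "det3 (p, p') (q, q') (r, r') i j k \<in> polys n"
  unfolding det3_def Let_def
  by (intro carrier_add carrier_diff carrier_mult carrier_var) (use assms in \<open>auto simp: coords_def\<close>)

lemma carrier_quad: "i < n \<Longrightarrow> j < n \<Longrightarrow> quad i j \<in> polys n"
  unfolding quad_def by (intro carrier_add carrier_diff carrier_mult carrier_var) (auto simp: coords_def)

lemma quadrics_subset: "quadrics n \<subseteq> polys n"
proof -
  have "2 * quad i j \<in> polys n" if "i < n" "j < n" for i j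
    using carrier_add[OF carrier_quad carrier_quad, OF that that] by (simp only: mult_2)
  then show ?thesis unfolding quadrics_eq by (auto intro!: carrier_uminus)
qed

lemma cubics_subset: "cubics n \<subseteq> polys n"
proof
  fix g assume "g \<in> cubics n"
  then obtain i j k p q where ijk: "i < j" "j < k" "k < n" "(p, q) \<in> upairs" and g: "g = cubic n (uvec p q) {i, j, k}"
    by (rule cubics_cases)
  show "g \<in> polys n"
    unfolding g using ijk by (intro cubic_closed[OF ijk, of "\<lambda>f. f \<in> polys n"] carrier_add carrier_uminus carrier_det3) auto
qed

lemma gens_subset: "gens n \<subseteq> polys n"
  unfolding gens_def using quadrics_subset cubics_subset by blast

lemma eval_param_quad: "eval (param z y) (quad i j) = 0"
  by (simp add: quad_def algebra_simps)

lemma eval_param_det: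
  "eval (param z y) (det_0 i j k) = 0" "eval (param z y) (det_1 i j k) = 0" "eval (param z y) (det_2 i j k) = 0"
  "eval (param z y) (det_3 i j k) = 0" "eval (param z y) (det_01 i j k) = 0" "eval (param z y) (det_02 i j k) = 0"
  "eval (param z y) (det_03 i j k) = 0" "eval (param z y) (det_12 i j k) = 0" "eval (param z y) (det_13 i j k) = 0"
  "eval (param z y) (det_23 i j k) = 0"
  unfolding generator_defs by (simp_all add: algebra_simps)

lemma eval_param_cubic:
  assumes "i < j" "j < k" "k < n" "(p, q) \<in> upairs"
  shows "eval (param z y) (cubic n (uvec p q) {i, j, k}) = 0"
  using assms(4) unfolding upairs_def
  by (elim insertE emptyE Pair_inject; simp only: cubic_explicit[OF assms(1-3)] One_nat_def[symmetric] eval_add eval_diff eval_uminus eval_param_det)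
     simp_all

lemma gens_vanishing: "gens n \<subseteq> vanishing n"
proof
  fix g assume g: "g \<in> gens n"
  have "eval (param z y) g = 0" for z y
    using g unfolding gens_def
    by (auto simp: quadrics_eq eval_param_quad elim!: cubics_cases intro!: eval_param_cubic)
  with g gens_subset show "g \<in> vanishing n" unfolding vanishing_def by blast
qed

lemma ideal_gen_ideal: "ideal (gen_ideal n) (poly_ring n)"
  unfolding gen_ideal_def by (rule ideal_genideal[OF gens_subset])

lemma gens_gen_ideal: "gens n \<subseteq> gen_ideal n"
  unfolding gen_ideal_def by (rule genideal_incl[OF gens_subset])

lemma gen_ideal_vanishing: "gen_ideal n \<subseteq> vanishing n"
  unfolding gen_ideal_def by (rule genideal_least[OF ideal_vanishing gens_vanishing])

text \<open>Polarization: the ten coefficients of a quadratic form in u are recovered from its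
  values at the ten vectors.\<close>

lemma concurrent_gens_gen_ideal: "concurrent_gens n (gen_ideal n)"
proof (rule concurrent_gens.intro)
  show "ideal (gen_ideal n) (poly_ring n)" by (rule ideal_gen_ideal)
next
  fix i j assume "i \<le> j" "j < n"
  then have "- (2 * quad i j) \<in> gen_ideal n"
    using gens_gen_ideal unfolding gens_def quadrics_eq by blast
  then have "single 0 (- 1/2) * - (2 * quad i j) \<in> gen_ideal n"
    by (intro ideal_mult[OF ideal_gen_ideal] carrier_const)
  moreover have "single 0 (- 1/2) * - (2 * quad i j) = quad i j"
  proof -
    have "single 0 (- 1/2) * - (2 :: mpoly) = 1"
      using mult_single[of "0 :: monomial" "- 1/2 :: complex" 0 "- 2"] by (simp add: single_uminus)
    moreover have "single 0 (- 1/2) * - (2 * quad i j) = single 0 (- 1/2) * - 2 * quad i j"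
      by (simp only: mult.assoc mult_minus_left)
    ultimately show ?thesis by (simp only: mult_1_left)
  qed
  ultimately show "quad i j \<in> gen_ideal n" by simp
next
  fix i j k assume ijk: "i < j" "j < k" "k < n"
  note add = ideal_add[OF ideal_gen_ideal] and diff = ideal_diff[OF ideal_gen_ideal]
    and uminus = ideal_uminus[OF ideal_gen_ideal]
  let ?c = "\<lambda>p q. cubic n (uvec p q) {i, j, k}"
  have c: "?c p q \<in> gen_ideal n" if "p \<le> q" "q < 4" for p q
    using gens_gen_ideal cubicsI[OF ijk that] unfolding gens_def by blast
  note ce = cubic_explicit[OF ijk]
  have d0: "det_0 i j k \<in> gen_ideal n" using c[of 0 0] ce(1) by simp
  have d1: "det_1 i j k \<in> gen_ideal n" using uminus[OF c[of 1 1]] unfolding ce by simp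
  have d2: "det_2 i j k \<in> gen_ideal n" using c[of 2 2] ce(3) by simp
  have d3: "det_3 i j k \<in> gen_ideal n" using uminus[OF c[of 3 3]] unfolding ce by simp
  have d01: "det_01 i j k \<in> gen_ideal n"
    using diff[OF add[OF d0 d1] c[of 0 1]] unfolding ce by simp
  have d02: "det_02 i j k \<in> gen_ideal n"
    using diff[OF c[of 0 2] add[OF d0 d2]] unfolding ce by simp
  have d03: "det_03 i j k \<in> gen_ideal n"
    using diff[OF add[OF d0 d3] c[of 0 3]] unfolding ce by simp
  have d12: "det_12 i j k \<in> gen_ideal n"
    using add[OF c[of 1 2] add[OF d1 d2]] unfolding ce by simp
  have d13: "det_13 i j k \<in> gen_ideal n"
    using uminus[OF add[OF c[of 1 3] add[OF d1 d3]]] unfolding ce by simp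
  have d23: "det_23 i j k \<in> gen_ideal n"
    using diff[OF add[OF d2 d3] c[of 2 3]] unfolding ce by simp
  show "{det_0 i j k, det_1 i j k, det_2 i j k, det_3 i j k, det_01 i j k, det_02 i j k, det_03 i j k,
       det_12 i j k, det_13 i j k, det_23 i j k} \<subseteq> gen_ideal n"
    using d0 d1 d2 d3 d01 d02 d03 d12 d13 d23 by simp
qed

subsection \<open>Reduction to standard monomials\<close>

definition sqf :: "coord set \<Rightarrow> monomial" where
  "sqf B = (\<Sum>v\<in>B. single v 1)"

lemma lookup_sqf: "finite B \<Longrightarrow> lookup (sqf B) v = (if v \<in> B then 1 else 0)"
  by (simp add: sqf_def lookup_sum lookup_single when_def sum.delta)

lemma keys_sqf: "finite B \<Longrightarrow> keys (sqf B) = B"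
  by (auto simp: in_keys_iff lookup_sqf split: if_splits)

lemma sqf_dvd_iff: "finite B \<Longrightarrow> mon_dvd (sqf B) m \<longleftrightarrow> B \<subseteq> keys m"
  by (auto simp: mon_dvd_iff lookup_sqf in_keys_iff Suc_le_eq split: if_splits)

lemma mdeg_sqf: "finite B \<Longrightarrow> mdeg (sqf B) = card B"
  by (simp add: mdeg_def keys_sqf lookup_sqf)

lemma lmon_distinct: "distinct xs \<Longrightarrow> lmon xs = sqf (set xs)"
  by (simp add: lmon_def sqf_def sum_list_distinct_conv_sum_set)

lemma nonface_lead:
  assumes "B \<in> nonfaces n"
  shows "\<exists>h. single (sqf B) 1 + h \<in> gen_ideal n \<and> below n (sqf B) h"
proof -
  interpret concurrent_gens n "gen_ideal n" by (rule concurrent_gens_gen_ideal)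
  have "\<exists>xs. set xs = B \<and> distinct xs \<and> lead_in n (gen_ideal n) xs"
    using assms unfolding nonfaces_def
  proof (elim UnE)
    assume "B \<in> nonfaces2 n"
    then consider i where "i < n" "B = {p03 i, p12 i}"
      | i j where "i < j" "j < n" "B = {p23 i, p01 j}"
      unfolding nonfaces2_def by blast
    then show ?thesis
    proof cases
      case (1 i)
      with lead_cd[OF 1(1)] show ?thesis by (intro exI[of _ "[p12 i, p03 i]"]) auto
    next
      case (2 i j)
      with lead_fa[OF 2(1,2)] show ?thesis by (intro exI[of _ "[p01 j, p23 i]"]) auto
    qed
  next
    assume "B \<in> nonfaces3 n"
    then obtain i j k p p' q q' r r' where B: "B = {Coord i p p', Coord j q q', Coord k r r'}"
      and ijk: "i < j" "j < k" "k < n" and ty: "((p, p'), (q, q'), (r, r')) \<in> cubic_types"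
      unfolding nonfaces3_def by blast
    have "lead_in n (gen_ideal n) [Coord k r r', Coord j q q', Coord i p p']"
      using ty unfolding cubic_types_def Un_iff mem_Times_iff fst_conv snd_conv insert_iff empty_iff prod.inject
      by (elim disjE conjE FalseE; simp only:)
        (intro lead_fed[OF ijk] lead_fcb[OF ijk] lead_eca[OF ijk] lead_dba[OF ijk] lead_feb[OF ijk] lead_eba[OF ijk]
          lead_dca[OF ijk] lead_fcd[OF ijk] lead_dcb[OF ijk] lead_ecb[OF ijk] lead_dcd[OF ijk] lead_ecd[OF ijk])+
    then show ?thesis using B ijk by (intro exI[of _ "[Coord k r r', Coord j q q', Coord i p p']"]) auto
  next
    assume "B \<in> nonfaces4 n"
    then obtain i j k l p r where B: "B = {Coord i 1 p, p02 j, p13 k, Coord l r 2}"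
      and ijkl: "i < j" "j \<le> k" "k < l" "l < n" and ty: "p \<in> {2, 3}" "r \<in> {0, 1}"
      unfolding nonfaces4_def by blast
    have "lead_in n (gen_ideal n) [Coord l r 2, p13 k, p02 j, Coord i 1 p]"
      using ty
      by (elim insertE emptyE; simp only:)
        (intro lead_ebeb[OF ijkl] lead_ebed[OF ijkl] lead_dbeb[OF ijkl] lead_dbed[OF ijkl])+
    then show ?thesis using B ijkl
      by (intro exI[of _ "[Coord l r 2, p13 k, p02 j, Coord i 1 p]"]) auto
  qed
  then obtain xs h where "set xs = B" "distinct xs" "vm xs + h \<in> gen_ideal n" "below n (lmon xs) h"
    unfolding lead_in_def by blast
  then show ?thesis unfolding vm_single using lmon_distinct[of xs] by auto
qed

lemma keys_const_mult: "keys (single 0 c * f) \<subseteq> keys f" for f :: mpoly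
proof
  fix t assume "t \<in> keys (single 0 c * f)"
  then show "t \<in> keys f" by (rule keys_mult_mon) (auto split: if_splits)
qed

text \<open>Linear extension of a reduction rule for monomials; \<open>Q t s\<close> records which
  \<open>s\<close> may arise from \<open>t\<close>.\<close>

lemma reduce_poly:
  assumes I: "ideal I (poly_ring n)"
    and red: "\<And>t. t \<in> keys g \<Longrightarrow> \<exists>r. single t 1 - r \<in> I \<and> (\<forall>s\<in>keys r. Q t s)"
  shows "\<exists>r. g - r \<in> I \<and> (\<forall>s\<in>keys r. \<exists>t\<in>keys g. Q t s)"
proof -
  obtain R where R: "\<forall>t\<in>keys g. single t 1 - R t \<in> I \<and> (\<forall>s\<in>keys (R t). Q t s)"
    using bchoice[of "keys g" "\<lambda>t r. single t 1 - r \<in> I \<and> (\<forall>s\<in>keys r. Q t s)"] red by blast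
  let ?c = "\<lambda>t. single 0 (lookup g t) :: mpoly"
  define r where "r = (\<Sum>t\<in>keys g. ?c t * R t)"
  have "(\<Sum>t\<in>keys g. ?c t * single t 1) = (\<Sum>t\<in>keys g. single t (lookup g t))"
    by (simp add: mult_single)
  then have "(\<Sum>t\<in>keys g. ?c t * single t 1) = g" by (simp only: mpoly_expand)
  then have "g - r = (\<Sum>t\<in>keys g. ?c t * (single t 1 - R t))"
    unfolding r_def by (simp only: right_diff_distrib sum_subtractf)
  moreover have "(\<Sum>t\<in>keys g. ?c t * (single t 1 - R t)) \<in> I"
    using R by (intro ideal_sum[OF I] ideal_mult[OF I] carrier_const) blast
  moreover have "\<exists>t\<in>keys g. Q t s" if s: "s \<in> keys r" for s
  proof -
    have "lookup r s \<noteq> 0" using s by (simp add: in_keys_iff)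
    then obtain t where t: "t \<in> keys g" "lookup (?c t * R t) s \<noteq> 0"
      unfolding r_def lookup_sum by (meson sum.not_neutral_contains_not_neutral)
    then have "s \<in> keys (R t)" using keys_const_mult[of "lookup g t" "R t"] by (auto simp: in_keys_iff)
    with R t(1) show ?thesis by blast
  qed
  ultimately show ?thesis by (intro exI[of _ r]) auto
qed

text \<open>A nonstandard monomial contains a nonface, which is replaced by the lower terms of the
  corresponding ideal element; these are treated by induction along the order in the same
  degree.\<close>

lemma monomial_normal_form:
  assumes "keys m \<subseteq> coords n"
  shows "\<exists>r. single m 1 - r \<in> gen_ideal n \<and>
    (\<forall>s\<in>keys r. s \<in> standard n 3 \<and> mdeg s = mdeg m \<and> (s = m \<or> s \<prec> m))"
  using assms
proof (induction m rule: degrevlex_induct)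
  case (less m)
  note I = ideal_gen_ideal[of n]
  show ?case
  proof (cases "m \<in> standard n 3")
    case True
    then show ?thesis by (intro exI[of _ "single m 1"]) (simp add: ideal_0[OF I])
  next
    case False
    then obtain B where B: "B \<in> nonfaces n" "B \<subseteq> keys m"
      using nonface_cover[OF less.hyps] less.hyps unfolding standard_def by blast
    then have "finite B" by (meson finite_keys finite_subset)
    then obtain k where k: "m = sqf B + k" using sqf_dvd_iff[of B m] B(2) unfolding mon_dvd_def by blast
    obtain h where h: "single (sqf B) 1 + h \<in> gen_ideal n" "below n (sqf B) h"
      using nonface_lead[OF B(1)] by blast
    have kc: "keys k \<subseteq> coords n" using less.hyps unfolding k keys_add_mon by blast
    let ?k = "single k 1 :: mpoly"
    have t: "keys t \<subseteq> coords n \<and> mdeg t = mdeg m \<and> t \<prec> m" if "t \<in> keys (- (?k * h))" for t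
    proof -
      from that have "t \<in> keys (?k * h)" by (simp add: in_keys_iff)
      then obtain s where s: "s \<in> keys h" "t = k + s" by (rule keys_mult_mon) auto
      with h(2) kc show ?thesis
        unfolding k add.commute[of "sqf B" k] s(2) degrevlex_add mdeg_add keys_add_mon below_def carrier_iff
        by auto
    qed
    have "\<exists>r. - (?k * h) - r \<in> gen_ideal n \<and> (\<forall>s\<in>keys r. \<exists>t\<in>keys (- (?k * h)).
        s \<in> standard n 3 \<and> mdeg s = mdeg t \<and> (s = t \<or> s \<prec> t))"
      using less.IH t by (intro reduce_poly[OF I]) blast
    then obtain r where r: "- (?k * h) - r \<in> gen_ideal n" "\<forall>s\<in>keys r. \<exists>t\<in>keys (- (?k * h)).
        s \<in> standard n 3 \<and> mdeg s = mdeg t \<and> (s = t \<or> s \<prec> t)"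
      by blast
    have "?k * (single (sqf B) 1 + h) + (- (?k * h) - r) \<in> gen_ideal n"
      by (intro ideal_add[OF I] ideal_mult[OF I] h r carrier_single kc)
    moreover have "?k * (single (sqf B) 1 + h) + (- (?k * h) - r) = single m 1 - r"
      by (simp add: distrib_left mult_single k add.commute)
    moreover have "\<forall>s\<in>keys r. s \<in> standard n 3 \<and> mdeg s = mdeg m \<and> (s = m \<or> s \<prec> m)"
    proof
      fix s assume "s \<in> keys r"
      with r(2) obtain u where u: "u \<in> keys (- (?k * h))" "s \<in> standard n 3" "mdeg s = mdeg u" "s = u \<or> s \<prec> u"
        by blast
      with t[OF u(1)] degrevlex_trans[of s u m] show "s \<in> standard n 3 \<and> mdeg s = mdeg m \<and> (s = m \<or> s \<prec> m)"
        by auto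
    qed
    ultimately show ?thesis by (intro exI[of _ r]) auto
  qed
qed

lemma normal_form:
  assumes "f \<in> polys n"
  shows "\<exists>r. f - r \<in> gen_ideal n \<and>
    (\<forall>s\<in>keys r. \<exists>t\<in>keys f. s \<in> standard n 3 \<and> mdeg s = mdeg t \<and> (s = t \<or> s \<prec> t))"
  using assms by (intro reduce_poly[OF ideal_gen_ideal] monomial_normal_form) (auto simp: carrier_iff)

lemma vanishing_standard_0:
  assumes "f \<in> vanishing n" "keys f \<subseteq> standard n 3"
  shows "f = 0"
  using indep_standard[of 3 n] assms unfolding indep_def vanishing_def flag_pts_def by blast

lemma gen_ideal_eq: "gen_ideal n = vanishing n"
proof
  show "vanishing n \<subseteq> gen_ideal n"
  proof
    fix f assume f: "f \<in> vanishing n"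
    then obtain r where r: "f - r \<in> gen_ideal n" "keys r \<subseteq> standard n 3"
      using normal_form[of f n] unfolding vanishing_def by blast
    then have "f - (f - r) \<in> vanishing n"
      using gen_ideal_vanishing by (intro ideal_diff[OF ideal_vanishing f] subsetD[OF gen_ideal_vanishing])
    then have "r = 0" using vanishing_standard_0 r(2) by simp
    with r(1) show "f \<in> gen_ideal n" by simp
  qed
qed (rule gen_ideal_vanishing)

text \<open>Replacing all lower terms by their normal form keeps the leading term. If that were
  standard, a nonzero combination of standard monomials would lie in the kernel.\<close>

lemma lead_not_standard:
  assumes "f \<in> gen_ideal n" "f \<noteq> 0"
  shows "lead_mon f \<notin> standard n 3"
proof
  assume std: "lead_mon f \<in> standard n 3"
  let ?m = "lead_mon f"
  let ?f = "restr (- {?m}) f"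
  have fc: "f \<in> polys n" by (rule ideal_carrier[OF ideal_gen_ideal assms(1)])
  have f: "f = single ?m (lookup f ?m) + ?f"
    by (rule poly_mapping_eqI) (simp add: lookup_add lookup_restr lookup_single when_def)
  obtain r where r: "?f - r \<in> gen_ideal n"
    "\<forall>s\<in>keys r. \<exists>t\<in>keys ?f. s \<in> standard n 3 \<and> mdeg s = mdeg t \<and> (s = t \<or> s \<prec> t)"
    using normal_form[OF carrier_restr[OF fc]] by blast
  have less: "s \<prec> ?m" if s: "s \<in> keys r" for s
  proof -
    from r(2) s obtain t where t: "t \<in> keys ?f" "s = t \<or> s \<prec> t" by blast
    then have "t \<prec> ?m" using lead_mon_greatest[OF assms(2), of t] by auto
    with t(2) degrevlex_trans[of s t ?m] show ?thesis by auto
  qed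
  let ?g = "single ?m (lookup f ?m) + r"
  have "f - (?f - r) \<in> gen_ideal n" by (intro ideal_diff[OF ideal_gen_ideal] assms r)
  moreover have "f - (?f - r) = ?g" by (subst (1) f) simp
  ultimately have "?g \<in> vanishing n" using gen_ideal_vanishing by auto
  moreover have "keys ?g \<subseteq> standard n 3"
    using Poly_Mapping.keys_add[of "single ?m (lookup f ?m)" r] std r(2) by (auto split: if_splits)
  ultimately have "?g = 0" by (rule vanishing_standard_0)
  moreover have "lookup ?g ?m = lookup f ?m"
    using less[of ?m] degrevlex_irrefl[of ?m] by (auto simp: lookup_add in_keys_iff)
  ultimately show False using lead_mon_in_keys[OF assms(2)] by (simp add: in_keys_iff)
qed

lemma nonfaces_finite:
  assumes "B \<in> nonfaces n"
  shows "finite B" "B \<subseteq> coords n" "card B \<in> {2, 3, 4}"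
  using assms unfolding nonfaces_def nonfaces2_def nonfaces3_def nonfaces4_def cubic_types_def
  by (auto simp: coords_def card_insert_if)

text \<open>Yields the converse of \<open>nonface_cover\<close> without looking at the automaton:
  the monomial leads an element of the ideal.\<close>

lemma sqf_not_standard:
  assumes "B \<in> nonfaces n"
  shows "sqf B \<notin> standard n 3"
proof -
  obtain h where h: "single (sqf B) 1 + h \<in> gen_ideal n" "below n (sqf B) h"
    using nonface_lead[OF assms] by blast
  have less: "\<And>t. t \<in> keys h \<Longrightarrow> t \<prec> sqf B" using h(2) by (simp add: below_def)
  have "single (sqf B) 1 + h \<noteq> 0"
    using lead_mon_single_add(2)[OF less] by fastforce
  from lead_not_standard[OF h(1) this] show ?thesis by (simp add: lead_mon_single_add(1)[OF less])
qed

lemma nonstandard_iff: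
  assumes "keys m \<subseteq> coords n"
  shows "m \<notin> standard n 3 \<longleftrightarrow> (\<exists>B\<in>nonfaces n. B \<subseteq> keys m)"
proof
  assume "m \<notin> standard n 3"
  with assms show "\<exists>B\<in>nonfaces n. B \<subseteq> keys m" using nonface_cover unfolding standard_def by blast
next
  assume "\<exists>B\<in>nonfaces n. B \<subseteq> keys m"
  then obtain B where B: "B \<in> nonfaces n" "B \<subseteq> keys m" ..
  have "\<not> face n 3 B"
    using sqf_not_standard[OF B(1)] nonfaces_finite[OF B(1)] by (simp add: standard_def keys_sqf)
  then show "m \<notin> standard n 3" using face_subset[OF B(2)] by (auto simp: standard_def)
qed

subsection \<open>Comparison with the concurrent lines variety\<close>

text \<open>The parameter space is irreducible. The factor \<open>g\<close> may involve further
  lines, which is exploited in the comparison with the variety.\<close>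

lemma vanishing_prime:
  assumes "f \<in> polys n" "\<And>z y. eval (param z y) f * eval (param z y) g = 0"
    and "eval (param z y) g \<noteq> 0"
  shows "f \<in> vanishing n"
proof -
  have "eval a f = 0" if "a \<in> {param z y | z y. True}" for a
  proof (rule line_closed_irreducible[OF _ _ assms(3) _ that])
    show "line_closed {param z y | z y. True}" by (rule line_closed_param) simp
  qed (use assms(2) in auto)
  with assms(1) show ?thesis unfolding vanishing_def by blast
qed

lemma primeideal_vanishing: "primeideal (vanishing n) (poly_ring n)"
proof (rule primeideal.intro[OF ideal_vanishing cring_poly_ring], unfold_locales)
  have "1 \<notin> vanishing n" by (simp add: vanishing_def)
  then show "polys n \<noteq> vanishing n" using carrier_1 by auto
next
  fix f g assume f: "f \<in> polys n" and g: "g \<in> polys n"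
    and fg: "f \<otimes>\<^bsub>poly_ring n\<^esub> g \<in> vanishing n"
  show "f \<in> vanishing n \<or> g \<in> vanishing n"
  proof (cases "g \<in> vanishing n")
    case False
    with g obtain z y where "eval (param z y) g \<noteq> 0" unfolding vanishing_def by blast
    with f fg show ?thesis using vanishing_prime[of f n g z y] by (auto simp: vanishing_def)
  qed simp
qed

section \<open>Multihomogeneity of the generators\<close>

definition line_deg :: "nat \<Rightarrow> monomial \<Rightarrow> nat" where
  "line_deg l m = (\<Sum>v\<in>{v\<in>keys m. line v = l}. lookup m v)"

lemma line_deg_superset: "finite A \<Longrightarrow> keys m \<subseteq> A \<Longrightarrow> line_deg l m = (\<Sum>v\<in>{v\<in>A. line v = l}. lookup m v)"
  unfolding line_deg_def by (intro sum.mono_neutral_left) (auto simp: in_keys_iff)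

lemma line_deg_add: "line_deg l (m + k) = line_deg l m + line_deg l k"
  using line_deg_superset[of "keys m \<union> keys k" m] line_deg_superset[of "keys m \<union> keys k" k]
  by (simp add: line_deg_def[of _ "m + k"] keys_add_mon lookup_add sum.distrib)

lemma multihomogeneous_iff: "multihomogeneous d f \<longleftrightarrow> (\<forall>m\<in>keys f. \<forall>l. line_deg l m = d l)"
  by (simp add: multihomogeneous_def line_deg_def)

lemma multihomogeneous_add: "multihomogeneous d f \<Longrightarrow> multihomogeneous d g \<Longrightarrow> multihomogeneous d (f + g)"
  using Poly_Mapping.keys_add[of f g] by (auto simp: multihomogeneous_iff)

lemma multihomogeneous_uminus: "multihomogeneous d f \<Longrightarrow> multihomogeneous d (- f)"
  by (auto simp: multihomogeneous_iff in_keys_iff)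

lemma multihomogeneous_diff: "multihomogeneous d f \<Longrightarrow> multihomogeneous d g \<Longrightarrow> multihomogeneous d (f - g)"
  using multihomogeneous_add[of d f "- g"] multihomogeneous_uminus by simp

lemma multihomogeneous_mult:
  assumes "multihomogeneous d f" "multihomogeneous d' g"
  shows "multihomogeneous (\<lambda>l. d l + d' l) (f * g)"
  unfolding multihomogeneous_iff
proof
  fix m assume "m \<in> keys (f * g)"
  then obtain k k' where "k \<in> keys f" "k' \<in> keys g" "m = k + k'" by (rule keys_mult_mon)
  with assms show "\<forall>l. line_deg l m = d l + d' l" by (simp add: multihomogeneous_iff line_deg_add)
qed

lemma multihomogeneous_var: "multihomogeneous (\<lambda>l. of_bool (l = line v)) (var v)"
proof -
  have "{w. w = v \<and> line w = l} = (if l = line v then {v} else {})" for l by auto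
  then show ?thesis by (simp add: multihomogeneous_iff line_deg_def var_def)
qed

lemma multihomogeneous_var2: "(\<And>l. d l = of_bool (l = line v) + of_bool (l = line w)) \<Longrightarrow> multihomogeneous d (var v * var w)"
  using multihomogeneous_mult[OF multihomogeneous_var[of v] multihomogeneous_var[of w]] by presburger

lemma multihomogeneous_var3:
  assumes "multihomogeneous d' f" "\<And>l. d l = of_bool (l = line v) + d' l"
  shows "multihomogeneous d (var v * f)"
  using multihomogeneous_mult[OF multihomogeneous_var[of v] assms(1)] assms(2) by presburger

lemma multihomogeneous_quad: "multihomogeneous (\<lambda>l. of_bool (l = i) + of_bool (l = j)) (quad i j)"
  unfolding quad_def by (intro multihomogeneous_add multihomogeneous_diff multihomogeneous_var2) simp_all

lemma multihomogeneous_det3: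
  "multihomogeneous (\<lambda>l. of_bool (l = i) + of_bool (l = j) + of_bool (l = k)) (det3 (p, p') (q, q') (r, r') i j k)"
proof -
  let ?x = "\<lambda>l s. var (Coord l (fst s) (snd s))"
  have 2: "multihomogeneous (\<lambda>l. of_bool (l = a) + of_bool (l = b)) (?x a s * ?x b t - ?x b s * ?x a t)" for a b s t
    by (intro multihomogeneous_diff multihomogeneous_var2) simp_all
  show ?thesis
    unfolding det3_def Let_def by (intro multihomogeneous_add multihomogeneous_diff multihomogeneous_var3[OF 2]) simp_all
qed

lemma gens_multihomogeneous:
  assumes "g \<in> gens n"
  obtains d where "multihomogeneous d g"
proof -
  consider i j where "g = - (2 * quad i j)" | "g \<in> cubics n"
    using assms unfolding gens_def quadrics_eq by blast
  then show ?thesis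
  proof cases
    case (1 i j)
    show ?thesis
      by (rule that[of "\<lambda>l. of_bool (l = i) + of_bool (l = j)"])
        (unfold 1 mult_2, intro multihomogeneous_uminus multihomogeneous_add multihomogeneous_quad)
  next
    case 2
    then obtain i j k p q where ijk: "i < j" "j < k" "k < n" "(p, q) \<in> upairs" and g: "g = cubic n (uvec p q) {i, j, k}"
      by (rule cubics_cases)
    show ?thesis
      by (rule that[of "\<lambda>l. of_bool (l = i) + of_bool (l = j) + of_bool (l = k)"])
        (unfold g, intro cubic_closed[OF ijk, of "multihomogeneous _"] multihomogeneous_add multihomogeneous_uminus multihomogeneous_det3)
  qed
qed

lemma concurrent_lines_param:
  assumes "a \<in> concurrent_lines n"
  shows "\<exists>z y. \<forall>v\<in>coords n. a v = param z y v"
proof -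
  from assms obtain z where z: "proj_point z" and
    lines: "\<forall>l<n. \<exists>x y c. proj_point x \<and> proj_point y \<and> \<not> same_point x y \<and> on_line x y z \<and> c \<noteq> 0 \<and>
        (\<forall>i j. i < j \<and> j < 4 \<longrightarrow> a (Coord l i j) = c * pluecker x y i j)"
    unfolding concurrent_lines_def by blast
  have "\<exists>w. \<forall>i j. i < j \<and> j < 4 \<longrightarrow> a (Coord l i j) = z $ i * w j - z $ j * w i" if l: "l < n" for l
  proof -
    from lines l obtain x y c where xy: "proj_point x" "proj_point y" "on_line x y z"
      and a: "\<And>i j. i < j \<Longrightarrow> j < 4 \<Longrightarrow> a (Coord l i j) = c * pluecker x y i j"
      by blast
    from xy(3) obtain s t where st: "z = s \<cdot>\<^sub>v x + t \<cdot>\<^sub>v y" unfolding on_line_def by blast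
    have dims: "dim_vec x = 4" "dim_vec y = 4" using xy(1,2) by (auto simp: proj_point_def)
    have zi: "z $ i = s * x $ i + t * y $ i" if "i < 4" for i using that dims by (simp add: st)
    have "s \<noteq> 0 \<or> t \<noteq> 0"
    proof (rule ccontr)
      assume "\<not> ?thesis"
      then have "z = 0\<^sub>v 4" using dims by (intro eq_vecI) (auto simp: st)
      with z show False by (simp add: proj_point_def)
    qed
    then show ?thesis
    proof
      \<comment> \<open>For s nonzero, z \<and> y = s (x \<and> y); in the other case z \<and> x = -
        t (x \<and> y). The scalar c is absorbed into the second point.\<close>
      assume s: "s \<noteq> 0"
      show ?thesis
        using s by (intro exI[of _ "\<lambda>i. c / s * y $ i"]) (auto simp: a pluecker_def zi field_simps)
    next
      assume t: "t \<noteq> 0"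
      show ?thesis
        using t by (intro exI[of _ "\<lambda>i. - (c / t) * x $ i"]) (auto simp: a pluecker_def zi field_simps)
    qed
  qed
  then obtain y where "\<And>l i j. l < n \<Longrightarrow> i < j \<and> j < 4 \<Longrightarrow> a (Coord l i j) = z $ i * y l j - z $ j * y l i"
    by metis
  then have "\<forall>v\<in>coords n. a v = param (\<lambda>i. z $ i) y v" unfolding coords_def by auto
  then show ?thesis by blast
qed

text \<open>A nonzero p_01 makes z and y_l independent, so these parameters give honest
  lines.\<close>

lemma param_concurrent_lines:
  assumes "\<And>l. l < n \<Longrightarrow> param z y (p01 l) \<noteq> 0" "z 0 \<noteq> 0 \<or> z 1 \<noteq> 0"
  shows "param z y \<in> concurrent_lines n"
proof -
  have nz: "proj_point (vec 4 w)" if "w 0 \<noteq> 0 \<or> w 1 \<noteq> 0" for w :: "nat \<Rightarrow> complex"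
  proof -
    have "vec 4 w \<noteq> 0\<^sub>v 4"
    proof
      assume "vec 4 w = 0\<^sub>v 4"
      then have "vec 4 w $ 0 = 0" "vec 4 w $ 1 = 0" by simp_all
      with that show False by simp
    qed
    then show ?thesis by (simp add: proj_point_def)
  qed
  have "proj_point (vec 4 z) \<and> proj_point (vec 4 (y l)) \<and> \<not> same_point (vec 4 z) (vec 4 (y l)) \<and>
      on_line (vec 4 z) (vec 4 (y l)) (vec 4 z) \<and> (1 :: complex) \<noteq> 0 \<and>
      (\<forall>i j. i < j \<and> j < 4 \<longrightarrow> param z y (Coord l i j) = 1 * pluecker (vec 4 z) (vec 4 (y l)) i j)"
    if l: "l < n" for l
  proof (intro conjI)
    show "proj_point (vec 4 z)" using assms(2) by (rule nz)
    show "proj_point (vec 4 (y l))" using assms(1)[OF l] by (intro nz) auto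
    show "\<not> same_point (vec 4 z) (vec 4 (y l))"
    proof
      assume "same_point (vec 4 z) (vec 4 (y l))"
      then obtain c where c: "vec 4 (y l) = c \<cdot>\<^sub>v vec 4 z" by (auto simp: same_point_def)
      have "y l i = c * z i" if "i < 4" for i
        using arg_cong[OF c, of "\<lambda>v. v $ i"] that by simp
      with assms(1)[OF l] show False by simp
    qed
    show "on_line (vec 4 z) (vec 4 (y l)) (vec 4 z)"
      unfolding on_line_def by (intro exI[of _ 1] exI[of _ 0] eq_vecI) auto
  qed (auto simp: pluecker_def)
  then show ?thesis
    unfolding concurrent_lines_def using nz[OF assms(2)] by blast
qed

text \<open>Restricting to multihomogeneous polynomials loses nothing, because the kernel is
  generated by multihomogeneous ones, the quadrics and cubics.\<close>

lemma concurrent_ideal_eq: "concurrent_ideal n = vanishing n"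
proof
  let ?G = "{f \<in> polys n. (\<exists>d. multihomogeneous d f) \<and> (\<forall>a\<in>concurrent_lines n. eval a f = 0)}"
  have sub: "?G \<subseteq> polys n" by blast
  have "f \<in> vanishing n" if f: "f \<in> polys n" "\<forall>a\<in>concurrent_lines n. eval a f = 0" for f
  proof -
    \<comment> \<open>This product vanishes at the parameters not known to give points of the
      variety, and primeness cancels it. The extra line n guarantees z \<noteq> 0 even when n =
      0.\<close>
    let ?g = "(\<Prod>l<Suc n. var (p01 l))"
    have "eval (param z y) f * eval (param z y) ?g = 0" for z y
    proof (cases "\<forall>l<Suc n. param z y (p01 l) \<noteq> 0")
      case True
      then have "z 0 \<noteq> 0 \<or> z 1 \<noteq> 0" by (auto dest: spec[of _ n])
      with True have "param z y \<in> concurrent_lines n" by (intro param_concurrent_lines) auto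
      with f(2) show ?thesis by simp
    next
      case False
      then show ?thesis by (auto simp del: prod.lessThan_Suc param_Coord intro!: prod_zero)
    qed
    moreover have "eval (param (\<lambda>q. if q = 0 then 1 else 0) (\<lambda>l q. if q = 1 then 1 else 0)) ?g \<noteq> 0"
      by (simp del: prod.lessThan_Suc)
    ultimately show ?thesis by (rule vanishing_prime[OF f(1)])
  qed
  then have "?G \<subseteq> vanishing n" by blast
  then show "concurrent_ideal n \<subseteq> vanishing n"
    unfolding concurrent_ideal_def by (rule genideal_least[OF ideal_vanishing])
  have "gens n \<subseteq> ?G"
  proof
    fix g assume g: "g \<in> gens n"
    have "eval a g = 0" if a: "a \<in> concurrent_lines n" for a
    proof -
      obtain z y where zy: "\<forall>v\<in>coords n. a v = param z y v" using concurrent_lines_param[OF a] by blast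
      have "eval a g = eval (param z y) g"
        using subsetD[OF gens_subset g] zy unfolding carrier_iff by (intro eval_cong) blast
      also have "\<dots> = 0" using gens_vanishing g unfolding vanishing_def by blast
      finally show ?thesis .
    qed
    with g gens_subset[of n] gens_multihomogeneous[OF g, of "\<exists>d. multihomogeneous d g"] show "g \<in> ?G" by blast
  qed
  also have "?G \<subseteq> concurrent_ideal n"
    unfolding concurrent_ideal_def by (rule genideal_incl[OF sub])
  finally show "vanishing n \<subseteq> concurrent_ideal n"
    unfolding gen_ideal_eq[symmetric] gen_ideal_def[of n] concurrent_ideal_def
    by (intro genideal_least ideal_genideal[OF sub])
qed

section \<open>The initial ideal and the reduced Groebner basis\<close>

lemma finite_nonfaces: "finite (nonfaces n)"
  by (rule finite_subset[of _ "Pow (coords n)"]) (auto simp: finite_coords dest: nonfaces_finite(2))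

lemma nonfaces_card:
  "B \<in> nonfaces2 n \<Longrightarrow> card B = 2" "B \<in> nonfaces3 n \<Longrightarrow> card B = 3" "B \<in> nonfaces4 n \<Longrightarrow> card B = 4"
  unfolding nonfaces2_def nonfaces3_def nonfaces4_def by (auto simp: card_insert_if)

lemma cubic_types_parts:
  assumes "((p, p'), (q, q'), (r, r')) \<in> cubic_types"
  shows "p = 2 \<and> p' = 3 \<longrightarrow> \<not> (r = 0 \<and> r' = 1)" "\<not> (q = 2 \<and> q' = 3)" "\<not> (q = 0 \<and> q' = 1)"
    "\<not> (r = 2 \<and> r' = 3)" "\<not> (p = 0 \<and> p' = 1)" "p = 2 \<and> p' = 3 \<or> q = 0 \<and> q' = 3 \<or> r = 0 \<and> r' = 1"
  using assms unfolding cubic_types_def Un_iff mem_Times_iff fst_conv snd_conv insert_iff empty_iff prod.inject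
  by presburger+

text \<open>Only inclusions between different sizes matter. Quartic supports use b, d and e alone,
  whereas every smaller support contains a, c or f. A cubic support has one unknown per line, so no
  c_i d_i, and never contains both an f and an a.\<close>

lemma nonfaces_antichain:
  assumes "B \<in> nonfaces n" "B' \<in> nonfaces n" "B \<subseteq> B'"
  shows "B = B'"
proof (rule ccontr)
  assume ne: "B \<noteq> B'"
  have "card B < card B'"
    using assms nonfaces_finite(1)[OF assms(2)] ne by (intro psubset_card_mono) auto
  then consider "B \<in> nonfaces2 n" "B' \<in> nonfaces3 n" | "B \<in> nonfaces2 n" "B' \<in> nonfaces4 n"
    | "B \<in> nonfaces3 n" "B' \<in> nonfaces4 n"
    using assms(1,2) nonfaces_card unfolding nonfaces_def by fastforce
  then show False
  proof cases
    case 1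
    then obtain i j k p p' q q' r r' where B': "B' = {Coord i p p', Coord j q q', Coord k r r'}" "i < j" "j < k"
      "((p, p'), (q, q'), (r, r')) \<in> cubic_types"
      unfolding nonfaces3_def by blast
    from 1(1) assms(3) consider i where "p03 i \<in> B'" "p12 i \<in> B'"
      | i j where "p23 i \<in> B'" "p01 j \<in> B'"
      unfolding nonfaces2_def by blast
    then show False
    proof cases
      case 1
      then show False using B'(2,3) unfolding B'(1) by auto
    next
      case 2
      note ty = cubic_types_parts[OF B'(4)]
      have "2 = p \<and> 3 = p'" using 2(1) ty(2,4) unfolding B'(1) by auto
      moreover have "0 = r \<and> 1 = r'" using 2(2) ty(3,5) unfolding B'(1) by auto
      ultimately show False using ty(1) by simp
    qed
  next
    case 2
    then obtain i j k l p r where B': "B' = {Coord i 1 p, p02 j, p13 k, Coord l r 2}" "p \<in> {2, 3}" "r \<in> {0, 1}"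
      unfolding nonfaces4_def by blast
    from 2(1) assms(3) consider i where "p03 i \<in> B'" | j where "p01 j \<in> B'"
      unfolding nonfaces2_def by blast
    then show False using B'(2-3) unfolding B'(1) by cases auto
  next
    case 3
    then obtain i j k l p r where B': "B' = {Coord i 1 p, p02 j, p13 k, Coord l r 2}" "p \<in> {2, 3}" "r \<in> {0, 1}"
      unfolding nonfaces4_def by blast
    from 3(1) obtain i j k p p' q q' r r' where "B = {Coord i p p', Coord j q q', Coord k r r'}"
      "((p, p'), (q, q'), (r, r')) \<in> cubic_types"
      unfolding nonfaces3_def by blast
    then have "\<exists>i. p23 i \<in> B \<or> p03 i \<in> B \<or> p01 i \<in> B"
      using cubic_types_parts(6)[of p p' q q' r r'] by blast
    then obtain i where "p23 i \<in> B' \<or> p03 i \<in> B' \<or> p01 i \<in> B'" using assms(3) by blast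
    then show False using B'(2-3) unfolding B'(1) by auto
  qed
qed

lemma sqf_inject: "finite B \<Longrightarrow> finite B' \<Longrightarrow> sqf B = sqf B' \<Longrightarrow> B = B'"
  using keys_sqf by metis

section \<open>Leading monomials and Groebner bases of the ideal\<close>

lemma lead_keys:
  assumes "f \<in> gen_ideal n" "f \<noteq> 0"
  shows "keys (lead_mon f) \<subseteq> coords n" "\<exists>B\<in>nonfaces n. B \<subseteq> keys (lead_mon f)"
proof -
  show c: "keys (lead_mon f) \<subseteq> coords n"
    using ideal_carrier[OF ideal_gen_ideal assms(1)] lead_mon_in_keys[OF assms(2)] by (simp add: carrier_iff)
  show "\<exists>B\<in>nonfaces n. B \<subseteq> keys (lead_mon f)"
    using lead_not_standard[OF assms] nonstandard_iff[OF c] by blast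
qed

definition nonstandard_ideal :: "nat \<Rightarrow> mpoly set" where
  "nonstandard_ideal n = {f \<in> polys n. \<forall>m\<in>keys f. m \<notin> standard n 3}"

lemma genideal_lead:
  assumes "G \<subseteq> gen_ideal n" "0 \<notin> G"
  shows "genideal (poly_ring n) {single (lead_mon g) 1 | g. g \<in> G} =
    {f \<in> polys n. \<forall>m\<in>keys f. \<exists>g\<in>G. mon_dvd (lead_mon g) m}"
proof -
  have eq: "{single (lead_mon g) 1 | g. g \<in> G} = (\<lambda>l. single l 1) ` lead_mon ` G"
    by blast
  have "keys l \<subseteq> coords n" if "l \<in> lead_mon ` G" for l
    using that assms lead_keys(1) by blast
  then show ?thesis
    unfolding eq by (subst genideal_monomials) simp_all
qed

lemma nonstandard_of_dvd:
  assumes "f \<in> gen_ideal n" "f \<noteq> 0" "mon_dvd (lead_mon f) m"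
  shows "m \<notin> standard n 3"
proof -
  have "keys (lead_mon f) \<subseteq> keys m" using assms(3) by (auto simp: mon_dvd_def keys_add_mon)
  then show ?thesis
    using lead_not_standard[OF assms(1,2)] lead_keys(1)[OF assms(1,2)] face_subset unfolding standard_def by blast
qed

lemma lead_dvd_iff:
  assumes "G \<subseteq> gen_ideal n" "0 \<notin> G" "\<forall>B\<in>nonfaces n. \<exists>g\<in>G. mon_dvd (lead_mon g) (sqf B)" "keys m \<subseteq> coords n"
  shows "(\<exists>g\<in>G. mon_dvd (lead_mon g) m) \<longleftrightarrow> m \<notin> standard n 3"
proof
  assume "\<exists>g\<in>G. mon_dvd (lead_mon g) m"
  then show "m \<notin> standard n 3" using nonstandard_of_dvd assms(1,2) by blast
next
  assume "m \<notin> standard n 3"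
  then obtain B where B: "B \<in> nonfaces n" "B \<subseteq> keys m" using nonstandard_iff[OF assms(4)] by blast
  then have "mon_dvd (sqf B) m" by (simp add: sqf_dvd_iff nonfaces_finite(1))
  with assms(3) B(1) show "\<exists>g\<in>G. mon_dvd (lead_mon g) m" using mon_dvd_trans by blast
qed

text \<open>The nonface monomial minus its normal form has all these properties.\<close>

definition gb_elem :: "nat \<Rightarrow> coord set \<Rightarrow> mpoly" where
  "gb_elem n B = (SOME g. g \<in> gen_ideal n \<and> lookup g (sqf B) = 1 \<and> lead_mon g = sqf B \<and>
     homogeneous (card B) g \<and> keys g \<subseteq> insert (sqf B) (standard n 3))"

lemma gb_elem:
  assumes "B \<in> nonfaces n"
  shows "gb_elem n B \<in> gen_ideal n" "lookup (gb_elem n B) (sqf B) = 1" "lead_mon (gb_elem n B) = sqf B"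
    "homogeneous (card B) (gb_elem n B)" "keys (gb_elem n B) \<subseteq> insert (sqf B) (standard n 3)"
proof -
  note fin = nonfaces_finite(1,2)[OF assms]
  have "\<exists>g. g \<in> gen_ideal n \<and> lookup g (sqf B) = 1 \<and> lead_mon g = sqf B \<and>
     homogeneous (card B) g \<and> keys g \<subseteq> insert (sqf B) (standard n 3)"
  proof -
    obtain r where r: "single (sqf B) 1 - r \<in> gen_ideal n"
      "\<forall>s\<in>keys r. s \<in> standard n 3 \<and> mdeg s = mdeg (sqf B) \<and> (s = sqf B \<or> s \<prec> sqf B)"
      using monomial_normal_form[of "sqf B" n] fin by (auto simp: keys_sqf)
    have less: "s \<prec> sqf B" if "s \<in> keys (- r)" for s
    proof -
      have "s \<in> keys r" using that by (simp add: in_keys_iff)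
      with r(2) sqf_not_standard[OF assms] show ?thesis by auto
    qed
    let ?g = "single (sqf B) 1 + - r"
    have l: "lead_mon ?g = sqf B" "lookup ?g (sqf B) = 1" "keys ?g = insert (sqf B) (keys (- r))"
      by (rule lead_mon_single_add, erule less)+
    have "mdeg m = card B" if "m \<in> insert (sqf B) (keys (- r))" for m
      using that r(2) by (auto simp: mdeg_sqf[OF fin(1)] in_keys_iff)
    then have "homogeneous (card B) ?g"
      unfolding homogeneous_iff l(3) by blast
    moreover have "keys ?g \<subseteq> insert (sqf B) (standard n 3)"
      unfolding l(3) using r(2) by (auto simp: in_keys_iff)
    moreover have "?g \<in> gen_ideal n" using r(1) by simp
    ultimately show ?thesis using l(1,2) by blast
  qed
  from someI_ex[OF this] show "gb_elem n B \<in> gen_ideal n" "lookup (gb_elem n B) (sqf B) = 1" "lead_mon (gb_elem n B) = sqf B"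
    "homogeneous (card B) (gb_elem n B)" "keys (gb_elem n B) \<subseteq> insert (sqf B) (standard n 3)"
    unfolding gb_elem_def[symmetric] by blast+
qed

lemma gb_elem_nonzero: "B \<in> nonfaces n \<Longrightarrow> gb_elem n B \<noteq> 0"
  using gb_elem(2) by fastforce

lemma initial_ideal_eq: "initial_ideal n (gen_ideal n) = nonstandard_ideal n"
proof -
  have "initial_ideal n (gen_ideal n) =
      genideal (poly_ring n) {single (lead_mon g) 1 | g. g \<in> gen_ideal n - {0}}"
    unfolding initial_ideal_def by simp
  also have "\<dots> = {f \<in> polys n. \<forall>m\<in>keys f. \<exists>g\<in>gen_ideal n - {0}. mon_dvd (lead_mon g) m}"
    by (rule genideal_lead) auto
  also have "\<dots> = nonstandard_ideal n"
  proof -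
    have "\<forall>B\<in>nonfaces n. \<exists>g\<in>gen_ideal n - {0}. mon_dvd (lead_mon g) (sqf B)"
    proof
      fix B assume B: "B \<in> nonfaces n"
      show "\<exists>g\<in>gen_ideal n - {0}. mon_dvd (lead_mon g) (sqf B)"
        by (rule bexI[of _ "gb_elem n B"]) (simp_all add: gb_elem[OF B] gb_elem_nonzero[OF B] mon_dvd_refl)
    qed
    from lead_dvd_iff[OF _ _ this]
    have "keys m \<subseteq> coords n \<Longrightarrow> (\<exists>g\<in>gen_ideal n - {0}. mon_dvd (lead_mon g) m) \<longleftrightarrow> m \<notin> standard n 3" for m
      by blast
    then show ?thesis unfolding nonstandard_ideal_def carrier_iff by blast
  qed
  finally show ?thesis .
qed

text \<open>Both ideals are monomial, and the initial ideal consists of the combinations of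
  nonstandard monomials, that is, of multiples of the \<open>sqf B\<close>.\<close>

lemma groebner_basis_iff:
  "groebner_basis n (gen_ideal n) G \<longleftrightarrow> finite G \<and> G \<subseteq> gen_ideal n \<and> 0 \<notin> G \<and>
     (\<forall>B\<in>nonfaces n. \<exists>g\<in>G. mon_dvd (lead_mon g) (sqf B))"
proof (cases "G \<subseteq> gen_ideal n \<and> 0 \<notin> G")
  case True
  let ?M = "{f \<in> polys n. \<forall>m\<in>keys f. \<exists>g\<in>G. mon_dvd (lead_mon g) m}"
  have "?M = nonstandard_ideal n \<longleftrightarrow> (\<forall>B\<in>nonfaces n. \<exists>g\<in>G. mon_dvd (lead_mon g) (sqf B))"
  proof
    assume eq: "?M = nonstandard_ideal n"
    show "\<forall>B\<in>nonfaces n. \<exists>g\<in>G. mon_dvd (lead_mon g) (sqf B)"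
    proof
      fix B assume B: "B \<in> nonfaces n"
      then have "single (sqf B) 1 \<in> nonstandard_ideal n"
        using nonfaces_finite[OF B] sqf_not_standard[OF B]
        by (auto simp: nonstandard_ideal_def keys_sqf intro!: carrier_single)
      then show "\<exists>g\<in>G. mon_dvd (lead_mon g) (sqf B)" unfolding eq[symmetric] by simp
    qed
  next
    assume cov: "\<forall>B\<in>nonfaces n. \<exists>g\<in>G. mon_dvd (lead_mon g) (sqf B)"
    have "keys m \<subseteq> coords n \<Longrightarrow> (\<exists>g\<in>G. mon_dvd (lead_mon g) m) \<longleftrightarrow> m \<notin> standard n 3" for m
      using lead_dvd_iff[OF _ _ cov] True by blast
    then show "?M = nonstandard_ideal n" unfolding nonstandard_ideal_def carrier_iff by blast
  qed
  with True show ?thesis unfolding groebner_basis_def initial_ideal_eq by (simp add: genideal_lead)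
qed (auto simp: groebner_basis_def)

lemma reduced_groebner_basis_gb_elem: "reduced_groebner_basis n (gen_ideal n) (gb_elem n ` nonfaces n)"
  unfolding reduced_groebner_basis_def
proof (intro conjI ballI)
  show "groebner_basis n (gen_ideal n) (gb_elem n ` nonfaces n)"
    unfolding groebner_basis_iff
    by (auto simp: finite_nonfaces gb_elem gb_elem_nonzero[symmetric] intro!: mon_dvd_refl)
next
  fix g assume "g \<in> gb_elem n ` nonfaces n"
  then obtain B where B: "B \<in> nonfaces n" "g = gb_elem n B" by blast
  show "lookup g (lead_mon g) = 1" using gb_elem(2,3)[OF B(1)] B(2) by simp
  fix h m assume h: "h \<in> gb_elem n ` nonfaces n - {g}" and m: "m \<in> keys g"
  then obtain B' where B': "B' \<in> nonfaces n" "h = gb_elem n B'" "B' \<noteq> B" using B(2) by blast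
  show "\<not> mon_dvd (lead_mon h) m"
  proof
    assume "mon_dvd (lead_mon h) m"
    then have dvd: "B' \<subseteq> keys m"
      unfolding B'(2) gb_elem(3)[OF B'(1)] sqf_dvd_iff[OF nonfaces_finite(1)[OF B'(1)]] .
    have "m \<noteq> sqf B"
      using dvd nonfaces_antichain[OF B'(1) B(1)] B'(3) by (auto simp: keys_sqf nonfaces_finite(1)[OF B(1)])
    then have std: "m \<in> standard n 3" using m B gb_elem(5)[OF B(1)] by auto
    then have "keys m \<subseteq> coords n" by (simp add: standard_def)
    with std dvd B'(1) show False using nonstandard_iff by blast
  qed
qed

lemma mon_dvd_antisym: "mon_dvd a b \<Longrightarrow> mon_dvd b a \<Longrightarrow> a = b"
  by (intro poly_mapping_eqI) (meson mon_dvd_iff order_antisym)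

text \<open>By the antichain property the leading monomials must be the nonfaces themselves. An
  element of \<open>G\<close> and the \<open>gb_elem\<close> with the same lead then differ by a
  standard combination in the kernel, which is 0.\<close>

lemma reduced_groebner_basis_unique:
  assumes "reduced_groebner_basis n (gen_ideal n) G"
  shows "G = gb_elem n ` nonfaces n"
proof -
  have G: "G \<subseteq> gen_ideal n" "0 \<notin> G" and cov: "\<And>B. B \<in> nonfaces n \<Longrightarrow> \<exists>g\<in>G. mon_dvd (lead_mon g) (sqf B)"
    and monic: "\<And>g. g \<in> G \<Longrightarrow> lookup g (lead_mon g) = 1"
    and red: "\<And>g h m. g \<in> G \<Longrightarrow> h \<in> G \<Longrightarrow> m \<in> keys g \<Longrightarrow> mon_dvd (lead_mon h) m \<Longrightarrow> h = g"
    using assms unfolding reduced_groebner_basis_def groebner_basis_iff by blast+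
  have lead: "\<exists>g\<in>G. lead_mon g = sqf B" if B: "B \<in> nonfaces n" for B
  proof -
    obtain g where g: "g \<in> G" "mon_dvd (lead_mon g) (sqf B)" using cov[OF B] by blast
    then have g0: "g \<in> gen_ideal n" "g \<noteq> 0" using G by auto
    obtain B' where B': "B' \<in> nonfaces n" "B' \<subseteq> keys (lead_mon g)" using lead_keys(2)[OF g0] by blast
    obtain k where "sqf B = lead_mon g + k" using g(2) unfolding mon_dvd_def by blast
    then have "B = keys (lead_mon g) \<union> keys k"
      using keys_sqf[OF nonfaces_finite(1)[OF B]] by (simp add: keys_add_mon)
    then have "keys (lead_mon g) \<subseteq> B" by blast
    then have "B' = B" using nonfaces_antichain[OF B'(1) B] B'(2) by blast
    then have "mon_dvd (sqf B) (lead_mon g)" using B' by (simp add: sqf_dvd_iff nonfaces_finite(1))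
    with g show ?thesis using mon_dvd_antisym by blast
  qed
  have elem: "\<exists>B\<in>nonfaces n. g = gb_elem n B \<and> lead_mon g = sqf B" if g: "g \<in> G" for g
  proof -
    have g0: "g \<in> gen_ideal n" "g \<noteq> 0" using g G by auto
    obtain B where B: "B \<in> nonfaces n" "B \<subseteq> keys (lead_mon g)" using lead_keys(2)[OF g0] by blast
    obtain h where h: "h \<in> G" "lead_mon h = sqf B" using lead[OF B(1)] by blast
    have "mon_dvd (lead_mon h) (lead_mon g)" using B h(2) by (simp add: sqf_dvd_iff nonfaces_finite(1))
    then have "h = g" by (rule red[OF g h(1) lead_mon_in_keys[OF g0(2)]])
    with h(2) have lg: "lead_mon g = sqf B" by simp
    have std: "m \<in> standard n 3" if m: "m \<in> keys g" "m \<noteq> lead_mon g" for m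
    proof (rule ccontr)
      assume ns: "m \<notin> standard n 3"
      have "keys m \<subseteq> coords n" using ideal_carrier[OF ideal_gen_ideal g0(1)] m(1) by (simp add: carrier_iff)
      then obtain B' where B': "B' \<in> nonfaces n" "B' \<subseteq> keys m" using nonstandard_iff ns by blast
      obtain h' where h': "h' \<in> G" "lead_mon h' = sqf B'" using lead[OF B'(1)] by blast
      have dvd: "mon_dvd (lead_mon h') m" using B' h'(2) by (simp add: sqf_dvd_iff nonfaces_finite(1))
      then have "h' = g" by (rule red[OF g h'(1) m(1)])
      with dvd have "lead_mon g \<prec> m" using degrevlex_dvd m(2) by blast
      then show False using lead_mon_greatest[OF g0(2) m] degrevlex_asym by blast
    qed
    let ?d = "g - gb_elem n B"
    have "?d \<in> vanishing n"
      using ideal_diff[OF ideal_gen_ideal g0(1) gb_elem(1)[OF B(1)]] unfolding gen_ideal_eq .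
    moreover have "keys ?d \<subseteq> standard n 3"
    proof
      fix m assume m: "m \<in> keys ?d"
      have "lookup ?d (sqf B) = 0" using monic[OF g] gb_elem(2)[OF B(1)] lg by (simp add: lookup_minus)
      with m have "m \<noteq> sqf B" by (auto simp: in_keys_iff)
      moreover have "m \<in> keys g \<or> m \<in> keys (gb_elem n B)" using m by (auto simp: in_keys_iff lookup_minus)
      ultimately show "m \<in> standard n 3" using std lg gb_elem(5)[OF B(1)] by auto
    qed
    ultimately have "?d = 0" by (rule vanishing_standard_0)
    with B(1) lg show ?thesis by auto
  qed
  show ?thesis
  proof
    show "G \<subseteq> gb_elem n ` nonfaces n" using elem by blast
    show "gb_elem n ` nonfaces n \<subseteq> G"
    proof
      fix x assume "x \<in> gb_elem n ` nonfaces n"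
      then obtain B where B: "B \<in> nonfaces n" "x = gb_elem n B" by blast
      obtain g where g: "g \<in> G" "lead_mon g = sqf B" using lead[OF B(1)] by blast
      obtain B' where B': "B' \<in> nonfaces n" "g = gb_elem n B'" "lead_mon g = sqf B'" using elem[OF g(1)] by blast
      have "B' = B" using g(2) B'(3) sqf_inject nonfaces_finite(1) B(1) B'(1) by metis
      with g(1) B' B(2) show "x \<in> G" by simp
    qed
  qed
qed

lemma inj_gb_elem: "inj_on (gb_elem n) (nonfaces n)"
proof (rule inj_onI)
  fix B B' assume "B \<in> nonfaces n" "B' \<in> nonfaces n" "gb_elem n B = gb_elem n B'"
  then show "B = B'" using gb_elem(3)[of B n] gb_elem(3)[of B' n] sqf_inject nonfaces_finite(1) by metis
qed

lemma card_homogeneous_gb_elem: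
  "card {g \<in> gb_elem n ` nonfaces n. homogeneous d g} = card {B \<in> nonfaces n. card B = d}"
proof -
  have "homogeneous d (gb_elem n B) \<longleftrightarrow> card B = d" if B: "B \<in> nonfaces n" for B
  proof
    assume "homogeneous d (gb_elem n B)"
    moreover have "sqf B \<in> keys (gb_elem n B)" using gb_elem(2)[OF B] by (simp add: in_keys_iff)
    ultimately show "card B = d" using mdeg_sqf[OF nonfaces_finite(1)[OF B]] by (simp add: homogeneous_iff)
  qed (use gb_elem(4)[OF B] in auto)
  then have "{g \<in> gb_elem n ` nonfaces n. homogeneous d g} = gb_elem n ` {B \<in> nonfaces n. card B = d}"
    by auto
  moreover have "inj_on (gb_elem n) {B \<in> nonfaces n. card B = d}"
    by (rule inj_on_subset[OF inj_gb_elem]) auto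
  ultimately show ?thesis by (simp add: card_image)
qed

lemma nonfaces_of_card:
  "{B \<in> nonfaces n. card B = 2} = nonfaces2 n" "{B \<in> nonfaces n. card B = 3} = nonfaces3 n"
  "{B \<in> nonfaces n. card B = 4} = nonfaces4 n"
proof -
  have "\<And>B. B \<in> nonfaces n \<longleftrightarrow> B \<in> nonfaces2 n \<or> B \<in> nonfaces3 n \<or> B \<in> nonfaces4 n"
    by (auto simp: nonfaces_def)
  then show "{B \<in> nonfaces n. card B = 2} = nonfaces2 n" "{B \<in> nonfaces n. card B = 3} = nonfaces3 n"
    "{B \<in> nonfaces n. card B = 4} = nonfaces4 n"
    using nonfaces_card[of _ n] by force+
qed

subsection \<open>Counting\<close>

definition pairs_lt :: "nat \<Rightarrow> (nat \<times> nat) set" where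
  "pairs_lt n = {(i, j). i < j \<and> j < n}"

definition triples_lt :: "nat \<Rightarrow> (nat \<times> nat \<times> nat) set" where
  "triples_lt n = {(i, j, k). i < j \<and> j < k \<and> k < n}"

definition triples_le :: "nat \<Rightarrow> (nat \<times> nat \<times> nat) set" where
  "triples_le n = {(i, j, k). i < j \<and> j \<le> k \<and> k < n}"

definition quadruples_le :: "nat \<Rightarrow> (nat \<times> nat \<times> nat \<times> nat) set" where
  "quadruples_le n = {(i, j, k, l). i < j \<and> j \<le> k \<and> k < l \<and> l < n}"

text \<open>Pascal's rule for sets: the tuples below n + 1 split by whether the last entry equals
  n.\<close>

lemma card_extend:
  assumes "finite A" "finite B" "C = A \<union> f ` B" "A \<inter> f ` B = {}" "inj_on f B"
  shows "finite C" "card C = card A + card B"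
  using assms by (simp_all add: card_Un_disjoint card_image)

lemma card_pairs_lt: "finite (pairs_lt n) \<and> card (pairs_lt n) = n choose 2"
proof (induction n)
  case (Suc n)
  have "pairs_lt (Suc n) = pairs_lt n \<union> (\<lambda>i. (i, n)) ` {..<n}" by (auto simp: pairs_lt_def less_Suc_eq)
  moreover have "pairs_lt n \<inter> (\<lambda>i. (i, n)) ` {..<n} = {}" by (auto simp: pairs_lt_def)
  ultimately show ?case using card_extend[of "pairs_lt n" "{..<n}" "pairs_lt (Suc n)" "\<lambda>i. (i, n)"] Suc
    by (simp add: inj_on_def numeral_2_eq_2)
next
  case 0
  have "pairs_lt 0 = {}" by (auto simp: pairs_lt_def)
  then show ?case by (simp add: binomial_eq_0)
qed

lemma card_triples_lt: "finite (triples_lt n) \<and> card (triples_lt n) = n choose 3"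
proof (induction n)
  case (Suc n)
  have "triples_lt (Suc n) = triples_lt n \<union> (\<lambda>(i, j). (i, j, n)) ` pairs_lt n"
    by (auto simp: pairs_lt_def triples_lt_def less_Suc_eq)
  moreover have "triples_lt n \<inter> (\<lambda>(i, j). (i, j, n)) ` pairs_lt n = {}" by (auto simp: triples_lt_def)
  moreover have "inj_on (\<lambda>(i, j). (i, j, n)) (pairs_lt n)" by (auto simp: inj_on_def)
  ultimately show ?case
    using card_extend[of "triples_lt n" "pairs_lt n" "triples_lt (Suc n)" "\<lambda>(i, j). (i, j, n)"] Suc card_pairs_lt[of n]
    by (simp add: numeral_2_eq_2 numeral_3_eq_3)
next
  case 0
  have "triples_lt 0 = {}" by (auto simp: triples_lt_def)
  then show ?case by (simp add: binomial_eq_0)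
qed

text \<open>Raising k by one turns j \<le> k into a strict inequality and n into n + 1; in the
  quadruples below, k and l are raised. This explains the binomials in n + 1.\<close>

lemma card_triples_le: "finite (triples_le n) \<and> card (triples_le n) = (n + 1) choose 3"
proof (induction n)
  case (Suc n)
  have "triples_le (Suc n) = triples_le n \<union> (\<lambda>(i, j). (i, j, n)) ` pairs_lt (Suc n)"
    by (auto simp: pairs_lt_def triples_le_def less_Suc_eq)
  moreover have "triples_le n \<inter> (\<lambda>(i, j). (i, j, n)) ` pairs_lt (Suc n) = {}" by (auto simp: triples_le_def)
  moreover have "inj_on (\<lambda>(i, j). (i, j, n)) (pairs_lt (Suc n))" by (auto simp: inj_on_def)
  ultimately show ?case
    using card_extend[of "triples_le n" "pairs_lt (Suc n)" "triples_le (Suc n)" "\<lambda>(i, j). (i, j, n)"] Suc card_pairs_lt[of "Suc n"]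
    by (simp add: numeral_2_eq_2 numeral_3_eq_3)
next
  case 0
  have "triples_le 0 = {}" by (auto simp: triples_le_def)
  then show ?case by (simp add: binomial_eq_0)
qed

lemma card_quadruples_le: "finite (quadruples_le n) \<and> card (quadruples_le n) = (n + 1) choose 4"
proof (induction n)
  case (Suc n)
  have "quadruples_le (Suc n) = quadruples_le n \<union> (\<lambda>(i, j, k). (i, j, k, n)) ` triples_le n"
    by (auto simp: triples_le_def quadruples_le_def less_Suc_eq image_iff)
  moreover have "quadruples_le n \<inter> (\<lambda>(i, j, k). (i, j, k, n)) ` triples_le n = {}" by (auto simp: quadruples_le_def)
  moreover have "inj_on (\<lambda>(i, j, k). (i, j, k, n)) (triples_le n)" by (auto simp: inj_on_def)
  ultimately show ?case
    using card_extend[of "quadruples_le n" "triples_le n" "quadruples_le (Suc n)" "\<lambda>(i, j, k). (i, j, k, n)"] Suc card_triples_le[of n]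
    by (simp add: eval_nat_numeral)
next
  case 0
  have "quadruples_le 0 = {}" by (auto simp: quadruples_le_def)
  then show ?case by (simp add: binomial_eq_0)
qed

lemma card_nonfaces2: "card (nonfaces2 n) = (n + 1) choose 2"
proof -
  let ?f = "\<lambda>i. {p03 i, p12 i}" and ?g = "\<lambda>(i, j). {p23 i, p01 j}"
  have "nonfaces2 n = ?g ` pairs_lt n \<union> ?f ` {..<n}"
    by (auto simp: nonfaces2_def pairs_lt_def image_iff)
  moreover have "inj_on ?g (pairs_lt n)"
    by (rule inj_onI, clarify) (simp add: doubleton_eq_iff)
  moreover have "inj_on ?f {..<n}"
    by (rule inj_onI) (simp add: doubleton_eq_iff)
  moreover have "?g ` pairs_lt n \<inter> ?f ` {..<n} = {}"
  proof (rule equals0I)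
    fix B assume "B \<in> ?g ` pairs_lt n \<inter> ?f ` {..<n}"
    then obtain x i where "B = ?g x" "B = ?f i" by (elim IntE imageE)
    then show False by (cases x) (simp add: doubleton_eq_iff)
  qed
  ultimately show ?thesis
    using card_pairs_lt[of n] by (simp add: card_Un_disjoint card_image numeral_2_eq_2)
qed

lemma finite_cubic_types: "finite cubic_types"
  unfolding cubic_types_def by blast

lemma card_cubic_types: "card cubic_types = 12"
  by code_simp

lemma card_nonfaces3: "card (nonfaces3 n) = 12 * (n choose 3)"
proof -
  let ?f = "\<lambda>(((p, p'), (q, q'), (r, r')), (i, j, k)). {Coord i p p', Coord j q q', Coord k r r'}"
  have "nonfaces3 n = ?f ` (cubic_types \<times> triples_lt n)"
  proof (rule equalityI; rule subsetI)
    fix B assume "B \<in> nonfaces3 n"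
    then obtain i j k p p' q q' r r' where B: "B = {Coord i p p', Coord j q q', Coord k r r'}"
      and ijk: "i < j" "j < k" "k < n" and ty: "((p, p'), (q, q'), (r, r')) \<in> cubic_types"
      unfolding nonfaces3_def by blast
    show "B \<in> ?f ` (cubic_types \<times> triples_lt n)"
      by (rule image_eqI[of _ _ "(((p, p'), (q, q'), (r, r')), (i, j, k))"])
        (use B ijk ty in \<open>auto simp: triples_lt_def\<close>)
  next
    fix B assume "B \<in> ?f ` (cubic_types \<times> triples_lt n)"
    then obtain x where x: "x \<in> cubic_types \<times> triples_lt n" "B = ?f x" by (elim imageE)
    obtain p p' q q' r r' i j k where "x = (((p, p'), (q, q'), (r, r')), (i, j, k))" by (metis prod.exhaust)
    with x have "B = {Coord i p p', Coord j q q', Coord k r r'}" "i < j" "j < k" "k < n"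
      "((p, p'), (q, q'), (r, r')) \<in> cubic_types"
      by (simp_all add: triples_lt_def)
    then show "B \<in> nonfaces3 n" unfolding nonfaces3_def by blast
  qed
  moreover have "inj_on ?f (cubic_types \<times> triples_lt n)"
  proof (rule inj_onI)
    fix x y assume xy: "x \<in> cubic_types \<times> triples_lt n" "y \<in> cubic_types \<times> triples_lt n" "?f x = ?f y"
    obtain p p' q q' r r' i j k where x: "x = (((p, p'), (q, q'), (r, r')), (i, j, k))" by (metis prod.exhaust)
    obtain s s' t t' u u' i' j' k' where y: "y = (((s, s'), (t, t'), (u, u')), (i', j', k'))" by (metis prod.exhaust)
    have lt: "i < j" "j < k" "i' < j'" "j' < k'" using xy(1,2) unfolding x y by (simp_all add: triples_lt_def)
    \<comment> \<open>Both supports are listed in ascending order of the unknowns, so equal sets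
      give equal lists.\<close>
    have "[Coord k r r', Coord j q q', Coord i p p'] = [Coord k' u u', Coord j' t t', Coord i' s s']"
    proof (rule sorted_distinct_set_unique)
      show "set [Coord k r r', Coord j q q', Coord i p p'] = set [Coord k' u u', Coord j' t t', Coord i' s s']"
        using xy(3) unfolding x y by (simp add: insert_commute)
    qed (use lt in \<open>simp_all add: less_coord_def less_eq_coord_def\<close>)
    then show "x = y" unfolding x y by simp
  qed
  ultimately show ?thesis
    using card_triples_lt[of n] card_cubic_types finite_cubic_types by (simp add: card_image card_cartesian_product)
qed

lemma card_nonfaces4: "card (nonfaces4 n) = 4 * ((n + 1) choose 4)"
proof -
  let ?f = "\<lambda>((p, r), (i, j, k, l)). {Coord i 1 p, p02 j, p13 k, Coord l r 2}"
  let ?A = "({2, 3} \<times> {0, 1}) \<times> quadruples_le n"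
  have "nonfaces4 n = ?f ` ?A"
  proof (rule equalityI; rule subsetI)
    fix B assume "B \<in> nonfaces4 n"
    then obtain i j k l p r where B: "B = {Coord i 1 p, p02 j, p13 k, Coord l r 2}"
      and ijkl: "i < j" "j \<le> k" "k < l" "l < n" "p \<in> {2, 3}" "r \<in> {0, 1}"
      unfolding nonfaces4_def by blast
    show "B \<in> ?f ` ?A"
      by (rule image_eqI[of _ _ "((p, r), (i, j, k, l))"]) (use B ijkl in \<open>auto simp: quadruples_le_def\<close>)
  next
    fix B assume "B \<in> ?f ` ?A"
    then obtain x where x: "x \<in> ?A" "B = ?f x" by (elim imageE)
    obtain p r i j k l where "x = ((p, r), (i, j, k, l))" by (metis prod.exhaust)
    with x have "B = {Coord i 1 p, p02 j, p13 k, Coord l r 2}"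
      "i < j" "j \<le> k" "k < l" "l < n" "p \<in> {2, 3}" "r \<in> {0, 1}"
      by (auto simp: quadruples_le_def)
    then show "B \<in> nonfaces4 n" unfolding nonfaces4_def by blast
  qed
  moreover have "inj_on ?f ?A"
  proof (rule inj_onI)
    fix x y assume xy: "x \<in> ?A" "y \<in> ?A" "?f x = ?f y"
    obtain p r i j k l where x: "x = ((p, r), (i, j, k, l))" by (metis prod.exhaust)
    obtain p' r' i' j' k' l' where y: "y = ((p', r'), (i', j', k', l'))" by (metis prod.exhaust)
    have lt: "i < j" "j \<le> k" "k < l" "i' < j'" "j' \<le> k'" "k' < l'"
      using xy(1,2) unfolding x y by (simp_all add: quadruples_le_def)
    have "[Coord l r 2, p13 k, p02 j, Coord i 1 p] = [Coord l' r' 2, p13 k', p02 j', Coord i' 1 p']"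
    proof (rule sorted_distinct_set_unique)
      show "set [Coord l r 2, p13 k, p02 j, Coord i 1 p] = set [Coord l' r' 2, p13 k', p02 j', Coord i' 1 p']"
        using xy(3) unfolding x y by (simp add: insert_commute)
    qed (use lt in \<open>auto simp: less_coord_def less_eq_coord_def\<close>)
    then show "x = y" unfolding x y by simp
  qed
  moreover have "card ({2, 3 :: nat} \<times> {0, 1 :: nat}) = 4" by (simp add: card_cartesian_product)
  ultimately show ?thesis
    using card_quadruples_le[of n] by (simp add: card_image card_cartesian_product)
qed

subsection \<open>The initial ideal is radical\<close>

lemma restr_add: "restr B (f + g) = restr B f + restr B g"
  by (rule poly_mapping_eqI) (simp add: lookup_restr lookup_add)

lemma restr_id: "keys f \<subseteq> B \<Longrightarrow> restr B f = f"
  by (rule poly_mapping_eqI) (auto simp: lookup_restr in_keys_iff)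

lemma restr_zero: "keys f \<inter> B = {} \<Longrightarrow> restr B f = 0"
  by (rule poly_mapping_eqI) (auto simp: lookup_restr in_keys_iff)

text \<open>Keeping the monomials supported in \<open>F\<close> amounts to substituting 0 for the
  unknowns outside \<open>F\<close>, which is a ring homomorphism.\<close>

lemma restr_face_mult:
  fixes F :: "coord set"
  defines "A \<equiv> {m. keys m \<subseteq> F}"
  shows "restr A (f * g) = restr A f * restr A g"
proof -
  let ?f = "restr (- A) f" and ?g = "restr (- A) g"
  have out: "keys (h * h') \<inter> A = {}" if "keys h \<inter> A = {}" for h h' :: mpoly
  proof (rule equals0I)
    fix t assume "t \<in> keys (h * h') \<inter> A"
    then have t: "t \<in> keys (h * h')" "keys t \<subseteq> F" by (auto simp: A_def)
    from t(1) obtain m m' where "m \<in> keys h" "m' \<in> keys h'" "t = m + m'" by (rule keys_mult_mon)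
    with t(2) that show False by (auto simp: A_def keys_add_mon)
  qed
  have "f * g = restr A f * restr A g + (?f * g + ?g * restr A f)"
  proof -
    have "f * g = (restr A f + ?f) * g" using restr_split[of f A] by simp
    also have "\<dots> = restr A f * (restr A g + ?g) + ?f * g" using restr_split[of g A] by (simp add: distrib_right)
    finally show ?thesis by (simp add: algebra_simps)
  qed
  then have "restr A (f * g) = restr A (restr A f * restr A g) + (restr A (?f * g) + restr A (?g * restr A f))"
    by (simp only: restr_add)
  also have "restr A (?f * g) = 0" by (intro restr_zero out) auto
  also have "restr A (?g * restr A f) = 0" by (intro restr_zero out) auto
  also have "restr A (restr A f * restr A g) = restr A f * restr A g"
  proof (rule restr_id, rule subsetI)
    fix t assume "t \<in> keys (restr A f * restr A g)"
    then obtain m m' where "m \<in> keys (restr A f)" "m' \<in> keys (restr A g)" "t = m + m'" by (rule keys_mult_mon)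
    then show "t \<in> A" by (auto simp: A_def keys_add_mon)
  qed
  finally show ?thesis by simp
qed

lemma restr_face_power: "restr {m. keys m \<subseteq> F} (f ^ k) = restr {m. keys m \<subseteq> F} f ^ k"
proof (induction k)
  case 0
  show ?case by (simp add: restr_id)
qed (simp add: restr_face_mult)

text \<open>Stanley-Reisner argument: being standard depends only on the support. If f had a
  standard monomial m, setting the unknowns outside \<open>keys m\<close> to 0 would kill a power of
  f but not f, which is impossible in a domain.\<close>

lemma radical_nonstandard_ideal: "radical_ideal n (nonstandard_ideal n)"
  unfolding radical_ideal_def
proof (intro conjI ballI allI impI)
  show "ideal (nonstandard_ideal n) (poly_ring n)"
  proof -
    have "{single (lead_mon g) 1 | g. g \<in> gen_ideal n \<and> g \<noteq> 0} \<subseteq> polys n"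
      using lead_keys(1) by (auto intro!: carrier_single)
    from ideal_genideal[OF this] show ?thesis unfolding initial_ideal_eq[symmetric] initial_ideal_def .
  qed
next
  fix f and k :: nat
  assume f: "f \<in> polys n" and "f [^]\<^bsub>poly_ring n\<^esub> k \<in> nonstandard_ideal n"
  then have fk: "f ^ k \<in> nonstandard_ideal n" by simp
  have "m \<notin> standard n 3" if m: "m \<in> keys f" for m
  proof
    assume std: "m \<in> standard n 3"
    let ?A = "{t. keys t \<subseteq> keys m}"
    have "keys (f ^ k) \<inter> ?A = {}"
    proof (rule ccontr)
      assume "keys (f ^ k) \<inter> ?A \<noteq> {}"
      then obtain t where t: "t \<in> keys (f ^ k)" "keys t \<subseteq> keys m" by blast
      then have "t \<in> standard n 3" using std face_subset[OF t(2)] by (auto simp: standard_def)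
      with t(1) fk show False by (auto simp: nonstandard_ideal_def)
    qed
    then have "restr ?A f ^ k = 0" unfolding restr_face_power[symmetric] by (rule restr_zero)
    then have "restr ?A f = 0" by (simp add: power_eq_0_iff)
    then have "keys f \<inter> ?A = {}" using keys_restr[of ?A f] by simp
    with m show False by blast
  qed
  with f show "f \<in> nonstandard_ideal n" by (simp add: nonstandard_ideal_def)
qed

section \<open>Minimality of the generators\<close>

lemma eval_det3_0:
  assumes "x \<in> {i, j, k}" "\<forall>p q. a (Coord x p q) = 0"
  shows "eval a (det3 (p, p') (q, q') (r, r') i j k) = 0"
  using assms by (auto simp: det3_def Let_def)

lemma eval_cubic_0:
  assumes "i < j" "j < k" "k < n" "(p, q) \<in> upairs" "x \<in> {i, j, k}" "\<forall>p q. a (Coord x p q) = 0"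
  shows "eval a (cubic n (uvec p q) {i, j, k}) = 0"
  by (rule cubic_closed[OF assms(1-4), of "\<lambda>f. eval a f = 0"]) (simp_all add: eval_det3_0[OF assms(5,6)])

text \<open>The nonzero unknowns are those of the leading monomial of \<open>quad i j\<close>, and
  no other quadric contains their product. Cubics vanish because they need three nonzero
  lines.\<close>

definition quad_pt :: "nat \<Rightarrow> nat \<Rightarrow> coord \<Rightarrow> complex" where
  "quad_pt i j v = (if i < j then of_bool (v = p23 i \<or> v = p01 j)
     else of_bool (v = p03 i \<or> v = p12 i))"

lemma eval_quad_pt_quad: "i \<le> j \<Longrightarrow> k \<le> l \<Longrightarrow> eval (quad_pt i j) (quad k l) = 0 \<longleftrightarrow> (k, l) \<noteq> (i, j)"
  by (auto simp: quad_def quad_pt_def)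

lemma eval_quad_pt_cubic:
  assumes "g \<in> cubics n"
  shows "eval (quad_pt i j) g = 0"
proof -
  obtain k l m p q where g: "k < l" "l < m" "m < n" "(p, q) \<in> upairs" "g = cubic n (uvec p q) {k, l, m}"
    using assms by (rule cubics_cases)
  have "\<exists>x\<in>{k, l, m}. x \<noteq> i \<and> x \<noteq> j" using g(1,2) by auto
  then obtain x where x: "x \<in> {k, l, m}" "x \<noteq> i" "x \<noteq> j" by blast
  show ?thesis
    unfolding g(5) by (rule eval_cubic_0[OF g(1-4) x(1)]) (use x(2,3) in \<open>simp add: quad_pt_def\<close>)
qed

definition pairs_le :: "nat \<Rightarrow> (nat \<times> nat) set" where
  "pairs_le n = {(i, j). i \<le> j \<and> j < n}"

lemma card_pairs_le: "finite (pairs_le n) \<and> card (pairs_le n) = (n + 1) choose 2"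
proof (induction n)
  case 0
  have "pairs_le 0 = {}" by (auto simp: pairs_le_def)
  then show ?case by (simp add: binomial_eq_0)
next
  case (Suc n)
  have "pairs_le (Suc n) = pairs_le n \<union> (\<lambda>i. (i, n)) ` {..n}" by (auto simp: pairs_le_def less_Suc_eq)
  moreover have "pairs_le n \<inter> (\<lambda>i. (i, n)) ` {..n} = {}" by (auto simp: pairs_le_def)
  moreover have "inj_on (\<lambda>i. (i, n)) {..n}" by (auto simp: inj_on_def)
  ultimately show ?case using card_extend[of "pairs_le n" "{..n}" "pairs_le (Suc n)" "\<lambda>i. (i, n)"] Suc
    by (simp add: numeral_2_eq_2)
qed

lemma quadrics_image: "quadrics n = (\<lambda>(i, j). - (2 * quad i j)) ` pairs_le n"
  by (auto simp: quadrics_eq pairs_le_def image_iff)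

lemma card_quadrics: "card (quadrics n) = (n + 1) choose 2"
proof -
  have "inj_on (\<lambda>(i, j). - (2 * quad i j)) (pairs_le n)"
  proof (rule inj_onI)
    fix x y assume xy: "x \<in> pairs_le n" "y \<in> pairs_le n"
      "(case x of (i, j) \<Rightarrow> - (2 * quad i j)) = (case y of (i, j) \<Rightarrow> - (2 * quad i j))"
    obtain i j where x: "x = (i, j)" by (cases x)
    obtain k l where y: "y = (k, l)" by (cases y)
    have le: "i \<le> j" "k \<le> l" using xy(1,2) by (simp_all add: x y pairs_le_def)
    have "eval (quad_pt i j) (- (2 * quad i j)) = eval (quad_pt i j) (- (2 * quad k l))"
      using xy(3) by (simp only: x y prod.case)
    then have "eval (quad_pt i j) (quad k l) \<noteq> 0" using eval_quad_pt_quad[OF le(1) le(1)] by simp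
    then show "x = y" using eval_quad_pt_quad[OF le] by (simp add: x y)
  qed
  then show ?thesis using card_pairs_le[of n] by (simp add: quadrics_image card_image)
qed

lemma quadrics_cubics_disjoint: "quadrics n \<inter> cubics n = {}"
proof (rule equals0I)
  fix g assume g: "g \<in> quadrics n \<inter> cubics n"
  then obtain i j where ij: "i \<le> j" "g = - (2 * quad i j)" by (auto simp: quadrics_eq)
  have "eval (quad_pt i j) g = 0" using g eval_quad_pt_cubic by blast
  then show False using eval_quad_pt_quad[OF ij(1) ij(1)] by (simp add: ij(2))
qed

text \<open>
  Coplanar lines: the points of line \<open>l\<close> are those on the two planes \<open>h\<close> and \<open>g l\<close>. All quadrics
  vanish there, while the cubic of \<open>u\<close> takes the value \<open>\<plusminus> (h \<bullet> u)\<^sup>2 det (h, g\<^sub>i, g\<^sub>j, g\<^sub>k)\<close>; the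
  squares \<open>(h \<bullet> u)\<^sup>2\<close> are linearly independent.
\<close>

definition planar_pt :: "(nat \<Rightarrow> complex) \<Rightarrow> (nat \<Rightarrow> nat \<Rightarrow> complex) \<Rightarrow> complex \<Rightarrow> coord \<Rightarrow> complex" where
  "planar_pt h g t v = (let m = (\<lambda>p q. h p * g (line v) q - h q * g (line v) p) in
     t * (if fst_index v = 0 \<and> snd_index v = 1 then m 2 3
       else if fst_index v = 0 \<and> snd_index v = 2 then - m 1 3
       else if fst_index v = 0 \<and> snd_index v = 3 then m 1 2
       else if fst_index v = 1 \<and> snd_index v = 2 then m 0 3
       else if fst_index v = 1 \<and> snd_index v = 3 then - m 0 2
       else m 0 1))"

definition det4 :: "(nat \<Rightarrow> complex) \<Rightarrow> (nat \<Rightarrow> complex) \<Rightarrow> (nat \<Rightarrow> complex) \<Rightarrow> (nat \<Rightarrow> complex) \<Rightarrow> complex" where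
  "det4 h x y z = (let m = (\<lambda>p q. y p * z q - y q * z p); d = (\<lambda>p q r. x p * m q r - x q * m p r + x r * m p q) in
     h 0 * d 1 2 3 - h 1 * d 0 2 3 + h 2 * d 0 1 3 - h 3 * d 0 1 2)"

lemma eval_planar_quad: "eval (planar_pt h g t) (quad i j) = 0"
  by (simp add: quad_def planar_pt_def Let_def algebra_simps)

lemma planar_pt_0: "g l = (\<lambda>_. 0) \<Longrightarrow> planar_pt h g t (Coord l p q) = 0"
  by (simp add: planar_pt_def)

lemma planar_pt_t0: "planar_pt h g 0 = (\<lambda>_. 0)"
  by (simp add: planar_pt_def fun_eq_iff)

lemma planar_pt_curve: "\<exists>p. \<forall>t. planar_pt h g t v = poly p t"
  by (intro exI[of _ "[:0, planar_pt h g 1 v:]"]) (simp add: planar_pt_def Let_def)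

lemma eval_planar_det:
  fixes h g t i j k
  defines "a \<equiv> planar_pt h g t" and "D \<equiv> t ^ 3 * det4 h (g i) (g j) (g k)"
  shows "eval a (det_0 i j k) = - (h 0)\<^sup>2 * D" "eval a (det_1 i j k) = - (h 1)\<^sup>2 * D"
    "eval a (det_2 i j k) = - (h 2)\<^sup>2 * D" "eval a (det_3 i j k) = - (h 3)\<^sup>2 * D"
    "eval a (det_01 i j k) = 2 * h 0 * h 1 * D" "eval a (det_02 i j k) = - 2 * h 0 * h 2 * D"
    "eval a (det_03 i j k) = 2 * h 0 * h 3 * D" "eval a (det_12 i j k) = 2 * h 1 * h 2 * D"
    "eval a (det_13 i j k) = - 2 * h 1 * h 3 * D" "eval a (det_23 i j k) = 2 * h 2 * h 3 * D"
  unfolding a_def D_def det4_def generator_defs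
  by (simp_all add: planar_pt_def Let_def power2_eq_square power3_eq_cube algebra_simps)

definition dot_u :: "(nat \<Rightarrow> complex) \<Rightarrow> nat \<times> nat \<Rightarrow> complex" where
  "dot_u h u = (if fst u = snd u then h (fst u) else h (fst u) + h (snd u))"

lemma eval_planar_cubic:
  assumes "i < j" "j < k" "k < n" "(p, q) \<in> upairs"
  shows "eval (planar_pt h g t) (cubic n (uvec p q) {i, j, k}) =
    t ^ 3 * ((- 1) ^ Suc p * (dot_u h (p, q))\<^sup>2 * det4 h (g i) (g j) (g k))"
  using assms(4) unfolding upairs_def
  by (elim insertE emptyE Pair_inject; simp only: cubic_explicit[OF assms(1-3)] One_nat_def[symmetric] eval_add eval_diff eval_uminus eval_planar_det)
     (simp_all add: dot_u_def power2_eq_square algebra_simps)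

definition indic :: "nat \<Rightarrow> nat \<Rightarrow> complex" where
  "indic p q = of_bool (q = p)"

definition test_h :: "nat \<times> nat \<Rightarrow> nat \<Rightarrow> complex" where
  "test_h c q = of_bool (q = fst c \<or> q = snd c)"

text \<open>The vectors are the basis vectors other than e_c, so that det (h, g_i, g_j, g_k) is h_c
  up to sign, which is nonzero for the chosen h. Lines outside the triple are set to zero, which
  kills the cubics of other triples.\<close>

definition test_g :: "nat \<Rightarrow> nat \<Rightarrow> nat \<Rightarrow> nat \<Rightarrow> nat \<Rightarrow> nat \<Rightarrow> complex" where
  "test_g c i j k l = (case other_rows c of (x, y, z) \<Rightarrow>
     if l = i then indic x else if l = j then indic y else if l = k then indic z else (\<lambda>_. 0))"

lemma det4_test:
  assumes "i < j" "j < k" "(c, d) \<in> upairs"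
  shows "det4 (test_h (c, d)) (test_g c i j k i) (test_g c i j k j) (test_g c i j k k) \<noteq> 0"
  using assms unfolding upairs_def
  by (elim insertE emptyE Pair_inject; simp add: test_g_def other_rows_def det4_def test_h_def indic_def Let_def)

lemma sum_upairs: "(\<Sum>u\<in>upairs. f u) = f (0,0) + f (1,1) + f (2,2) + f (3,3) + f (0,1) + f (0,2) + f (0,3) + f (1,2) + f (1,3) + f (2,3)"
  for f :: "nat \<times> nat \<Rightarrow> complex"
  by (simp add: upairs_def add.assoc)

text \<open>Polarization: in the value at h = e_a + e_b every u meeting only one of a, b counts as
  it did for e_a or e_b, while (a, b) contributes 4 d (a, b) instead of 2 d (a, b).\<close>

lemma squares_independent:
  fixes d :: "nat \<times> nat \<Rightarrow> complex"
  assumes "\<And>c. c \<in> upairs \<Longrightarrow> (\<Sum>u\<in>upairs. d u * (dot_u (test_h c) u)\<^sup>2) = 0" and "u \<in> upairs"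
  shows "d u = 0"
proof -
  define s where "s a = (\<Sum>u\<in>upairs. d u * (dot_u (test_h (a, a)) u)\<^sup>2)" for a
  have s: "s 0 = 0" "s 1 = 0" "s 2 = 0" "s 3 = 0"
    unfolding s_def by (rule assms(1), simp add: upairs_def)+
  have m: "d (a, b) = 0" if "(a, b) \<in> upairs" "a < b" for a b
  proof -
    have "(\<Sum>u\<in>upairs. d u * (dot_u (test_h (a, b)) u)\<^sup>2) = s a + s b + 2 * d (a, b)"
      using that unfolding s_def sum_upairs upairs_def
      by (elim insertE emptyE Pair_inject; simp add: dot_u_def test_h_def)
    moreover have "s a = 0" "s b = 0" using that s unfolding upairs_def by auto
    ultimately show ?thesis using assms(1)[OF that(1)] by simp
  qed
  have "d (a, a) = 0" if "(a, a) \<in> upairs" for a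
  proof -
    have "s a = d (a, a)"
      using that m unfolding s_def sum_upairs upairs_def
      by (elim insertE emptyE Pair_inject; simp add: dot_u_def test_h_def)
    then show ?thesis using that s unfolding upairs_def by auto
  qed
  with m assms(2) show ?thesis by (cases u) (metis le_neq_implies_less upairs_iff)
qed

lemma cubic_neq:
  assumes J: "J \<in> triples n" "J' \<in> triples n" and u: "(p, q) \<in> upairs" "(p', q') \<in> upairs"
    and ne: "((p, q), J) \<noteq> ((p', q'), J')"
  shows "cubic n (uvec p q) J \<noteq> cubic n (uvec p' q') J'"
proof
  assume eq: "cubic n (uvec p q) J = cubic n (uvec p' q') J'"
  obtain i j k where ijk: "J = {i, j, k}" "i < j" "j < k" "k < n" using J(1) by (rule triplesE)
  \<comment> \<open>Equality of the cubics becomes a linear relation between squares with these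
    coefficients. The second term is present only for J' = J, and the sign is the one in
    \<open>eval_planar_cubic\<close>.\<close>
  let ?d = "\<lambda>w. (of_bool (w = (p, q)) - of_bool (J' = J \<and> w = (p', q'))) * (- 1) ^ Suc (fst w) :: complex"
  have "?d (p, q) = 0"
  proof (rule squares_independent[where d = ?d, OF _ u(1)])
    fix c assume c: "c \<in> upairs"
    let ?h = "test_h c" and ?g = "test_g (fst c) i j k"
    let ?D = "det4 ?h (?g i) (?g j) (?g k)"
    have D: "?D \<noteq> 0" using det4_test[OF ijk(2,3), of "fst c" "snd c"] c by simp
    have fin: "finite upairs" by (simp add: upairs_def)
    have "eval (planar_pt ?h ?g 1) (cubic n (uvec p q) J) = (- 1) ^ Suc p * (dot_u ?h (p, q))\<^sup>2 * ?D"
      unfolding ijk(1) eval_planar_cubic[OF ijk(2-4) u(1)] by simp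
    moreover have "eval (planar_pt ?h ?g 1) (cubic n (uvec p' q') J') =
        of_bool (J' = J) * ((- 1) ^ Suc p' * (dot_u ?h (p', q'))\<^sup>2 * ?D)"
    proof (cases "J' = J")
      case True
      then show ?thesis unfolding ijk(1) by (simp add: eval_planar_cubic[OF ijk(2-4) u(2)])
    next
      case False
      obtain i' j' k' where ijk': "J' = {i', j', k'}" "i' < j'" "j' < k'" "k' < n" using J(2) by (rule triplesE)
      \<comment> \<open>Both sets have three elements, so \<open>J'\<close> has a line outside
        \<open>J\<close>, which is zero at the test point.\<close>
      have "\<not> J' \<subseteq> J" using J False by (auto simp: triples_def dest: card_subset_eq[of J J', OF finite_subset[of _ "{..<n}"]])
      then obtain x where x: "x \<in> {i', j', k'}" "x \<notin> {i, j, k}" using ijk'(1) ijk(1) by blast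
      have "?g x = (\<lambda>_. 0)" using x(2) by (simp add: test_g_def split: prod.split)
      with False show ?thesis
        unfolding ijk'(1) by (simp add: eval_cubic_0[OF ijk'(2-4) u(2) x(1)] planar_pt_0)
    qed
    ultimately have "((- 1) ^ Suc p * (dot_u ?h (p, q))\<^sup>2 - of_bool (J' = J) * ((- 1) ^ Suc p' * (dot_u ?h (p', q'))\<^sup>2)) * ?D = 0"
      using eq by (simp add: algebra_simps)
    then have z: "(- 1) ^ Suc p * (dot_u ?h (p, q))\<^sup>2 - of_bool (J' = J) * ((- 1) ^ Suc p' * (dot_u ?h (p', q'))\<^sup>2) = 0"
      using D by simp
    have "(\<Sum>w\<in>upairs. ?d w * (dot_u ?h w)\<^sup>2) =
        (\<Sum>w\<in>upairs. (if w = (p, q) then (- 1) ^ Suc p * (dot_u ?h (p, q))\<^sup>2 else 0)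
          - (if w = (p', q') then of_bool (J' = J) * ((- 1) ^ Suc p' * (dot_u ?h (p', q'))\<^sup>2) else 0))"
      by (rule sum.cong) auto
    also have "\<dots> = 0" unfolding sum_subtractf using fin u z by (simp add: sum.delta)
    finally show "(\<Sum>w\<in>upairs. ?d w * (dot_u ?h w)\<^sup>2) = 0" .
  qed
  with ne show False by (auto split: if_splits)
qed

lemma card_triples: "card (triples n) = n choose 3"
  unfolding triples_def using n_subsets[of "{..<n}" 3] by simp

lemma card_cubics: "card (cubics n) = 10 * (n choose 3)"
proof -
  let ?f = "\<lambda>(u, J). cubic n (uvec (fst u) (snd u)) J"
  have "cubics n = ?f ` (upairs \<times> triples n)"
    unfolding cubics_def ten_vectors_eq by (auto simp: image_iff split_beta) force+
  moreover have "inj_on ?f (upairs \<times> triples n)"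
  proof (rule inj_onI, rule ccontr)
    fix x y assume xy: "x \<in> upairs \<times> triples n" "y \<in> upairs \<times> triples n" "?f x = ?f y" "x \<noteq> y"
    obtain p q J where x: "x = ((p, q), J)" by (metis prod.exhaust)
    obtain p' q' J' where y: "y = ((p', q'), J')" by (metis prod.exhaust)
    show False using cubic_neq[of J n J' p q p' q'] xy by (simp add: x y)
  qed
  moreover have "card upairs = 10" by (simp add: upairs_def)
  ultimately show ?thesis by (simp add: card_image card_cartesian_product card_triples)
qed

lemma quadric_needed:
  assumes "H \<subseteq> gens n" "g \<in> quadrics n" "g \<notin> H"
  shows "g \<notin> genideal (poly_ring n) H"
proof -
  obtain i j where g: "i \<le> j" "g = - (2 * quad i j)" using assms(2) by (auto simp: quadrics_eq)
  let ?K = "{f \<in> polys n. eval (quad_pt i j) f = 0}"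
  have "ideal ?K (poly_ring n)"
    by (rule ideal_poly_ringI) (auto intro: carrier_0 carrier_add carrier_mult)
  moreover have "H \<subseteq> ?K"
  proof
    fix f assume f: "f \<in> H"
    have "eval (quad_pt i j) f = 0"
    proof (cases "f \<in> cubics n")
      case True
      then show ?thesis by (rule eval_quad_pt_cubic)
    next
      case False
      with f assms(1) obtain k l where kl: "k \<le> l" "f = - (2 * quad k l)" by (auto simp: gens_def quadrics_eq)
      with f assms(3) g have "(k, l) \<noteq> (i, j)" by auto
      then show ?thesis using eval_quad_pt_quad[OF g(1) kl(1)] kl(2) by simp
    qed
    with f assms(1) gens_subset show "f \<in> ?K" by blast
  qed
  ultimately have "genideal (poly_ring n) H \<subseteq> ?K" by (rule genideal_least)
  moreover have "g \<notin> ?K" using eval_quad_pt_quad[OF g(1) g(1)] by (simp add: g(2))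
  ultimately show ?thesis by blast
qed

text \<open>
  Restricting a representation of a cubic by the other generators to the cone over planar triples
  with line indices in \<open>J\<close>, and comparing the coefficients of \<open>t\<^sup>3\<close>, only the constant terms of the
  coefficients of the ten cubics for \<open>J\<close> survive.
\<close>

lemma cubic_needed:
  assumes "H \<subseteq> gens n" "g \<in> cubics n" "g \<notin> H"
  shows "g \<notin> genideal (poly_ring n) H"
proof
  assume gH: "g \<in> genideal (poly_ring n) H"
  obtain i j k p q where ijk: "i < j" "j < k" "k < n" and pq: "(p, q) \<in> upairs" and g: "g = cubic n (uvec p q) {i, j, k}"
    using assms(2) by (rule cubics_cases)
  let ?c = "\<lambda>u. cubic n (uvec (fst u) (snd u)) {i, j, k}"
  have fin: "finite upairs" by (simp add: upairs_def)
  \<comment> \<open>\<open>rep f C\<close>: on the planar cone f agrees with the combination of the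
    ten cubics of the triple with coefficients \<open>C\<close>, where the cubic in question has
    coefficient 0. Polynomials with such a representation form an ideal, and it contains
    \<open>H\<close>.\<close>
  define rep :: "mpoly \<Rightarrow> (nat \<times> nat \<Rightarrow> mpoly) \<Rightarrow> bool" where
    "rep f C \<longleftrightarrow> C (p, q) = 0 \<and> (\<forall>h g t. (\<forall>l. l \<notin> {i, j, k} \<longrightarrow> g l = (\<lambda>_. 0)) \<longrightarrow>
      eval (planar_pt h g t) f = (\<Sum>u\<in>upairs. eval (planar_pt h g t) (C u) * eval (planar_pt h g t) (?c u)))" for f C
  define K where "K = {f \<in> polys n. \<exists>C. rep f C}"
  have "ideal K (poly_ring n)"
  proof (rule ideal_poly_ringI)
    show "K \<subseteq> polys n" by (auto simp: K_def)
    have "rep 0 (\<lambda>_. 0)" by (simp add: rep_def)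
    then show "0 \<in> K" unfolding K_def using carrier_0 by blast
  next
    fix f f' assume ff': "f \<in> K" "f' \<in> K"
    then obtain C C' where "rep f C" "rep f' C'" unfolding K_def by blast
    then have "rep (f + f') (\<lambda>u. C u + C' u)" by (simp add: rep_def distrib_right sum.distrib)
    with ff' show "f + f' \<in> K" unfolding K_def using carrier_add by blast
  next
    fix r f assume rf: "r \<in> polys n" "f \<in> K"
    then obtain C where "rep f C" unfolding K_def by blast
    then have "rep (r * f) (\<lambda>u. r * C u)" by (simp add: rep_def sum_distrib_left mult.assoc)
    with rf show "r * f \<in> K" unfolding K_def using carrier_mult by blast
  qed
  moreover have "H \<subseteq> K"
  proof
    fix f assume f: "f \<in> H"
    then have fc: "f \<in> polys n" using assms(1) gens_subset by blast
    have zero: "f \<in> K" if "\<And>h g t. (\<forall>l. l \<notin> {i, j, k} \<longrightarrow> g l = (\<lambda>_. 0)) \<Longrightarrow> eval (planar_pt h g t) f = 0"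
    proof -
      have "rep f (\<lambda>_. 0)" using that by (simp add: rep_def)
      with fc show ?thesis unfolding K_def by blast
    qed
    show "f \<in> K"
    proof (cases "f \<in> cubics n")
      case False
      with f assms(1) obtain a b where "f = - (2 * quad a b)" by (auto simp: gens_def quadrics_eq)
      then show ?thesis by (intro zero) (simp add: eval_planar_quad)
    next
      case True
      then obtain i' j' k' p' q' where ijk': "i' < j'" "j' < k'" "k' < n" and pq': "(p', q') \<in> upairs"
        and f': "f = cubic n (uvec p' q') {i', j', k'}"
        by (rule cubics_cases)
      show ?thesis
      proof (cases "{i', j', k'} \<subseteq> {i, j, k}")
        case False
        then obtain x where x: "x \<in> {i', j', k'}" "x \<notin> {i, j, k}" by blast
        show ?thesis
          unfolding f' by (rule zero[unfolded f'])
            (use x in \<open>intro eval_cubic_0[OF ijk' pq' x(1)] allI planar_pt_0, blast\<close>)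
      next
        case True
        then have J: "{i', j', k'} = {i, j, k}"
          using ijk ijk' by (intro card_subset_eq) auto
        have ne: "(p', q') \<noteq> (p, q)" using f assms(3) g f' J by auto
        have "(\<Sum>u\<in>upairs. eval a (if u = (p', q') then 1 else 0) * eval a (?c u)) = eval a f" for a
        proof -
          have "(\<Sum>u\<in>upairs. eval a (if u = (p', q') then 1 else 0) * eval a (?c u)) =
              (\<Sum>u\<in>upairs. if u = (p', q') then eval a (?c u) else 0)"
            by (rule sum.cong) auto
          then show ?thesis using fin pq' by (simp add: sum.delta f' J)
        qed
        then have "rep f (\<lambda>u. if u = (p', q') then 1 else 0)" using ne by (auto simp: rep_def)
        with fc show ?thesis unfolding K_def by blast
      qed
    qed
  qed
  ultimately have "genideal (poly_ring n) H \<subseteq> K" by (rule genideal_least)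
  with gH obtain C where "rep g C" unfolding K_def by blast
  then have C: "C (p, q) = 0"
    "\<And>h g' t. (\<forall>l. l \<notin> {i, j, k} \<longrightarrow> g' l = (\<lambda>_. 0)) \<Longrightarrow>
        eval (planar_pt h g' t) g = (\<Sum>u\<in>upairs. eval (planar_pt h g' t) (C u) * eval (planar_pt h g' t) (?c u))"
    for h g' t
    unfolding rep_def by blast+
  let ?d = "\<lambda>u. (eval (\<lambda>_. 0) (C u) - of_bool (u = (p, q))) * (- 1) ^ Suc (fst u) :: complex"
  have "?d (p, q) = 0"
  proof (rule squares_independent[where d = ?d, OF _ pq])
    fix c assume c: "c \<in> upairs"
    let ?h = "test_h c" and ?g = "test_g (fst c) i j k"
    let ?D = "det4 ?h (?g i) (?g j) (?g k)"
    let ?v = "\<lambda>u. (- 1) ^ Suc (fst u) * (dot_u ?h u)\<^sup>2 * ?D"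
    have D: "?D \<noteq> 0" using det4_test[OF ijk(1,2), of "fst c" "snd c"] c by simp
    have g0: "\<forall>l. l \<notin> {i, j, k} \<longrightarrow> ?g l = (\<lambda>_. 0)" by (simp add: test_g_def split: prod.split)
    have "\<exists>P. \<forall>t. eval (planar_pt ?h ?g t) (C u) = poly P t" for u
      by (rule eval_curve) (rule planar_pt_curve)
    then obtain P where P: "\<And>u t. eval (planar_pt ?h ?g t) (C u) = poly (P u) t" by metis
    have val: "eval (planar_pt ?h ?g t) (?c u) = t ^ 3 * ?v u" if "u \<in> upairs" for u t
      using eval_planar_cubic[OF ijk, of "fst u" "snd u"] that by simp
    \<comment> \<open>Both sides carry the factor t ^ 3 because the cubics are homogeneous; it is
      divided out as a polynomial identity so that t = 0 becomes admissible.\<close>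
    let ?Q = "(\<Sum>u\<in>upairs. smult (?v u) (P u)) - [:?v (p, q):]"
    have "poly ([:0, 1:] ^ 3 * ?Q) t = 0" for t
    proof -
      have "t ^ 3 * ?v (p, q) = (\<Sum>u\<in>upairs. poly (P u) t * (t ^ 3 * ?v u))"
        using C(2)[OF g0, of ?h t] val[OF pq, of t] val by (simp add: g P cong: sum.cong)
      also have "\<dots> = t ^ 3 * (\<Sum>u\<in>upairs. ?v u * poly (P u) t)"
        by (simp add: sum_distrib_left mult_ac)
      finally have "t ^ 3 * ((\<Sum>u\<in>upairs. ?v u * poly (P u) t) - ?v (p, q)) = 0"
        by (simp only: right_diff_distrib diff_self)
      moreover have "poly ([:0, 1:] ^ 3 * ?Q) t = t ^ 3 * ((\<Sum>u\<in>upairs. ?v u * poly (P u) t) - ?v (p, q))"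
        by (simp add: poly_sum)
      ultimately show ?thesis by (simp only:)
    qed
    then have "[:0, 1:] ^ 3 * ?Q = 0" using poly_all_0_iff_0 by blast
    then have "?Q = 0" by simp
    \<comment> \<open>At t = 0 the point is the origin, so only the constant terms of the
      coefficients remain.\<close>
    then have "poly ?Q 0 = 0" by simp
    then have "(\<Sum>u\<in>upairs. ?v u * eval (\<lambda>_. 0) (C u)) - ?v (p, q) = 0"
      using P[where t = 0] by (simp add: poly_sum planar_pt_t0)
    then have "(\<Sum>u\<in>upairs. ?v u * eval (\<lambda>_. 0) (C u)) = ?v (p, q)"
      by (simp only: right_minus_eq)
    moreover have "(\<Sum>u\<in>upairs. ?v u * of_bool (u = (p, q))) = ?v (p, q)"
    proof -
      have "(\<Sum>u\<in>upairs. ?v u * of_bool (u = (p, q))) = (\<Sum>u\<in>upairs. if u = (p, q) then ?v u else 0)"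
        by (rule sum.cong) auto
      then show ?thesis using fin pq by (simp add: sum.delta)
    qed
    ultimately have "(\<Sum>u\<in>upairs. ?v u * (eval (\<lambda>_. 0) (C u) - of_bool (u = (p, q)))) = 0"
      by (simp only: right_diff_distrib sum_subtractf diff_self)
    moreover have "(\<Sum>u\<in>upairs. ?v u * (eval (\<lambda>_. 0) (C u) - of_bool (u = (p, q)))) =
        ?D * (\<Sum>u\<in>upairs. ?d u * (dot_u ?h u)\<^sup>2)"
      unfolding sum_distrib_left by (intro sum.cong refl) (simp only: mult_ac)
    ultimately have "?D * (\<Sum>u\<in>upairs. ?d u * (dot_u ?h u)\<^sup>2) = 0"
      by (simp only:)
    with D show "(\<Sum>u\<in>upairs. ?d u * (dot_u ?h u)\<^sup>2) = 0" by simp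
  qed
  with C(1) show False by simp
qed

lemma minimally_generates_gens: "minimally_generates n (gens n) (gen_ideal n)"
  unfolding minimally_generates_def
proof (intro conjI allI impI)
  show "gens n \<subseteq> polys n" by (rule gens_subset)
  show "genideal (poly_ring n) (gens n) = gen_ideal n" by (simp add: gen_ideal_def)
  fix H assume "H \<subset> gens n"
  then obtain g where g: "H \<subseteq> gens n" "g \<in> gens n" "g \<notin> H" by blast
  then have "g \<notin> genideal (poly_ring n) H"
    using quadric_needed cubic_needed unfolding gens_def by blast
  moreover have "g \<in> gen_ideal n" using g(2) gens_gen_ideal by blast
  ultimately show "genideal (poly_ring n) H \<noteq> gen_ideal n" by blast
qed

theorem theorem3p1:
  fixes n :: nat
  shows
    "primeideal (concurrent_ideal n) (poly_ring n) \<and>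
     (\<forall>u\<in>ten_vectors. \<forall>J\<in>triples n. \<forall>r<4. minor n u r J \<in> {0, cubic n u J, - cubic n u J}) \<and>
     card (quadrics n) = (n + 1) choose 2 \<and>
     card (cubics n) = 10 * (n choose 3) \<and>
     quadrics n \<inter> cubics n = {} \<and>
     minimally_generates n (quadrics n \<union> cubics n) (concurrent_ideal n) \<and>
     (\<exists>!G. reduced_groebner_basis n (concurrent_ideal n) G) \<and>
     (\<forall>G. reduced_groebner_basis n (concurrent_ideal n) G \<longrightarrow>
        (\<forall>g\<in>G. homogeneous 2 g \<or> homogeneous 3 g \<or> homogeneous 4 g) \<and>
        card {g\<in>G. homogeneous 2 g} = (n + 1) choose 2 \<and>
        card {g\<in>G. homogeneous 3 g} = 12 * (n choose 3) \<and>
        card {g\<in>G. homogeneous 4 g} = 4 * ((n + 1) choose 4) \<and>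
        (\<forall>g\<in>G. squarefree_mon (lead_mon g))) \<and>
     radical_ideal n (initial_ideal n (concurrent_ideal n))"
proof -
  have I: "concurrent_ideal n = gen_ideal n" by (simp add: concurrent_ideal_eq gen_ideal_eq)
  have elem: "homogeneous 2 g \<or> homogeneous 3 g \<or> homogeneous 4 g" "squarefree_mon (lead_mon g)"
    if "g \<in> gb_elem n ` nonfaces n" for g
  proof -
    from that obtain B where B: "B \<in> nonfaces n" "g = gb_elem n B" by blast
    show "homogeneous 2 g \<or> homogeneous 3 g \<or> homogeneous 4 g"
      using gb_elem(4)[OF B(1)] nonfaces_finite(3)[OF B(1)] B(2) by auto
    show "squarefree_mon (lead_mon g)"
      using nonfaces_finite(1)[OF B(1)] by (simp add: B(2) gb_elem(3)[OF B(1)] squarefree_mon_def lookup_sqf)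
  qed
  show ?thesis
    unfolding I initial_ideal_eq gens_def[symmetric]
  proof (intro conjI ballI allI impI)
    show "primeideal (gen_ideal n) (poly_ring n)"
      unfolding gen_ideal_eq by (rule primeideal_vanishing)
    show "\<exists>!G. reduced_groebner_basis n (gen_ideal n) G"
      using reduced_groebner_basis_gb_elem reduced_groebner_basis_unique by (rule ex1I)
  next
    fix G assume "reduced_groebner_basis n (gen_ideal n) G"
    then have G: "G = gb_elem n ` nonfaces n" by (rule reduced_groebner_basis_unique)
    show "card {g \<in> G. homogeneous 2 g} = (n + 1) choose 2"
      unfolding G card_homogeneous_gb_elem nonfaces_of_card by (rule card_nonfaces2)
    show "card {g \<in> G. homogeneous 3 g} = 12 * (n choose 3)"
      unfolding G card_homogeneous_gb_elem nonfaces_of_card by (rule card_nonfaces3)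
    show "card {g \<in> G. homogeneous 4 g} = 4 * ((n + 1) choose 4)"
      unfolding G card_homogeneous_gb_elem nonfaces_of_card by (rule card_nonfaces4)
    fix g assume "g \<in> G"
    then show "homogeneous 2 g \<or> homogeneous 3 g \<or> homogeneous 4 g" "squarefree_mon (lead_mon g)"
      unfolding G by (rule elem)+
  qed (rule minor_cases card_quadrics card_cubics quadrics_cubics_disjoint minimally_generates_gens
      radical_nonstandard_ideal; assumption)+
qed

end
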